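(* Let $\mathbf{D}\in\mathbb{R}^{d\times d}$ be a positive definite diagonal matrix and $\mathbf{C}\in\mathbb{R}^{d\times d}$ a positive stable matrix (all eigenvalues have positive real part) such that $\mathbf{D}=\frac{\mathbf{C}+\mathbf{C}^T}{2}$. Let $g_0\in L^2(\mathbb{R}^d,f_\infty^{-1})$ and let $g$ be the solution of the Fokker-Planck equation $\partial_tg=\mathrm{div}(\mathbf{D}\nabla g+\mathbf{C}xg)$ with initial datum $g_0$. Assume in addition that $$\int_{\mathbb{R}^d}g_0(x)\,\partial_{x_i}f_\infty(x)\,f_\infty(x)^{-1}\,dx=0,\qquad\forall i=1,\dots,d.$$ Then for any positive definite matrix $\mathbf{P}$ such that $\mathbf{C}^T\mathbf{P}+\mathbf{P}\mathbf{C}\ge2\lambda\mathbf{P}$ for some $\lambda>0$ we have that for any $t>0$, $I_2(g(t)|f_\infty)<\infty$ and $$\frac{d}{dt}I_2^{\mathbf{P}}(g(t)|f_\infty)\le-2(\lambda+\mathrm{d}_{\min})\,I_2^{\mathbf{P}}(g(t)|f_\infty),$$ where $\mathrm{d}_{\min}>0$ is the minimal eigenvalue of $\mathbf{D}$. Consequently, for any $t_0>0$ and all $t\ge t_0$, $$I_2^{\mathbf{P}}(g(t)|f_\infty)\le I_2^{\mathbf{P}}(g(t_0)|f_\infty)\,e^{-2(\lambda+\mathrm{d}_{\min})(t-t_0)}.$$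
   Context: Here $f_\infty(x)=(2\pi)^{-d/2}e^{-|x|^2/2}$ is the standard Gaussian (the unique unit-mass equilibrium of the equation under these assumptions). $L^2(\mathbb{R}^d,f_\infty^{-1})$ is the space of real functions with $\int|g|^2f_\infty^{-1}dx<\infty$. For a positive (semi-)definite matrix $\mathbf{P}$, $$I_2^{\mathbf{P}}(g|f_\infty):=\int_{\mathbb{R}^d}\nabla\Big(\frac{g(x)}{f_\infty(x)}\Big)^T\mathbf{P}\,\nabla\Big(\frac{g(x)}{f_\infty(x)}\Big)f_\infty(x)\,dx,$$ and $I_2:=I_2^{\mathbf{D}}$; no sign condition on $g$ is required. The solution with initial datum $g_0$ is given for $t>0$ by $$g(t,x)=\frac{1}{(2\pi)^{d/2}\sqrt{\det\mathbf{W}(t)}}\int_{\mathbb{R}^d}e^{-\frac12(x-e^{-\mathbf{C}t}y)^T\mathbf{W}(t)^{-1}(x-e^{-\mathbf{C}t}y)}g_0(y)\,dy,\quad \mathbf{W}(t):=2\int_0^te^{-\mathbf{C}s}\mathbf{D}e^{-\mathbf{C}^Ts}ds.$$ *)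

theory Defs
  imports "HOL-Analysis.Analysis"
begin

text \<open>\<open>*\<close> on vectors is componentwise and \<^typ>\<open>real^'n^'n\<close> is no instance of
  \<^class>\<open>real_normed_algebra_1\<close>, so the library's \<^const>\<open>exp\<close> does not apply to matrices; we use
  the exponential series directly.\<close>

definition matrix_exp :: "real^'n^'n \<Rightarrow> real^'n^'n" where
  "matrix_exp A = (\<Sum>k. (1 / fact k) *\<^sub>R (((**) A ^^ k) (mat 1)))"

definition eigenvalue :: "'a::field^'n^'n \<Rightarrow> 'a \<Rightarrow> bool" where
  "eigenvalue A \<mu> \<longleftrightarrow> (\<exists>v. v \<noteq> 0 \<and> A *v v = \<mu> *s v)"

definition positive_stable :: "real^'n^'n \<Rightarrow> bool" where
  "positive_stable A \<longleftrightarrow>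
     (\<forall>\<mu>::complex. eigenvalue (\<chi> i j. complex_of_real (A $ i $ j)) \<mu> \<longrightarrow> Re \<mu> > 0)"

definition positive_definite :: "real^'n^'n \<Rightarrow> bool" where
  "positive_definite A \<longleftrightarrow> transpose A = A \<and> (\<forall>x. x \<noteq> 0 \<longrightarrow> x \<bullet> (A *v x) > 0)"

text \<open>\<open>loewner_le A B\<close> is the order \<open>A \<le> B\<close> of matrix inequalities: \<open>B - A\<close> is
  (symmetric) positive semidefinite.\<close>

definition loewner_le :: "real^'n^'n \<Rightarrow> real^'n^'n \<Rightarrow> bool" where
  "loewner_le A B \<longleftrightarrow> transpose (B - A) = B - A \<and> (\<forall>x. x \<bullet> ((B - A) *v x) \<ge> 0)"

definition diagonal_matrix :: "real^'n^'n \<Rightarrow> bool" where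
  "diagonal_matrix A \<longleftrightarrow> (\<forall>i j. i \<noteq> j \<longrightarrow> A $ i $ j = 0)"

definition min_eigenvalue :: "real^'n^'n \<Rightarrow> real" where
  "min_eigenvalue A = Min {\<mu>. eigenvalue A \<mu>}"

definition gradient :: "(real^'n \<Rightarrow> real) \<Rightarrow> real^'n \<Rightarrow> real^'n" where
  "gradient f x = (\<chi> i. frechet_derivative f (at x) (axis i 1))"

definition f_inf :: "real^'n \<Rightarrow> real" where
  "f_inf x = (2 * pi) powr (- real CARD('n) / 2) * exp (- (norm x)\<^sup>2 / 2)"

definition weighted_L2 :: "(real^'n \<Rightarrow> real) \<Rightarrow> bool" where
  "weighted_L2 g \<longleftrightarrow>
     g \<in> borel_measurable lebesgue \<and> integrable lebesgue (\<lambda>x. (g x)\<^sup>2 / f_inf x)"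

text \<open>The integrand is nonnegative for positive (semi-)definite \<open>P\<close>, so the functional is a
  \<open>[0, \<infinity>]\<close>-valued integral and finiteness is a genuine statement.\<close>

definition fisher_information :: "real^'n^'n \<Rightarrow> (real^'n \<Rightarrow> real) \<Rightarrow> ennreal" where
  "fisher_information P g =
     (\<integral>\<^sup>+ x. ennreal ((let v = gradient (\<lambda>y. g y / f_inf y) x in v \<bullet> (P *v v)) * f_inf x)
        \<partial>lebesgue)"

definition W_matrix :: "real^'n^'n \<Rightarrow> real^'n^'n \<Rightarrow> real \<Rightarrow> real^'n^'n" where
  "W_matrix C D t =
     2 *\<^sub>R integral {0..t}
       (\<lambda>s. matrix_exp ((- s) *\<^sub>R C) ** D ** matrix_exp ((- s) *\<^sub>R transpose C))"

text \<open>The solution of \<open>\<partial>\<^sub>t g = div (D \<nabla>g + C x g)\<close> with initial datum \<open>g0\<close>, given for \<open>t > 0\<close> by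
  the Gaussian transition kernel of the equation.\<close>

definition fokker_planck_solution ::
  "real^'n^'n \<Rightarrow> real^'n^'n \<Rightarrow> (real^'n \<Rightarrow> real) \<Rightarrow> real \<Rightarrow> real^'n \<Rightarrow> real" where
  "fokker_planck_solution C D g0 t x =
     1 / ((2 * pi) powr (real CARD('n) / 2) * sqrt (det (W_matrix C D t))) *
     (LINT y|lebesgue.
        exp (- (1 / 2) * (let z = x - matrix_exp ((- t) *\<^sub>R C) *v y
                          in z \<bullet> (matrix_inv (W_matrix C D t) *v z))) * g0 y)"

end

theory Submission
  imports Defs "HOL-Complex_Analysis.Complex_Analysis" "HOL-Probability.Characteristic_Functions"
begin

text \<open>
  Write \<open>A\<^sub>t = exp (- t C)\<close> and let \<open>F\<^sub>t(z) = exp (- z \<cdot> z / 2) \<integral> exp (z \<cdot> y) g(t, y) dy\<close> be the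
  Bargmann transform of the solution, an entire function on \<open>\<complex>\<^sup>n\<close>. Since \<open>C + C\<^sup>T = 2 D\<close>, the
  covariance is \<open>W(t) = 1 - A\<^sub>t A\<^sub>t\<^sup>T\<close> and the evolution becomes the substitution
  \<open>F\<^sub>t(z) = F\<^sub>0(A\<^sub>t\<^sup>T z)\<close>. The transform takes the Gaussian \<open>L\<^sup>2\<close> norm of \<open>g / f\<^sub>\<infinity>\<close> to the Fock
  norm and intertwines derivatives, so the Fisher information is, up to a constant, the sum of the
  squared Fock norms of the components of \<open>Q \<nabla>F\<^sub>t\<close>, where \<open>P = Q\<^sup>T Q\<close>.

  By the moment condition \<open>\<nabla>F\<^sub>0\<close> vanishes at \<open>0\<close>. Precomposition with a matrix of norm at most
  \<open>\<theta> < 1\<close> multiplies the Fock norm of an entire function vanishing at \<open>0\<close> by at most \<open>\<theta>\<close>: for a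
  scalar this is Schwarz's lemma, and a contraction does not increase the Fock norm by the mean value
  property and Jensen's inequality. With \<open>d\<close> the least eigenvalue of \<open>D\<close> this applies to
  \<open>A\<^sub>s\<^sup>T\<close> with \<open>\<theta> = exp (- d s)\<close>, while the matrix inequality makes \<open>A\<^sub>s\<close>, acting on the values
  of the gradient, a contraction by \<open>exp (- \<lambda> s)\<close> in the norm of \<open>P\<close>. The resulting exponential
  decay on every interval \<open>[t, t + s]\<close> yields the differential inequality, because the Fock norms
  depend differentiably on \<open>t\<close>.
\<close>

section \<open>Linear substitutions and Gaussian integrals\<close>

text \<open>The transform of a datum in the weighted space grows at most like
  \<open>exp (|z|^2 / 2)\<close>. Squared, this is exactly the size that the Fock weight
  \<open>exp (- |z|^2)\<close> cannot absorb, so at time 0 growth bounds give nothing. For t > 0 the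
  substitution by the transpose of A_t, of norm at most exp (- d t) < 1, pushes the exponent
  strictly below 1/2. This gain gives finiteness, absolutely convergent integrals and
  differentiability in t, and it is why every estimate of the flow is stated for positive times.

  That norm bound is where the relation between C and D enters a second time: x . Cx depends only on
  the symmetric part of C, so it equals x . Dx and is at least d |x|^2.

  The derivative of the Fisher information is never computed. An identity for it would involve
  second derivatives of the solution and integration by parts; instead, decay over intervals is
  combined with the bare existence of the derivative. The solution is likewise never differentiated
  through its kernel: derivatives in x are moved to the entire function by shifting the line of
  integration.\<close>

lemma inner_matrix_transpose:
  fixes A :: "real^'n^'m"
  shows "x \<bullet> (A *v y) = (transpose A *v x) \<bullet> y"
  by (simp add: dot_lmul_matrix)

section \<open>Positive definite matrices as Gram matrices\<close>

lemma posdef_symmetric: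
  assumes "positive_definite K"
  shows "x \<bullet> (K *v y) = y \<bullet> (K *v x)"
  using assms by (metis inner_commute inner_matrix_transpose positive_definite_def)

text \<open>Gram-Schmidt for the inner product \<open>x \<bullet> (K *v y)\<close>: fewer than
  \<open>CARD('n)\<close> vectors span a proper subspace, so a vector outside it can be
  orthogonalised and normalised.\<close>

lemma posdef_orthonormal_set:
  fixes K :: "real^'n^'n"
  assumes K: "positive_definite K" and "m \<le> CARD('n)"
  shows "\<exists>S. finite S \<and> card S = m \<and> (\<forall>u\<in>S. \<forall>v\<in>S. u \<bullet> (K *v v) = (if u = v then 1 else 0))"
  using \<open>m \<le> CARD('n)\<close>
proof (induction m)
  case 0
  show ?case by (intro exI[of _ "{}"]) auto
next
  case (Suc m)
  then obtain S where S: "finite S" "card S = m"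
    and o: "\<And>u v. u \<in> S \<Longrightarrow> v \<in> S \<Longrightarrow> u \<bullet> (K *v v) = (if u = v then 1 else 0)"
    by auto
  have "dim (span S) \<le> m"
    using S dim_le_card' by (metis dim_span)
  then have "span S \<noteq> UNIV"
    using Suc.prems by (metis DIM_cart DIM_real Suc_le_lessD dim_UNIV leD mult.right_neutral)
  then obtain x where x: "x \<notin> span S" by auto
  define w where "w = x - (\<Sum>s\<in>S. (x \<bullet> (K *v s)) *\<^sub>R s)"
  have "w \<noteq> 0"
  proof
    assume "w = 0"
    then have "x = (\<Sum>s\<in>S. (x \<bullet> (K *v s)) *\<^sub>R s)" by (simp add: w_def)
    moreover have "(\<Sum>s\<in>S. (x \<bullet> (K *v s)) *\<^sub>R s) \<in> span S"
      by (intro span_sum span_scale span_base)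
    ultimately show False using x by metis
  qed
  have wo: "w \<bullet> (K *v s) = 0" if "s \<in> S" for s
  proof -
    have "w \<bullet> (K *v s) = x \<bullet> (K *v s) - (\<Sum>r\<in>S. (x \<bullet> (K *v r)) * (r \<bullet> (K *v s)))"
      by (simp add: w_def inner_diff_left inner_sum_left)
    also have "(\<Sum>r\<in>S. (x \<bullet> (K *v r)) * (r \<bullet> (K *v s))) = (\<Sum>r\<in>S. if r = s then x \<bullet> (K *v s) else 0)"
      using that by (intro sum.cong) (auto simp: o)
    finally show ?thesis using that S by simp
  qed
  define q where "q = w \<bullet> (K *v w)"
  have q: "q > 0" using K \<open>w \<noteq> 0\<close> by (simp add: q_def positive_definite_def)
  define u where "u = (1 / sqrt q) *\<^sub>R w"
  have uu: "u \<bullet> (K *v u) = 1"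
    using q by (simp add: u_def matrix_vector_mult_scaleR flip: q_def)
  have us: "u \<bullet> (K *v s) = 0" "s \<bullet> (K *v u) = 0" if "s \<in> S" for s
    using wo[OF that] posdef_symmetric[OF K, of u s] by (simp_all add: u_def)
  have "u \<notin> S" using us uu by force
  then show ?case
    using S uu us o by (intro exI[of _ "insert u S"]) auto
qed

text \<open>The columns of \<open>R\<close> are an orthonormal basis for the inner product of
  \<open>K\<close>, so that R^T K R = 1; the inverse of \<open>R\<close> is the required
  factor.\<close>

lemma posdef_factorization:
  fixes K :: "real^'n^'n"
  assumes K: "positive_definite K"
  obtains Q :: "real^'n^'n" where "invertible Q" "K = transpose Q ** Q"
proof -
  obtain S where S: "finite S" "card S = CARD('n)"
    and o: "\<And>u v. u \<in> S \<Longrightarrow> v \<in> S \<Longrightarrow> u \<bullet> (K *v v) = (if u = v then 1 else 0)"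
    using posdef_orthonormal_set[OF K order_refl] by auto
  obtain b :: "'n \<Rightarrow> real^'n" where b: "bij_betw b UNIV S"
    using S by (metis finite_UNIV bij_betw_iff_card finite)
  define R :: "real^'n^'n" where "R = (\<chi> i j. b j $ i)"
  have Rc: "R *v axis j 1 = b j" for j
    by (simp add: R_def vec_eq_iff matrix_vector_mult_basis column_def)
  have e: "transpose R ** K ** R = mat 1"
  proof -
    have "(transpose R ** K ** R) $ i $ j = (mat 1 :: real^'n^'n) $ i $ j" for i j
    proof -
      have "(transpose R ** K ** R) $ i $ j = axis i 1 \<bullet> ((transpose R ** K ** R) *v axis j 1)"
        by (simp add: inner_axis' matrix_vector_mult_basis column_def)
      also have "\<dots> = b i \<bullet> (K *v b j)"
        by (simp only: inner_matrix_transpose[of _ "transpose R"] matrix_vector_mul_assoc[symmetric]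
            transpose_transpose Rc)
      also have "\<dots> = (if i = j then 1 else 0)"
        using b o[of "b i" "b j"] by (auto simp: bij_betw_def inj_eq)
      finally show ?thesis by (simp add: mat_def)
    qed
    then show ?thesis by (simp add: vec_eq_iff)
  qed
  have inv: "invertible R"
    using e invertible_left_inverse by blast
  define Q where "Q = matrix_inv R"
  have QR: "Q ** R = mat 1" "R ** Q = mat 1"
    unfolding Q_def using inv by (auto simp: matrix_inv_def invertible_def intro: someI2_ex)
  have iQ: "invertible Q" using QR by (auto simp: invertible_def)
  have "transpose Q ** (transpose R ** K ** R) ** Q = transpose (R ** Q) ** K ** (R ** Q)"
    by (simp add: matrix_transpose_mul matrix_mul_assoc)
  then have "K = transpose Q ** Q"
    by (simp add: e QR)
  with iQ show ?thesis using that by blast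
qed

section \<open>Lebesgue measure under linear maps\<close>

lemma nn_integral_lborel_translate:
  fixes F :: "'a::euclidean_space \<Rightarrow> ennreal"
  assumes [measurable]: "F \<in> borel_measurable borel"
  shows "(\<integral>\<^sup>+x. F (t + x) \<partial>lborel) = (\<integral>\<^sup>+x. F x \<partial>lborel)"
proof -
  have "(\<integral>\<^sup>+x. F x \<partial>lborel) = (\<integral>\<^sup>+x. F x \<partial>distr lborel borel ((+) t))"
    by (simp add: lborel_distr_plus)
  then show ?thesis by (simp add: nn_integral_distr)
qed

lemma nn_integral_lborel_reflect:
  fixes F :: "'a::euclidean_space \<Rightarrow> ennreal"
  assumes [measurable]: "F \<in> borel_measurable borel"
  shows "(\<integral>\<^sup>+x. F (- x) \<partial>lborel) = (\<integral>\<^sup>+x. F x \<partial>lborel)"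
  using arg_cong[OF lborel_affine[of "-1" "0::'a"], of "\<lambda>M. nn_integral M F"]
  by (simp add: nn_integral_density nn_integral_distr)

text \<open>Uniqueness of the translation-invariant measure: shifting \<open>y\<close> by \<open>f x\<close> and then \<open>x\<close>
  by \<open>f\<^sup>-\<^sup>1 y\<close> exchanges the roles of \<open>F\<close> and the indicator of the unit cube.\<close>

lemma nn_integral_linear_scale:
  fixes f :: "'a::euclidean_space \<Rightarrow> 'a"
  assumes f: "linear f" "bij f"
  obtains c where "\<And>F. F \<in> borel_measurable borel \<Longrightarrow>
    (\<integral>\<^sup>+x. F (f x) \<partial>lborel) = c * (\<integral>\<^sup>+x. F x \<partial>lborel)"
proof
  fix F :: "'a \<Rightarrow> ennreal"
  assume [measurable]: "F \<in> borel_measurable borel"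
  define G where "G = (indicator (cbox 0 One) :: 'a \<Rightarrow> ennreal)"
  have [measurable]: "G \<in> borel_measurable borel" by (simp add: G_def)
  have [measurable]: "f \<in> borel_measurable borel"
    using f(1) by (intro borel_measurable_continuous_onI linear_continuous_on) (simp add: linear_linear)
  have G1: "(\<integral>\<^sup>+y. G y \<partial>lborel) = 1"
    by (simp add: G_def emeasure_lborel_cbox_eq)
  have fi: "f (inv f y) = y" for y using f(2) by (simp add: bij_is_surj surj_f_inv_f)
  have "(\<integral>\<^sup>+x. F (f x) \<partial>lborel) = (\<integral>\<^sup>+x. \<integral>\<^sup>+y. F (f x) * G y \<partial>lborel \<partial>lborel)"
    by (simp add: nn_integral_cmult G1)
  also have "\<dots> = (\<integral>\<^sup>+x. \<integral>\<^sup>+y. F (f x) * G (f x + y) \<partial>lborel \<partial>lborel)"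
    by (simp add: nn_integral_cmult nn_integral_lborel_translate)
  also have "\<dots> = (\<integral>\<^sup>+y. \<integral>\<^sup>+x. F (f x) * G (f x + y) \<partial>lborel \<partial>lborel)"
    by (rule lborel_pair.Fubini'[symmetric]) measurable
  also have "\<dots> = (\<integral>\<^sup>+y. \<integral>\<^sup>+x. F (f (- inv f y + x)) * G (f (- inv f y + x) + y) \<partial>lborel \<partial>lborel)"
    by (intro nn_integral_cong nn_integral_lborel_translate[symmetric, where F = "\<lambda>x. F (f x) * G (f x + y)" for y]) measurable
  also have "\<dots> = (\<integral>\<^sup>+y. \<integral>\<^sup>+x. F (f x - y) * G (f x) \<partial>lborel \<partial>lborel)"
    using f(1) by (simp add: linear_diff fi)
  also have "\<dots> = (\<integral>\<^sup>+x. \<integral>\<^sup>+y. F (f x - y) * G (f x) \<partial>lborel \<partial>lborel)"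
    by (rule lborel_pair.Fubini') measurable
  also have "\<dots> = (\<integral>\<^sup>+x. (\<integral>\<^sup>+y. F y \<partial>lborel) * G (f x) \<partial>lborel)"
  proof (rule nn_integral_cong)
    fix x
    have "(\<integral>\<^sup>+y. F (f x - y) \<partial>lborel) = (\<integral>\<^sup>+y. F (f x + y) \<partial>lborel)"
      using nn_integral_lborel_reflect[of "\<lambda>y. F (f x + y)"] by simp
    also have "\<dots> = (\<integral>\<^sup>+y. F y \<partial>lborel)" by (rule nn_integral_lborel_translate) simp
    finally show "(\<integral>\<^sup>+y. F (f x - y) * G (f x) \<partial>lborel) = (\<integral>\<^sup>+y. F y \<partial>lborel) * G (f x)"
      by (simp add: nn_integral_multc)
  qed
  also have "\<dots> = (\<integral>\<^sup>+x. indicator (cbox 0 One) (f x) \<partial>lborel) * (\<integral>\<^sup>+y. F y \<partial>lborel)"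
    by (simp add: nn_integral_cmult G_def mult.commute)
  finally show "(\<integral>\<^sup>+x. F (f x) \<partial>lborel) = (\<integral>\<^sup>+x. indicator (cbox 0 One) (f x) \<partial>lborel) * (\<integral>\<^sup>+y. F y \<partial>lborel)" .
qed

text \<open>The scaling factor of a linear bijection is read off from a single test function, the
  indicator of the image of the unit cube. Coordinate swaps and shears are settled by this
  criterion.\<close>

lemma nn_integral_linear_unit_cube:
  fixes f :: "'a::euclidean_space \<Rightarrow> 'a" and F :: "'a \<Rightarrow> ennreal"
  assumes f: "linear f" "bij f" and cube: "emeasure lborel (f ` cbox 0 One) = 1"
    and F: "F \<in> borel_measurable borel"
  shows "(\<integral>\<^sup>+x. F (f x) \<partial>lborel) = (\<integral>\<^sup>+x. F x \<partial>lborel)"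
proof -
  obtain c where c: "\<And>F. F \<in> borel_measurable borel \<Longrightarrow>
    (\<integral>\<^sup>+x. F (f x) \<partial>lborel) = c * (\<integral>\<^sup>+x. F x \<partial>lborel)"
    using nn_integral_linear_scale[OF f] by blast
  have m: "f ` cbox 0 One \<in> sets borel"
    using f(1) by (intro borel_closed compact_imp_closed compact_continuous_image linear_continuous_on)
      (auto simp: linear_linear)
  have "1 = (\<integral>\<^sup>+x. indicator (f ` cbox 0 One) (f x) \<partial>lborel)"
    using f(2) by (simp add: indicator_image bij_is_inj emeasure_lborel_cbox_eq)
  also have "\<dots> = c"
    using c[of "indicator (f ` cbox 0 One)"] m cube by simp
  finally show ?thesis using c[OF F] by simp
qed

text \<open>Decomposition into elementary matrices. The premise on the determinant makes the case of
  a zero row vacuous and passes from a product to both factors. Diagonal matrices scale the axes,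
  swaps map the unit cube onto itself, shears preserve its volume. \<open>F\<close> is quantified
  inside the induction because in a product the claim for \<open>B\<close> is applied to F composed
  with \<open>A\<close>.\<close>

lemma nn_integral_matrix_image:
  fixes Q :: "real^'n^'n"
  shows "det Q \<noteq> 0 \<longrightarrow> (\<forall>F\<in>borel_measurable borel.
    ennreal \<bar>det Q\<bar> * (\<integral>\<^sup>+x. F (Q *v x) \<partial>lborel) = (\<integral>\<^sup>+x. F x \<partial>lborel))" (is "?P Q")
proof (induction rule: induct_matrix_elementary_alt[where P = ?P])
  fix A B :: "real^'n^'n"
  assume P: "?P A" "?P B"
  show "?P (A ** B)"
  proof (intro impI ballI)
    fix F :: "real^'n \<Rightarrow> ennreal"
    assume d: "det (A ** B) \<noteq> 0" and [measurable]: "F \<in> borel_measurable borel"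
    have [measurable]: "(*v) A \<in> borel_measurable borel"
      by (intro borel_measurable_continuous_onI continuous_intros)
    have "(\<integral>\<^sup>+x. F x \<partial>lborel) = ennreal \<bar>det A\<bar> * (\<integral>\<^sup>+x. F (A *v x) \<partial>lborel)"
      using P(1) d by (simp add: det_mul)
    also have "(\<integral>\<^sup>+x. F (A *v x) \<partial>lborel) = ennreal \<bar>det B\<bar> * (\<integral>\<^sup>+x. F (A *v (B *v x)) \<partial>lborel)"
      using P(2)[rule_format, of "\<lambda>x. F (A *v x)"] d by (simp add: det_mul)
    finally show "ennreal \<bar>det (A ** B)\<bar> * (\<integral>\<^sup>+x. F ((A ** B) *v x) \<partial>lborel) = (\<integral>\<^sup>+x. F x \<partial>lborel)"
      by (simp add: det_mul abs_mult ennreal_mult mult.assoc matrix_vector_mul_assoc)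
  qed
next
  fix A :: "real^'n^'n" and i
  assume "row i A = 0"
  then show "?P A" by (simp add: det_zero_row)
next
  fix A :: "real^'n^'n"
  assume diag: "\<And>i j. i \<noteq> j \<Longrightarrow> A $ i $ j = 0"
  show "?P A"
  proof (intro impI ballI)
    fix F :: "real^'n \<Rightarrow> ennreal"
    assume d: "det A \<noteq> 0" and [measurable]: "F \<in> borel_measurable borel"
    have dA: "det A = (\<Prod>i\<in>UNIV. A $ i $ i)" by (rule det_diagonal) (rule diag)
    define c where "c j = A $ (axis_index j) $ (axis_index j)" for j :: "real^'n"
    have cx: "c (axis i 1) = A $ i $ i" for i by (simp add: c_def axis_index_axis)
    have B: "(Basis :: (real^'n) set) = (\<lambda>i. axis i 1) ` UNIV" by (auto simp: Basis_vec_def)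
    have inj: "inj (\<lambda>i::'n. axis i (1::real))" by (auto simp: inj_def axis_eq_axis)
    have c0: "c j \<noteq> 0" if "j \<in> Basis" for j
      using that d by (auto simp: B cx dA)
    have T: "0 + (\<Sum>j\<in>Basis. (c j * (x \<bullet> j)) *\<^sub>R j) = A *v x" for x
    proof -
      have "(\<Sum>j\<in>Basis. (c j * (x \<bullet> j)) *\<^sub>R j) = (\<Sum>i\<in>UNIV. (A $ i $ i * x $ i) *\<^sub>R axis i 1)"
        unfolding B by (subst sum.reindex[OF inj]) (simp add: cx inner_axis)
      also have "\<dots> = A *v x"
      proof (unfold vec_eq_iff, intro allI)
        fix k
        have "(A *v x) $ k = (\<Sum>j\<in>UNIV. if j = k then A $ k $ k * x $ k else 0)"
          unfolding matrix_vector_mult_def vec_lambda_beta by (intro sum.cong) (auto simp: diag)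
        then show "(\<Sum>i\<in>UNIV. (A $ i $ i * x $ i) *\<^sub>R axis i 1) $ k = (A *v x) $ k"
          by (simp add: axis_def if_distrib cong: if_cong)
      qed
      finally show ?thesis by simp
    qed
    have p: "(\<Prod>j\<in>Basis. \<bar>c j\<bar>) = \<bar>det A\<bar>"
      unfolding B dA by (subst prod.reindex[OF inj]) (simp add: cx abs_prod)
    have [measurable]: "(*v) A \<in> borel_measurable borel"
      by (intro borel_measurable_continuous_onI continuous_intros)
    have "lborel = density (distr lborel borel ((*v) A)) (\<lambda>_. ennreal \<bar>det A\<bar>)"
      using lborel_affine_euclidean[of c 0, OF c0] unfolding T p by simp
    then have "(\<integral>\<^sup>+x. F x \<partial>lborel) = (\<integral>\<^sup>+x. F x \<partial>density (distr lborel borel ((*v) A)) (\<lambda>_. ennreal \<bar>det A\<bar>))"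
      by simp
    then show "ennreal \<bar>det A\<bar> * (\<integral>\<^sup>+x. F (A *v x) \<partial>lborel) = (\<integral>\<^sup>+x. F x \<partial>lborel)"
      by (simp add: nn_integral_density nn_integral_distr nn_integral_cmult)
  qed
next
  fix m n :: 'n
  assume "m \<noteq> n"
  define A :: "real^'n^'n" where "A = (\<chi> i j. mat 1 $ i $ Transposition.transpose m n j)"
  have Ax: "A *v x = (\<chi> i. x $ Transposition.transpose m n i)" for x
  proof (unfold vec_eq_iff, intro allI)
    fix i
    have "(A *v x) $ i = (\<Sum>j\<in>UNIV. if j = Transposition.transpose m n i then x $ j else 0)"
      unfolding matrix_vector_mult_def A_def mat_def vec_lambda_beta
      by (intro sum.cong) (auto simp: transpose_eq_iff)
    then show "(A *v x) $ i = (\<chi> i. x $ Transposition.transpose m n i) $ i" by simp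
  qed
  have AA: "A *v (A *v x) = x" for x by (simp add: Ax vec_eq_iff)
  have d: "\<bar>det A\<bar> = 1"
    unfolding A_def by (subst det_permute_columns) (auto simp: permutes_swap_id sign_swap_id)
  have "(One :: real^'n) $ i = 1" for i
    using inner_sum_left_Basis[of "axis i 1 :: real^'n" "\<lambda>_. 1"]
    by (auto simp: cart_eq_inner_axis Basis_vec_def simp del: sum_component)
  then have "A *v x \<in> cbox 0 One" if "x \<in> cbox 0 One" for x
    using that by (auto simp: Ax mem_box_cart simp del: sum_component)
  note cube = this
  have "(*v) A ` cbox 0 One = cbox 0 One"
  proof (intro equalityI image_subsetI subsetI)
    fix x :: "real^'n"
    assume "x \<in> cbox 0 One"
    then show "A *v x \<in> cbox 0 One" by (rule cube)
    then show "x \<in> (*v) A ` cbox 0 One" by (rule image_eqI[rotated]) (rule AA[symmetric])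
  qed
  then have "emeasure lborel ((*v) A ` cbox 0 One) = 1"
    by (simp add: emeasure_lborel_cbox_eq)
  moreover have "bij ((*v) A)"
    using AA by (rule involuntory_imp_bij)
  ultimately have "(\<integral>\<^sup>+x. F (A *v x) \<partial>lborel) = (\<integral>\<^sup>+x. F x \<partial>lborel)"
    if "F \<in> borel_measurable borel" for F
    using nn_integral_linear_unit_cube[of "(*v) A"] that by (metis matrix_vector_mul_linear)
  then show "?P (\<chi> i j. mat 1 $ i $ Transposition.transpose m n j)"
    unfolding A_def[symmetric] d by (metis ennreal_1 mult_1)
next
  fix m n :: 'n
  assume mn: "m \<noteq> n"
  define A :: "real^'n^'n" where "A = (\<chi> i j. of_bool (i = m \<and> j = n \<or> i = j))"
  have Ax: "A *v x = (\<chi> i. if i = m then x $ m + x $ n else x $ i)" for x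
  proof (unfold vec_eq_iff, intro allI)
    fix i
    have "(A *v x) $ i = (\<Sum>j\<in>UNIV. (if i = m \<and> j = n then x $ j else 0) + (if j = i then x $ j else 0))"
      unfolding matrix_vector_mult_def A_def vec_lambda_beta
      by (intro sum.cong) (use mn in auto)
    also have "\<dots> = (\<Sum>j\<in>UNIV. (if i = m \<and> j = n then x $ j else 0)) + x $ i"
      by (simp add: sum.distrib)
    finally show "(A *v x) $ i = (\<chi> i. if i = m then x $ m + x $ n else x $ i) $ i"
      using mn by (cases "i = m") auto
  qed
  have "det A = det (\<chi> k. if k = m then row m (mat 1) + 1 *s row n (mat 1) else row k (mat 1))"
    using mn by (intro arg_cong[of _ _ det]) (auto simp: A_def vec_eq_iff row_def mat_def)
  also have "\<dots> = 1"
    by (subst det_row_operation[OF mn]) (rule det_I)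
  finally have d: "det A = 1" .
  then have b: "bij ((*v) A)"
    by (metis invertible_det_nz invertible_eq_bij zero_neq_one)
  have "measure lebesgue ((*v) A ` cbox 0 One) = measure lebesgue (cbox 0 (One::real^'n))"
    unfolding Ax by (rule measure_shear_interval[OF mn]) auto
  moreover have "(*v) A ` cbox 0 One \<in> lmeasurable"
    by (simp add: measurable_linear_image_interval matrix_vector_mul_linear)
  ultimately have "emeasure lebesgue ((*v) A ` cbox 0 One) = ennreal (measure lebesgue (cbox 0 (One::real^'n)))"
    by (metis emeasure_eq_measure2)
  also have "measure lebesgue (cbox 0 (One::real^'n)) = 1"
    using content_unit[where 'a = "real^'n"] by (simp only: measure_completion sets_lborel cbox_borel)
  moreover have "(*v) A ` cbox 0 One \<in> sets borel"
    by (intro borel_closed compact_imp_closed compact_continuous_image) (auto intro!: continuous_intros)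
  ultimately have "emeasure lborel ((*v) A ` cbox 0 One) = 1"
    by (simp add: emeasure_completion)
  then have "(\<integral>\<^sup>+x. F (A *v x) \<partial>lborel) = (\<integral>\<^sup>+x. F x \<partial>lborel)"
    if "F \<in> borel_measurable borel" for F
    using nn_integral_linear_unit_cube[of "(*v) A"] that b by (metis matrix_vector_mul_linear)
  then show "?P (\<chi> i j. of_bool (i = m \<and> j = n \<or> i = j))"
    unfolding A_def[symmetric] d by (metis abs_one ennreal_1 mult_1)
qed

section \<open>Fourier transforms of Gaussian densities\<close>

lemma gaussian_fourier_real:
  fixes t :: real
  shows "integrable lborel (\<lambda>x. of_real (exp (- x\<^sup>2 / 2)) * cis (t * x))"
    and "(LBINT x. of_real (exp (- x\<^sup>2 / 2)) * cis (t * x)) = of_real (sqrt (2 * pi) * exp (- t\<^sup>2 / 2))"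
proof -
  have e: "of_real (exp (- x\<^sup>2 / 2)) * cis (t * x)
      = of_real (sqrt (2 * pi)) * (std_normal_density x *\<^sub>R iexp (t * x))" for x
    by (simp add: std_normal_density_def scaleR_conv_of_real cis_conv_exp mult.commute)
  have i: "integrable lborel (\<lambda>x. std_normal_density x *\<^sub>R iexp (t * x))"
    by (rule Bochner_Integration.integrable_bound[OF integrable_normal_density[of 1 0]]) auto
  then show "integrable lborel (\<lambda>x. of_real (exp (- x\<^sup>2 / 2)) * cis (t * x))"
    unfolding e by (intro integrable_mult_right)
  have "(LBINT x. std_normal_density x *\<^sub>R iexp (t * x)) = of_real (exp (- t\<^sup>2 / 2))"
    using fun_cong[OF char_std_normal_distribution, of t]
    by (simp add: char_def integral_density)
  then show "(LBINT x. of_real (exp (- x\<^sup>2 / 2)) * cis (t * x)) = of_real (sqrt (2 * pi) * exp (- t\<^sup>2 / 2))"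
    by (simp only: e integral_mult_right_zero of_real_mult)
qed

lemma cis_sum: "finite I \<Longrightarrow> cis (\<Sum>i\<in>I. f i) = (\<Prod>i\<in>I. cis (f i))"
proof (induction I rule: finite_induct)
  case (insert x F)
  then show ?case by (simp add: cis_mult[symmetric, of "f x"])
qed simp

text \<open>In coordinates the integrand is a product of one-dimensional factors, so the product
  structure of Lebesgue measure reduces the claim to \<open>gaussian_fourier_real\<close>.\<close>

lemma gaussian_fourier:
  fixes v :: "'a::euclidean_space"
  shows "integrable lborel (\<lambda>x::'a. of_real (exp (- (norm x)\<^sup>2 / 2)) * cis (v \<bullet> x))" (is ?I)
    and "(LBINT x::'a. of_real (exp (- (norm x)\<^sup>2 / 2)) * cis (v \<bullet> x))
      = of_real ((2 * pi) powr (DIM('a) / 2) * exp (- (norm v)\<^sup>2 / 2))" (is ?V)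
proof -
  interpret product_sigma_finite "\<lambda>_::'a. lborel :: real measure" ..
  let ?f = "\<lambda>(b::'a) x. of_real (exp (- x\<^sup>2 / 2)) * cis ((v \<bullet> b) * x)"
  let ?g = "\<lambda>x::'a. of_real (exp (- (norm x)\<^sup>2 / 2)) * cis (v \<bullet> x)"
  have g: "?g (\<Sum>b\<in>Basis. f b *\<^sub>R b) = (\<Prod>b\<in>Basis. ?f b (f b))" for f
  proof -
    have "(norm (\<Sum>b\<in>Basis. f b *\<^sub>R b :: 'a))\<^sup>2 = (\<Sum>b\<in>Basis. (f b)\<^sup>2)"
      unfolding power2_norm_eq_inner by (subst euclidean_inner) (simp add: power2_eq_square)
    then have "- (norm (\<Sum>b\<in>Basis. f b *\<^sub>R b :: 'a))\<^sup>2 / 2 = (\<Sum>b\<in>Basis. - (f b)\<^sup>2 / 2)"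
      by (simp only: sum_divide_distrib[symmetric] sum_negf)
    moreover have "v \<bullet> (\<Sum>b\<in>Basis. f b *\<^sub>R b) = (\<Sum>b\<in>Basis. (v \<bullet> b) * f b)"
      by (simp add: inner_sum_right mult.commute)
    ultimately show ?thesis
      by (simp only: exp_sum cis_sum finite_Basis of_real_prod prod.distrib)
  qed
  have [measurable]: "?g \<in> borel_measurable borel"
    by (intro borel_measurable_continuous_onI) (auto intro!: continuous_intros)
  have "integrable (\<Pi>\<^sub>M b\<in>(Basis::'a set). lborel) (\<lambda>x. \<Prod>b\<in>Basis. ?f b (x b))"
    by (intro product_integrable_prod gaussian_fourier_real) auto
  then show ?I
    unfolding lborel_eq[where 'a = 'a] by (subst integrable_distr_eq, measurable) (simp only: g)
  have "(LBINT x. ?g x) = (\<integral>x. (\<Prod>b\<in>Basis. ?f b (x b)) \<partial>(\<Pi>\<^sub>M b\<in>(Basis::'a set). lborel))"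
    unfolding lborel_eq[where 'a = 'a] by (subst integral_distr, measurable) (simp only: g)
  also have "\<dots> = (\<Prod>b\<in>(Basis::'a set). of_real (sqrt (2 * pi) * exp (- (v \<bullet> b)\<^sup>2 / 2)))"
    by (subst product_integral_prod, rule finite_Basis, rule gaussian_fourier_real(1))
      (simp only: gaussian_fourier_real(2))
  also have "\<dots> = of_real (\<Prod>b\<in>(Basis::'a set). sqrt (2 * pi) * exp (- (v \<bullet> b)\<^sup>2 / 2))"
    by (simp only: of_real_prod)
  also have "(\<Prod>b\<in>(Basis::'a set). sqrt (2 * pi) * exp (- (v \<bullet> b)\<^sup>2 / 2))
      = sqrt (2 * pi) ^ DIM('a) * exp (\<Sum>b\<in>Basis. - (v \<bullet> b)\<^sup>2 / 2)"
    by (simp add: prod.distrib exp_sum)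
  also have "sqrt (2 * pi) ^ DIM('a) = (2 * pi) powr (DIM('a) / 2)"
    by (simp add: powr_half_sqrt[symmetric] powr_powr flip: powr_realpow)
  also have "(\<Sum>b\<in>Basis. - (v \<bullet> b)\<^sup>2 / 2) = - (norm v)\<^sup>2 / 2"
    unfolding sum_divide_distrib[symmetric] sum_negf power2_norm_eq_inner
    by (subst euclidean_inner) (simp add: power2_eq_square)
  finally show ?V .
qed

lemma matrix_inv_left: "invertible (Q::real^'n^'n) \<Longrightarrow> matrix_inv Q ** Q = mat 1"
  and matrix_inv_right: "invertible (Q::real^'n^'n) \<Longrightarrow> Q ** matrix_inv Q = mat 1"
  by (auto simp: matrix_inv_def invertible_def intro: someI2_ex)

lemma integral_matrix_image:
  fixes Q :: "real^'n^'n" and f :: "real^'n \<Rightarrow> 'b::{banach,second_countable_topology}"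
  assumes Q: "det Q \<noteq> 0" and f: "integrable lborel f"
  shows "integrable lborel (\<lambda>x. f (Q *v x))"
    and "\<bar>det Q\<bar> *\<^sub>R (LBINT x. f (Q *v x)) = (LBINT x. f x)"
proof -
  have [measurable]: "(*v) Q \<in> borel_measurable borel"
    by (intro borel_measurable_continuous_onI continuous_intros)
  have [measurable]: "f \<in> borel_measurable borel" using f by auto
  \<comment> \<open>Tested on indicators, the formula for nonnegative functions identifies Lebesgue
    measure with a weighted image of itself; the substitution then holds for Bochner integrals as
    well.\<close>
  have "lborel = density (distr lborel borel ((*v) Q)) (\<lambda>_. ennreal \<bar>det Q\<bar>)" (is "_ = ?D")
  proof (rule measure_eqI)
    fix X :: "(real^'n) set"
    assume "X \<in> sets lborel"
    then have [measurable]: "X \<in> sets borel" by simp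
    have "emeasure ?D X = (\<integral>\<^sup>+x. indicator X x \<partial>?D)" by simp
    also have "\<dots> = ennreal \<bar>det Q\<bar> * (\<integral>\<^sup>+x. indicator X (Q *v x) \<partial>lborel)"
      by (simp add: nn_integral_density nn_integral_distr nn_integral_cmult del: nn_integral_indicator)
    also have "\<dots> = emeasure lborel X"
      using nn_integral_matrix_image[of Q] Q by simp
    finally show "emeasure lborel X = emeasure ?D X" ..
  qed simp
  note L = this
  have "integrable ?D f" using f L by simp
  then have "integrable (distr lborel borel ((*v) Q)) (\<lambda>x. \<bar>det Q\<bar> *\<^sub>R f x)"
    by (simp add: integrable_density)
  then have "integrable lborel (\<lambda>x. \<bar>det Q\<bar> *\<^sub>R f (Q *v x))"
    by (simp add: integrable_distr_eq)
  from integrable_scaleR_right[of "inverse \<bar>det Q\<bar>", OF this]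
  show "integrable lborel (\<lambda>x. f (Q *v x))"
    using Q by simp
  have "(LBINT x. f x) = (\<integral>x. f x \<partial>?D)" using L by simp
  also have "\<dots> = \<bar>det Q\<bar> *\<^sub>R (LBINT x. f (Q *v x))"
    by (simp add: integral_density integral_distr)
  finally show "\<bar>det Q\<bar> *\<^sub>R (LBINT x. f (Q *v x)) = (LBINT x. f x)" ..
qed

lemma posdef_invertible:
  fixes K :: "real^'n^'n"
  assumes "positive_definite K"
  shows "invertible K" "det K > 0"
proof -
  obtain Q :: "real^'n^'n" where Q: "invertible Q" "K = transpose Q ** Q"
    using posdef_factorization[OF assms] .
  then have "det K = (det Q)\<^sup>2" "det Q \<noteq> 0"
    by (auto simp: det_mul invertible_det_nz power2_eq_square)
  then show "invertible K" "det K > 0" by (auto simp: invertible_det_nz)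
qed

text \<open>With K = Q^T Q the substitution of Q k for k makes the quadratic form Euclidean. The
  frequency turns into \<open>w\<close>, the inverse transpose of \<open>Q\<close> applied to
  \<open>v\<close>, whose squared norm is the quadratic form of the inverse of \<open>K\<close> at
  \<open>v\<close>.\<close>

lemma gaussian_matrix_fourier:
  fixes K :: "real^'n^'n"
  assumes K: "positive_definite K"
  shows "integrable lborel (\<lambda>k. of_real (exp (- (k \<bullet> (K *v k)) / 2)) * cis (v \<bullet> k))" (is ?I)
    and "(LBINT k. of_real (exp (- (k \<bullet> (K *v k)) / 2)) * cis (v \<bullet> k))
      = of_real ((2 * pi) powr (CARD('n) / 2) / sqrt (det K) * exp (- (v \<bullet> (matrix_inv K *v v)) / 2))"
      (is ?V)
proof -
  obtain Q :: "real^'n^'n" where Q: "invertible Q" and KQ: "K = transpose Q ** Q"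
    using posdef_factorization[OF K] .
  define w where "w = transpose (matrix_inv Q) *v v"
  have k: "k \<bullet> (K *v k) = (norm (Q *v k))\<^sup>2" for k
    unfolding KQ power2_norm_eq_inner
    by (simp only: inner_matrix_transpose[of _ "transpose Q"] matrix_vector_mul_assoc[symmetric] transpose_transpose)
  have vk: "v \<bullet> k = w \<bullet> (Q *v k)" for k
    by (simp only: w_def inner_matrix_transpose[of _ Q] matrix_vector_mul_assoc
        matrix_transpose_mul[symmetric] matrix_inv_left[OF Q] transpose_mat matrix_vector_mul_lid)
  have dQ: "det Q \<noteq> 0" using Q by (simp add: invertible_det_nz)
  note G = gaussian_fourier[of w]
  show ?I unfolding k vk by (rule integral_matrix_image(1)[OF dQ G(1)])
  have Kinv: "matrix_inv K = matrix_inv Q ** transpose (matrix_inv Q)"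
  proof -
    have t: "transpose (matrix_inv Q) ** transpose Q = mat 1"
      by (simp add: matrix_transpose_mul[symmetric] matrix_inv_right[OF Q])
    have "(matrix_inv Q ** transpose (matrix_inv Q)) ** K
        = matrix_inv Q ** (transpose (matrix_inv Q) ** transpose Q) ** Q"
      by (simp add: KQ matrix_mul_assoc)
    also have "\<dots> = mat 1" by (simp add: t matrix_inv_left[OF Q])
    finally have a: "(matrix_inv Q ** transpose (matrix_inv Q)) ** K = mat 1" .
    have "(matrix_inv Q ** transpose (matrix_inv Q)) ** (K ** matrix_inv K) = matrix_inv K"
      unfolding matrix_mul_assoc a by simp
    then show ?thesis by (simp add: matrix_inv_right posdef_invertible[OF K])
  qed
  have vv: "v \<bullet> (matrix_inv K *v v) = (norm w)\<^sup>2"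
    unfolding Kinv power2_norm_eq_inner w_def
    by (simp only: inner_matrix_transpose[of _ "matrix_inv Q"] matrix_vector_mul_assoc[symmetric])
  have dK: "sqrt (det K) = \<bar>det Q\<bar>"
    by (simp add: KQ det_mul)
  show ?V
    using integral_matrix_image(2)[OF dQ G(1)] dQ
    unfolding k vk[symmetric] G(2) vv dK by (simp add: field_simps scaleR_conv_of_real)
qed

section \<open>Integrals depending on a parameter\<close>

text \<open>Dominated convergence for Frechet difference quotients. The majorant \<open>H\<close> of
  the derivatives also serves as a Lipschitz constant by the mean value inequality, so increment and
  linear term are both controlled. Measurability of the derivative in \<open>y\<close> is derived,
  as a pointwise limit of difference quotients.\<close>

lemma has_derivative_integral:
  fixes f :: "'a::{real_normed_vector,perfect_space} \<Rightarrow> 'b \<Rightarrow> 'c::{banach,second_countable_topology}"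
  assumes r: "r > 0"
    and int: "\<And>x. x \<in> ball x0 r \<Longrightarrow> integrable M (f x)"
    and der: "\<And>x y. x \<in> ball x0 r \<Longrightarrow> y \<in> space M \<Longrightarrow> ((\<lambda>x. f x y) has_derivative f' x y) (at x)"
    and bound: "\<And>x y v. x \<in> ball x0 r \<Longrightarrow> y \<in> space M \<Longrightarrow> norm (f' x y v) \<le> H y * norm v"
    and H: "integrable M H"
  shows "integrable M (\<lambda>y. f' x0 y v)"
    and "((\<lambda>x. \<integral>y. f x y \<partial>M) has_derivative (\<lambda>v. \<integral>y. f' x0 y v \<partial>M)) (at x0)"
proof -
  have x0: "x0 \<in> ball x0 r" using r by simp
  have lip: "norm (f x y - f x0 y) \<le> H y * norm (x - x0)" if "x \<in> ball x0 r" "y \<in> space M" for x y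
  proof (rule differentiable_bound[of "ball x0 r" "\<lambda>x. f x y" "\<lambda>x. f' x y"])
    fix z assume "z \<in> ball x0 r"
    then show "((\<lambda>x. f x y) has_derivative f' z y) (at z within ball x0 r)"
      using der that by (blast intro: has_derivative_at_withinI)
    show "onorm (f' z y) \<le> H y"
      using bound[OF \<open>z \<in> ball x0 r\<close> that(2)] by (intro onorm_le) auto
  qed (use that x0 in auto)
  have int': "integrable M (\<lambda>y. f' x0 y v)" for v
  proof (rule Bochner_Integration.integrable_bound)
    show "integrable M (\<lambda>y. H y * norm v)" using H by simp
    \<comment> \<open>This scaling keeps \<open>x0 + t n *\<^sub>R v\<close> in the ball for every
      \<open>n\<close>; the summand 1 covers \<open>v = 0\<close>.\<close>
    define t where "t n = r / (2 * (1 + norm v)) / real (Suc n)" for n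
    have nv: "1 + norm v > 0" by (simp add: add_pos_nonneg)
    have t0: "t n > 0" for n using r nv by (simp add: t_def)
    have "t \<longlonglongrightarrow> 0" unfolding t_def by real_asymp
    have tr: "x0 + t n *\<^sub>R v \<in> ball x0 r" for n
    proof -
      have "t n \<le> r / (2 * (1 + norm v))"
        using r nv unfolding t_def by (simp add: divide_simps)
      then have "t n * norm v \<le> r / (2 * (1 + norm v)) * norm v"
        by (rule mult_right_mono) simp
      also have "\<dots> < r" using r nv by (simp add: field_simps) (smt (verit) mult_nonneg_nonneg norm_ge_zero)
      finally show ?thesis using t0[of n] by (simp add: dist_norm)
    qed
    show "(\<lambda>y. f' x0 y v) \<in> borel_measurable M"
    proof (rule borel_measurable_LIMSEQ_metric)
      show "(\<lambda>y. (1 / t n) *\<^sub>R (f (x0 + t n *\<^sub>R v) y - f x0 y)) \<in> borel_measurable M" for n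
        using int[OF tr[of n]] int[OF x0] by measurable
      fix y assume y: "y \<in> space M"
      have "((\<lambda>s. f (x0 + s *\<^sub>R v) y) has_derivative (\<lambda>s. f' x0 y (s *\<^sub>R v))) (at 0)"
      proof -
        have "((\<lambda>s. x0 + s *\<^sub>R v) has_derivative (\<lambda>s. s *\<^sub>R v)) (at (0::real))"
          by (auto intro!: derivative_eq_intros)
        moreover have "((\<lambda>x. f x y) has_derivative f' x0 y) (at (x0 + 0 *\<^sub>R v))"
          using der[OF x0 y] by simp
        ultimately show ?thesis by (rule has_derivative_compose)
      qed
      moreover have "f' x0 y (s *\<^sub>R v) = s *\<^sub>R f' x0 y v" for s
        using der[OF x0 y] by (simp add: has_derivative_bounded_linear linear_simps)
      ultimately have "((\<lambda>h. norm (f (x0 + h *\<^sub>R v) y - f x0 y - h *\<^sub>R f' x0 y v) / norm h) \<longlongrightarrow> 0) (at 0)"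
        by (simp add: has_derivative_at)
      then have "(\<lambda>n. norm (f (x0 + t n *\<^sub>R v) y - f x0 y - t n *\<^sub>R f' x0 y v) / norm (t n)) \<longlonglongrightarrow> 0"
        unfolding tendsto_at_iff_sequentially using t0 \<open>t \<longlonglongrightarrow> 0\<close>
        by (auto simp: o_def less_imp_neq[THEN not_sym])
      moreover have "norm (f (x0 + t n *\<^sub>R v) y - f x0 y - t n *\<^sub>R f' x0 y v) / norm (t n)
          = norm ((1 / t n) *\<^sub>R (f (x0 + t n *\<^sub>R v) y - f x0 y) - f' x0 y v)" for n
      proof -
        have e: "(1 / t n) *\<^sub>R (f (x0 + t n *\<^sub>R v) y - f x0 y) - f' x0 y v
            = (1 / t n) *\<^sub>R (f (x0 + t n *\<^sub>R v) y - f x0 y - t n *\<^sub>R f' x0 y v)"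
          using t0[of n] by (simp add: scaleR_right_diff_distrib)
        show ?thesis unfolding e norm_scaleR by (simp add: divide_inverse mult.commute)
      qed
      ultimately have "(\<lambda>n. norm ((1 / t n) *\<^sub>R (f (x0 + t n *\<^sub>R v) y - f x0 y) - f' x0 y v)) \<longlonglongrightarrow> 0"
        by (simp only:)
      then show "(\<lambda>n. (1 / t n) *\<^sub>R (f (x0 + t n *\<^sub>R v) y - f x0 y)) \<longlonglongrightarrow> f' x0 y v"
        by (rule LIM_zero_cancel[OF tendsto_norm_zero_cancel])
    qed
    show "AE y in M. norm (f' x0 y v) \<le> norm (H y * norm v)"
    proof (rule AE_I2)
      fix y assume "y \<in> space M"
      from bound[OF x0 this, of v] show "norm (f' x0 y v) \<le> norm (H y * norm v)"
        by (metis abs_ge_self order_trans real_norm_def)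
    qed
  qed
  show "integrable M (\<lambda>y. f' x0 y v)" by (rule int')
  have int0: "integrable M H" by (rule H)
  have lin: "bounded_linear (\<lambda>v. \<integral>y. f' x0 y v \<partial>M)"
  proof (rule bounded_linear_intro)
    fix v w
    have "(\<integral>y. f' x0 y (v + w) \<partial>M) = (\<integral>y. f' x0 y v + f' x0 y w \<partial>M)"
      using has_derivative_bounded_linear[OF der[OF x0]]
      by (intro Bochner_Integration.integral_cong) (auto simp: linear_simps)
    then show "(\<integral>y. f' x0 y (v + w) \<partial>M) = (\<integral>y. f' x0 y v \<partial>M) + (\<integral>y. f' x0 y w \<partial>M)"
      using int' by simp
  next
    fix s :: real and v
    have "(\<integral>y. f' x0 y (s *\<^sub>R v) \<partial>M) = (\<integral>y. s *\<^sub>R f' x0 y v \<partial>M)"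
      using has_derivative_bounded_linear[OF der[OF x0]]
      by (intro Bochner_Integration.integral_cong) (auto simp: linear_simps)
    then show "(\<integral>y. f' x0 y (s *\<^sub>R v) \<partial>M) = s *\<^sub>R (\<integral>y. f' x0 y v \<partial>M)"
      by simp
  next
    fix v
    have "norm (\<integral>y. f' x0 y v \<partial>M) \<le> (\<integral>y. norm (f' x0 y v) \<partial>M)" by simp
    also have "\<dots> \<le> (\<integral>y. H y * norm v \<partial>M)"
      using bound[OF x0] int' H by (intro integral_mono) auto
    finally show "norm (\<integral>y. f' x0 y v \<partial>M) \<le> norm v * (\<integral>y. H y \<partial>M)"
      by (simp add: mult.commute)
  qed
  have "((\<lambda>h. norm ((\<integral>y. f (x0 + h) y \<partial>M) - (\<integral>y. f x0 y \<partial>M) - (\<integral>y. f' x0 y h \<partial>M)) / norm h)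
      \<longlongrightarrow> 0) (at 0)" (is "(?Q \<longlongrightarrow> 0) _")
    unfolding tendsto_at_iff_sequentially
  proof (intro allI impI)
    fix X :: "nat \<Rightarrow> 'a"
    assume X0: "\<forall>i. X i \<in> UNIV - {0}" and X: "X \<longlonglongrightarrow> 0"
    \<comment> \<open>Outside the ball there is neither integrability nor domination, so the
      remainder quotient is replaced by 0 there; as \<open>X n\<close> tends to 0, only finitely
      many terms are affected.\<close>
    define R where "R n y = (if norm (X n) < r then
      (1 / norm (X n)) *\<^sub>R (f (x0 + X n) y - f x0 y - f' x0 y (X n)) else 0)" for n y
    have "(\<lambda>n. \<integral>y. R n y \<partial>M) \<longlonglongrightarrow> (\<integral>y. 0 \<partial>M)"
    proof (rule integral_dominated_convergence)
      \<comment> \<open>One \<open>H y\<close> pays for the increment of \<open>f\<close>, the other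
        for the linear term.\<close>
      show "integrable M (\<lambda>y. 2 * H y)" using H by simp
      show "R n \<in> borel_measurable M" for n
      proof (cases "norm (X n) < r")
        case True
        then have "x0 + X n \<in> ball x0 r" by (simp add: dist_norm)
        then show ?thesis
          unfolding R_def using int int'[of "X n"] int[OF x0] True by (simp add: borel_measurable_integrable)
      qed (simp add: R_def[abs_def])
      show "AE y in M. norm (R n y) \<le> 2 * H y" for n
      proof (rule AE_I2)
        fix y assume y: "y \<in> space M"
        have H0: "0 \<le> H y"
          using lip[of "x0 + X n" y] bound[OF x0 y, of "X n"] X0
          by (metis DiffD2 insertI1 mult_less_0_iff norm_ge_zero not_le order_trans zero_less_norm_iff)
        show "norm (R n y) \<le> 2 * H y"
        proof (cases "norm (X n) < r")
          case True
          have "norm (f (x0 + X n) y - f x0 y - f' x0 y (X n)) \<le> 2 * H y * norm (X n)"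
            using lip[of "x0 + X n" y] bound[OF x0 y, of "X n"] True y
            by (intro order_trans[OF norm_triangle_ineq4]) (auto simp: dist_norm)
          moreover have "norm (X n) > 0" using X0 by simp
          ultimately have "norm (f (x0 + X n) y - f x0 y - f' x0 y (X n)) / norm (X n) \<le> 2 * H y"
            by (simp only: pos_divide_le_eq)
          then show ?thesis
            unfolding R_def if_P[OF True] norm_scaleR by simp
        qed (use H0 in \<open>simp add: R_def\<close>)
      qed
      show "AE y in M. (\<lambda>n. R n y) \<longlonglongrightarrow> 0"
      proof (rule AE_I2)
        fix y assume y: "y \<in> space M"
        have "((\<lambda>h. norm (f (x0 + h) y - f x0 y - f' x0 y h) / norm h) \<longlongrightarrow> 0) (at 0)"
          using der[OF x0 y] by (simp add: has_derivative_at)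
        then have "(\<lambda>n. norm (f (x0 + X n) y - f x0 y - f' x0 y (X n)) / norm (X n)) \<longlonglongrightarrow> 0"
          unfolding tendsto_at_iff_sequentially using X0 X by (auto simp: o_def)
        then show "(\<lambda>n. R n y) \<longlonglongrightarrow> 0"
          by (rule Lim_null_comparison[rotated]) (auto simp: R_def divide_inverse mult.commute)
      qed
    qed simp
    then have "(\<lambda>n. norm (\<integral>y. R n y \<partial>M)) \<longlonglongrightarrow> 0"
      using tendsto_norm_zero by fastforce
    moreover have "eventually (\<lambda>n. norm (\<integral>y. R n y \<partial>M) = (?Q \<circ> X) n) sequentially"
    proof -
      have "eventually (\<lambda>n. norm (X n) < r) sequentially"
        using X r by (auto simp: tendsto_iff dist_norm)
      then show ?thesis
      proof eventually_elim
        case (elim n)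
        then have "x0 + X n \<in> ball x0 r" by (simp add: dist_norm)
        then show ?case
          using elim int int'[of "X n"] int[OF x0] by (simp add: R_def o_def divide_inverse mult.commute)
      qed
    qed
    ultimately show "(?Q \<circ> X) \<longlonglongrightarrow> 0" by (rule Lim_transform_eventually)
  qed
  then show "((\<lambda>x. \<integral>y. f x y \<partial>M) has_derivative (\<lambda>v. \<integral>y. f' x0 y v \<partial>M)) (at x0)"
    using lin by (simp add: has_derivative_at)
qed

text \<open>Local domination of the functions themselves is enough: Cauchy's inequality on discs of
  a fixed radius \<open>r\<close> converts it into the majorant \<open>H y / r\<close> of the
  derivatives.\<close>

lemma holomorphic_on_integral:
  fixes f :: "complex \<Rightarrow> 'b \<Rightarrow> complex"
  assumes S: "open S"
    and int: "\<And>z. z \<in> S \<Longrightarrow> integrable M (f z)"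
    and hol: "\<And>y. y \<in> space M \<Longrightarrow> (\<lambda>z. f z y) holomorphic_on S"
    and bound: "\<And>z0. z0 \<in> S \<Longrightarrow> \<exists>r>0. \<exists>H. integrable M H \<and>
      (\<forall>z\<in>ball z0 r \<inter> S. \<forall>y\<in>space M. norm (f z y) \<le> H y)"
  shows "(\<lambda>z. \<integral>y. f z y \<partial>M) holomorphic_on S"
  unfolding holomorphic_on_def
proof
  fix z0 assume "z0 \<in> S"
  then obtain r1 H where "r1 > 0" and H: "integrable M H"
    and b: "\<And>z y. z \<in> ball z0 r1 \<inter> S \<Longrightarrow> y \<in> space M \<Longrightarrow> norm (f z y) \<le> H y"
    using bound by metis
  obtain r2 where "r2 > 0" "ball z0 r2 \<subseteq> S" using S \<open>z0 \<in> S\<close> open_contains_ball by blast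
  \<comment> \<open>With a third of the smaller radius, every closed disc of radius \<open>r\<close>
    centred within \<open>r\<close> of \<open>z0\<close> stays inside both neighbourhoods.\<close>
  define r where "r = min r1 r2 / 3"
  have r: "r > 0" "ball z0 (3 * r) \<subseteq> ball z0 r1 \<inter> S"
    using \<open>r1 > 0\<close> \<open>r2 > 0\<close> \<open>ball z0 r2 \<subseteq> S\<close> by (auto simp: r_def)
  have sub: "cball z r \<subseteq> ball z0 (3 * r)" if "z \<in> ball z0 r" for z
  proof
    fix x assume "x \<in> cball z r"
    then show "x \<in> ball z0 (3 * r)"
      using that r(1) dist_triangle[of z0 x z] by simp
  qed
  have "((\<lambda>z. \<integral>y. f z y \<partial>M) has_derivative (\<lambda>v. \<integral>y. deriv (\<lambda>z. f z y) z0 * v \<partial>M)) (at z0)"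
  proof (rule has_derivative_integral(2))
    show "r > 0" by fact
    show "integrable M (f z)" if "z \<in> ball z0 r" for z
      using that r int by (meson Int_iff subsetD mem_ball_leI order.refl sub centre_in_cball less_imp_le)
    show "integrable M (\<lambda>y. H y / r)" using H by simp
    fix z y assume z: "z \<in> ball z0 r" and y: "y \<in> space M"
    have zS: "z \<in> S" using sub[OF z] r by (meson Int_iff subsetD centre_in_cball less_imp_le)
    show "((\<lambda>z. f z y) has_derivative (*) (deriv (\<lambda>z. f z y) z)) (at z)"
      using holomorphic_derivI[OF hol[OF y] S zS] by (simp add: has_field_derivative_def)
    have "norm ((deriv ^^ 1) (\<lambda>z. f z y) z) \<le> fact 1 * H y / r ^ 1"
    proof (rule Cauchy_inequality)
      have "cball z r \<subseteq> S" using sub[OF z] r by blast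
      then show "(\<lambda>z. f z y) holomorphic_on ball z r" "continuous_on (cball z r) (\<lambda>z. f z y)"
        using hol[OF y] ball_subset_cball[of z r]
        by (meson holomorphic_on_subset order_trans holomorphic_on_imp_continuous_on)+
      show "norm (f x y) \<le> H y" if "cmod (z - x) = r" for x
      proof (rule b[OF _ y])
        have "x \<in> cball z r" using that by (simp add: dist_norm)
        then show "x \<in> ball z0 r1 \<inter> S" using sub[OF z] r by blast
      qed
    qed fact
    then have "norm (deriv (\<lambda>z. f z y) z) \<le> H y / r" by simp
    then show "norm (deriv (\<lambda>z. f z y) z * v) \<le> H y / r * norm v" for v
      unfolding norm_mult by (rule mult_right_mono) simp
  qed
  then have "((\<lambda>z. \<integral>y. f z y \<partial>M) has_field_derivative (\<integral>y. deriv (\<lambda>z. f z y) z0 \<partial>M)) (at z0)"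
    by (simp add: has_field_derivative_def)
  then show "(\<lambda>z. \<integral>y. f z y \<partial>M) field_differentiable at z0 within S"
    using field_differentiable_at_within field_differentiable_def by blast
qed

lemma integral_affine:
  fixes f :: "'a::euclidean_space \<Rightarrow> 'b::{banach,second_countable_topology}"
  assumes c: "c \<noteq> 0" and f: "integrable lborel f"
  shows "integrable lborel (\<lambda>x. f (t + c *\<^sub>R x))"
    and "\<bar>c\<bar> ^ DIM('a) *\<^sub>R (LBINT x. f (t + c *\<^sub>R x)) = (LBINT x. f x)"
proof -
  have [measurable]: "f \<in> borel_measurable borel" using f by auto
  let ?D = "density (distr lborel borel (\<lambda>x::'a. t + c *\<^sub>R x)) (\<lambda>_. ennreal (\<bar>c\<bar> ^ DIM('a)))"
  have L: "lborel = ?D" using lborel_affine[OF c, of t] by simp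
  have "integrable ?D f" using f L by simp
  then have "integrable lborel (\<lambda>x. \<bar>c\<bar> ^ DIM('a) *\<^sub>R f (t + c *\<^sub>R x))"
    by (simp add: integrable_density integrable_distr_eq)
  from integrable_scaleR_right[of "inverse (\<bar>c\<bar> ^ DIM('a))", OF this]
  show "integrable lborel (\<lambda>x. f (t + c *\<^sub>R x))" using c by simp
  have "(LBINT x. f x) = (\<integral>x. f x \<partial>?D)" using L by simp
  also have "\<dots> = \<bar>c\<bar> ^ DIM('a) *\<^sub>R (LBINT x. f (t + c *\<^sub>R x))"
    by (simp add: integral_density integral_distr)
  finally show "\<bar>c\<bar> ^ DIM('a) *\<^sub>R (LBINT x. f (t + c *\<^sub>R x)) = (LBINT x. f x)" ..
qed

text \<open>Frequency zero in \<open>gaussian_fourier\<close>, rescaled by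
  \<open>sqrt (2 * \<delta>)\<close> and translated by \<open>m\<close>.\<close>

lemma integrable_gaussian:
  fixes m :: "'a::euclidean_space"
  assumes "\<delta> > 0"
  shows "integrable lborel (\<lambda>x. exp (- \<delta> * (norm (x - m))\<^sup>2))"
    and "(LBINT x. exp (- \<delta> * (norm (x - m))\<^sup>2)) = (pi / \<delta>) powr (DIM('a) / 2)"
proof -
  have i: "integrable lborel (\<lambda>x::'a. exp (- (norm x)\<^sup>2 / 2))"
    using integrable_norm[OF gaussian_fourier(1)[of "0::'a"]] by (simp add: norm_mult)
  have "(LBINT x::'a. of_real (exp (- (norm x)\<^sup>2 / 2)) :: complex) = of_real ((2 * pi) powr (DIM('a) / 2))"
    using gaussian_fourier(2)[of "0::'a"] by simp
  then have v: "(LBINT x::'a. exp (- (norm x)\<^sup>2 / 2)) = (2 * pi) powr (DIM('a) / 2)"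
    by (simp only: integral_complex_of_real of_real_eq_iff)
  define c where "c = sqrt (2 * \<delta>)"
  have c: "c > 0" "c\<^sup>2 = 2 * \<delta>" using assms by (auto simp: c_def)
  have e: "exp (- (norm (- c *\<^sub>R m + c *\<^sub>R x))\<^sup>2 / 2) = exp (- \<delta> * (norm (x - m))\<^sup>2)" for x
  proof -
    have "- c *\<^sub>R m + c *\<^sub>R x = c *\<^sub>R (x - m)" by (simp add: algebra_simps)
    then show ?thesis by (simp add: power_mult_distrib c(2))
  qed
  have "c \<noteq> 0" using c by simp
  show "integrable lborel (\<lambda>x. exp (- \<delta> * (norm (x - m))\<^sup>2))"
    using integral_affine(1)[OF \<open>c \<noteq> 0\<close> i, of "- c *\<^sub>R m"] unfolding e .
  have "c ^ DIM('a) * (LBINT x. exp (- \<delta> * (norm (x - m))\<^sup>2)) = (2 * pi) powr (DIM('a) / 2)"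
    using integral_affine(2)[OF \<open>c \<noteq> 0\<close> i, of "- c *\<^sub>R m"] c unfolding e v by simp
  moreover have "c ^ DIM('a) = (2 * \<delta>) powr (DIM('a) / 2)"
    using c assms by (simp add: c_def powr_half_sqrt[symmetric] powr_powr flip: powr_realpow)
  moreover have "(2 * pi) powr (DIM('a) / 2) = (2 * \<delta>) powr (DIM('a) / 2) * (pi / \<delta>) powr (DIM('a) / 2)"
    using assms by (subst powr_mult[symmetric]) auto
  ultimately show "(LBINT x. exp (- \<delta> * (norm (x - m))\<^sup>2)) = (pi / \<delta>) powr (DIM('a) / 2)"
    using assms by simp
qed

section \<open>Entire functions of several variables\<close>

text \<open>Points of complex n-space are parametrised by real and imaginary parts, so that
  integrals over it are integrals over a product whose slices are the vertical lines Re z =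
  a.\<close>

definition cvec :: "(real^'n) \<times> (real^'n) \<Rightarrow> complex^'n" where
  "cvec p = (\<chi> i. Complex (fst p $ i) (snd p $ i))"

text \<open>Without conjugation the form is complex linear in both arguments, so that
  \<open>exp (bil w z)\<close> is holomorphic in each of them.\<close>

definition bil :: "complex^'n \<Rightarrow> complex^'n \<Rightarrow> complex" where
  "bil w z = (\<Sum>i\<in>UNIV. w $ i * z $ i)"

definition cmat :: "real^'n^'m \<Rightarrow> complex^'n \<Rightarrow> complex^'m" where
  "cmat A z = (\<chi> i. \<Sum>j\<in>UNIV. of_real (A $ i $ j) * z $ j)"

abbreviation creal :: "real^'n \<Rightarrow> complex^'n" where
  "creal x \<equiv> cvec (x, 0)"

lemma cvec_nth [simp]: "cvec p $ i = Complex (fst p $ i) (snd p $ i)"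
  by (simp add: cvec_def)

lemma norm_cvec [simp]: "norm (cvec p) = norm p"
proof -
  have "(norm (cvec p))\<^sup>2 = (norm p)\<^sup>2"
    by (simp add: power2_norm_eq_inner inner_vec_def inner_prod_def inner_complex_def sum.distrib)
  then show ?thesis by simp
qed

lemma cvec_add: "cvec (p + q) = cvec p + cvec q"
  and cvec_scaleR: "cvec (r *\<^sub>R p) = r *\<^sub>R cvec p"
  and cvec_diff: "cvec (p - q) = cvec p - cvec q"
  by (simp_all add: vec_eq_iff complex_eq_iff)

lemma bounded_linear_cvec: "bounded_linear cvec"
  by (rule bounded_linear_intro[of _ 1]) (simp_all add: cvec_add cvec_scaleR)

lemma cvec_surj: "z = cvec ((\<chi> i. Re (z $ i)), (\<chi> i. Im (z $ i)))"
  by (simp add: vec_eq_iff)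

lemma continuous_on_cvec [continuous_intros]: "continuous_on S f \<Longrightarrow> continuous_on S (\<lambda>x. cvec (f x))"
  by (rule bounded_linear.continuous_on[OF bounded_linear_cvec])

lemma measurable_cvec [measurable]: "cvec \<in> borel_measurable borel"
  by (intro borel_measurable_continuous_onI continuous_intros)

lemma norm_bil_le: "norm (bil w z) \<le> norm w * norm z"
proof -
  have "norm (bil w z) \<le> (\<Sum>i\<in>UNIV. \<bar>norm (w $ i)\<bar> * \<bar>norm (z $ i)\<bar>)"
    unfolding bil_def by (rule order_trans[OF norm_sum]) (simp add: norm_mult)
  also have "\<dots> \<le> norm w * norm z"
    unfolding norm_vec_def by (rule L2_set_mult_ineq)
  finally show ?thesis .
qed

lemma bounded_bilinear_bil: "bounded_bilinear bil"
proof
  show "\<exists>K. \<forall>a b :: complex^'n. norm (bil a b) \<le> norm a * norm b * K"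
    by (rule exI[of _ 1]) (simp add: norm_bil_le)
qed (simp_all add: bil_def algebra_simps sum.distrib scaleR_sum_right)

interpretation bil: bounded_bilinear bil
  by (rule bounded_bilinear_bil)

lemma bil_commute: "bil w z = bil z w"
  by (simp add: bil_def mult.commute)

lemma bil_scale: "bil (c *s w) z = c * bil w z" "bil w (c *s z) = c * bil w z"
  by (simp_all add: bil_def sum_distrib_left algebra_simps)

lemma bil_axis: "bil (axis i c) z = c * z $ i"
proof -
  have "bil (axis i c) z = (\<Sum>j\<in>UNIV. if j = i then c * z $ i else 0)"
    unfolding bil_def by (intro sum.cong) (auto simp: axis_def)
  then show ?thesis by simp
qed

lemma bil_creal: "bil (cvec p) (creal x) = Complex (fst p \<bullet> x) (snd p \<bullet> x)"
  by (simp add: bil_def complex_eq_iff inner_vec_def mult.commute)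

lemma bil_self: "bil (cvec p) (cvec p) = Complex ((norm (fst p))\<^sup>2 - (norm (snd p))\<^sup>2) (2 * (fst p \<bullet> snd p))"
  by (simp add: bil_def complex_eq_iff inner_vec_def power2_norm_eq_inner sum_subtractf sum_distrib_left
      algebra_simps flip: sum.distrib)

lemma cmat_cvec: "cmat A (cvec p) = cvec (A *v fst p, A *v snd p)"
  by (simp add: cmat_def vec_eq_iff complex_eq_iff matrix_vector_mult_def)

lemma bil_cmat: "bil (cmat A w) z = bil w (cmat (transpose A) z)"
  unfolding bil_def cmat_def transpose_def
  by (simp add: sum_distrib_left sum_distrib_right mult_ac) (rule sum.swap)

lemma cmat_mul: "cmat A (cmat B z) = cmat (A ** B) z"
  unfolding cmat_def matrix_matrix_mult_def vec_eq_iff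
  by (simp add: sum_distrib_left sum_distrib_right mult_ac) (intro allI sum.swap)

lemma cmat_id [simp]:
  fixes z :: "complex^'n"
  shows "cmat (mat 1) z = z"
proof -
  have "(\<Sum>j\<in>UNIV. of_real ((mat 1 :: real^'n^'n) $ i $ j) * z $ j) = (\<Sum>j\<in>UNIV. if j = i then z $ i else 0)" for i
    by (intro sum.cong) (auto simp: mat_def)
  then show ?thesis by (simp add: cmat_def vec_eq_iff)
qed

lemma bounded_linear_cmat: "bounded_linear (cmat A)"
  unfolding linear_conv_bounded_linear[symmetric]
  by (rule linearI) (simp_all add: cmat_def vec_eq_iff algebra_simps sum.distrib scaleR_sum_right)

lemma cmat_scale: "cmat A (c *s z) = c *s cmat A z"
  by (simp add: cmat_def vec_eq_iff sum_distrib_left algebra_simps)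

text \<open>A real matrix acts separately on real and imaginary parts, whose squared norms add
  up.\<close>

lemma norm_cmat_le:
  fixes A :: "real^'n^'m"
  assumes "\<And>x. norm (A *v x) \<le> \<theta> * norm x"
  shows "norm (cmat A z) \<le> \<theta> * norm z"
proof -
  obtain a b where z: "z = cvec (a, b)" using cvec_surj by metis
  have "0 \<le> \<theta> * norm (1 :: real^'n)" using assms order_trans norm_ge_zero by blast
  then have th: "0 \<le> \<theta>" by (simp add: zero_le_mult_iff)
  have "(norm (cmat A z))\<^sup>2 = (norm (A *v a))\<^sup>2 + (norm (A *v b))\<^sup>2"
    by (simp add: z cmat_cvec norm_Pair)
  also have "\<dots> \<le> (\<theta> * norm a)\<^sup>2 + (\<theta> * norm b)\<^sup>2"
    using assms by (intro add_mono power_mono) auto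
  also have "\<dots> = (\<theta> * norm z)\<^sup>2"
    by (simp add: z norm_Pair power_mult_distrib algebra_simps)
  finally show ?thesis using th by (simp add: power2_le_iff_abs_le)
qed

text \<open>Holomorphy on the whole space: a real derivative of the form \<open>bil v (G' z)\<close>
  is complex linear in \<open>v\<close>, and \<open>G'\<close> is then the complex gradient of
  \<open>G\<close>.\<close>

definition entire_vec :: "(complex^'n \<Rightarrow> complex) \<Rightarrow> (complex^'n \<Rightarrow> complex^'n) \<Rightarrow> bool" where
  "entire_vec G G' \<longleftrightarrow> (\<forall>z. (G has_derivative (\<lambda>v. bil v (G' z))) (at z))"

lemma entire_vec_continuous:
  assumes "entire_vec G G'"
  shows "continuous_on S G"
proof -
  have "isCont G z" for z
    using assms unfolding entire_vec_def by (blast intro: has_derivative_continuous)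
  then show ?thesis by (simp add: continuous_at_imp_continuous_on)
qed

lemma entire_vec_compose:
  assumes "entire_vec G G'" and "(f has_derivative f') (at x within S)"
  shows "((\<lambda>x. G (f x)) has_derivative (\<lambda>v. bil (f' v) (G' (f x)))) (at x within S)"
  using has_derivative_compose[OF assms(2), of G "\<lambda>v. bil v (G' (f x))"] assms(1)
  by (simp add: entire_vec_def)

lemma entire_vec_mult:
  assumes "entire_vec F F'" "entire_vec G G'"
  shows "entire_vec (\<lambda>z. F z * G z) (\<lambda>z. F z *s G' z + G z *s F' z)"
  unfolding entire_vec_def
proof
  fix z
  show "((\<lambda>z. F z * G z) has_derivative (\<lambda>v. bil v (F z *s G' z + G z *s F' z))) (at z)"
    using has_derivative_mult[of F "\<lambda>v. bil v (F' z)" z UNIV G "\<lambda>v. bil v (G' z)"] assms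
    by (simp add: entire_vec_def bil.add_right bil_scale mult.commute)
qed

lemma entire_vec_diff:
  assumes "entire_vec F F'" "entire_vec G G'"
  shows "entire_vec (\<lambda>z. F z - G z) (\<lambda>z. F' z - G' z)"
  using assms has_derivative_diff unfolding entire_vec_def bil.diff_right by blast

lemma entire_vec_sum:
  assumes "\<And>i. i \<in> I \<Longrightarrow> entire_vec (F i) (F' i)"
  shows "entire_vec (\<lambda>z. \<Sum>i\<in>I. F i z) (\<lambda>z. \<Sum>i\<in>I. F' i z)"
  using assms unfolding entire_vec_def bil.sum_right by (auto intro!: has_derivative_sum)

lemma entire_vec_cmult:
  assumes "entire_vec F F'"
  shows "entire_vec (\<lambda>z. c * F z) (\<lambda>z. c *s F' z)"
  using assms has_derivative_mult_right unfolding entire_vec_def bil_scale by blast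

lemma entire_vec_nth: "entire_vec (\<lambda>z. z $ i) (\<lambda>z. axis i 1)"
  unfolding entire_vec_def bil_commute[of _ "axis i 1"] bil_axis
  by (simp add: bounded_linear_imp_has_derivative bounded_linear_vec_nth)

lemma entire_vec_cmat:
  assumes "entire_vec G G'"
  shows "entire_vec (\<lambda>z. G (cmat A z)) (\<lambda>z. cmat (transpose A) (G' (cmat A z)))"
  unfolding entire_vec_def
proof
  fix z
  show "((\<lambda>z. G (cmat A z)) has_derivative (\<lambda>v. bil v (cmat (transpose A) (G' (cmat A z))))) (at z)"
    using entire_vec_compose[OF assms bounded_linear_imp_has_derivative[OF bounded_linear_cmat], of A z UNIV]
    by (simp add: bil_cmat)
qed

lemma bounded_linear_scale_vec: "bounded_linear (\<lambda>l. l *s (v :: complex^'n))"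
  unfolding linear_conv_bounded_linear[symmetric]
  by (rule linearI) (simp_all add: vec_eq_iff algebra_simps)

lemma bounded_linear_scale_vec2: "bounded_linear (\<lambda>v :: complex^'n. l *s v)"
  unfolding linear_conv_bounded_linear[symmetric]
  by (rule linearI) (simp_all add: vec_eq_iff algebra_simps)

lemma norm_scale_vec: "norm (l *s (v :: complex^'n)) = norm l * norm v"
  by (simp add: norm_vec_def norm_mult L2_set_right_distrib)

lemma entire_vec_line:
  assumes "entire_vec G G'"
  shows "((\<lambda>l. G (z + l *s v)) has_field_derivative bil v (G' (z + l *s v))) (at l)"
proof -
  have "((\<lambda>l. z + l *s v) has_derivative (\<lambda>h. h *s v)) (at l)"
    by (auto intro!: derivative_eq_intros bounded_linear_imp_has_derivative bounded_linear_scale_vec)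
  from entire_vec_compose[OF assms this] show ?thesis
    by (simp add: has_field_derivative_def bil_scale mult_commute_abs)
qed

lemma entire_vec_line_holomorphic:
  assumes "entire_vec G G'"
  shows "(\<lambda>l. G (z + l *s v)) holomorphic_on S"
  unfolding holomorphic_on_def field_differentiable_def
  using entire_vec_line[OF assms] has_field_derivative_at_within by blast

text \<open>Lets a bounded shift of the argument be absorbed into a Gaussian bound at the price of
  an arbitrarily small increase of its exponent.\<close>

lemma weighted_square_add:
  fixes x y :: real
  assumes "e > 0"
  shows "(x + y)\<^sup>2 \<le> (1 + e) * x\<^sup>2 + (1 + 1 / e) * y\<^sup>2"
proof -
  have "0 \<le> (sqrt e * x - y / sqrt e)\<^sup>2" by simp
  also have "\<dots> = e * x\<^sup>2 - 2 * x * y + y\<^sup>2 / e"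
    using assms by (simp add: power2_diff power_mult_distrib power_divide)
  finally show ?thesis by (simp add: power2_sum algebra_simps)
qed

text \<open>Cauchy's inequality on the unit disc in each coordinate direction. Moving by a vector of
  norm 1 costs a factor \<open>1 + e\<close> in the exponent, and \<open>e\<close> is chosen so that
  \<open>\<kappa> * (1 + e) = \<kappa>'\<close>.\<close>

lemma entire_vec_growth_deriv:
  fixes G :: "complex^'n \<Rightarrow> complex"
  assumes G: "entire_vec G G'" and c: "\<And>z. norm (G z) \<le> c * exp (\<kappa> * (norm z)\<^sup>2)"
    and \<kappa>: "0 < \<kappa>" "\<kappa> < \<kappa>'"
  obtains c' where "\<And>z. norm (G' z) \<le> c' * exp (\<kappa>' * (norm z)\<^sup>2)"
proof
  fix z
  define e where "e = \<kappa>' / \<kappa> - 1"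
  have e: "e > 0" "\<kappa> * (1 + e) = \<kappa>'" using \<kappa> by (auto simp: e_def field_simps)
  define M where "M = c * exp (\<kappa> * (1 + 1 / e))"
  have c0: "c \<ge> 0" using order_trans[OF norm_ge_zero c[of 0]] by simp
  have "norm (G' z $ i) \<le> M * exp (\<kappa>' * (norm z)\<^sup>2)" for i
  proof -
    let ?\<phi> = "\<lambda>l. G (z + l *s axis i 1)"
    have "norm ((deriv ^^ 1) ?\<phi> 0) \<le> fact 1 * (M * exp (\<kappa>' * (norm z)\<^sup>2)) / 1 ^ 1"
    proof (rule Cauchy_inequality)
      show "?\<phi> holomorphic_on ball 0 1" "continuous_on (cball 0 1) ?\<phi>"
        by (auto intro!: holomorphic_on_imp_continuous_on entire_vec_line_holomorphic[OF G])
      fix l :: complex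
      assume "cmod (0 - l) = 1"
      then have "norm (l *s (axis i 1 :: complex^'n)) = 1"
        by (simp add: norm_scale_vec)
      then have "(norm (z + l *s axis i 1))\<^sup>2 \<le> (norm z + 1)\<^sup>2"
        by (metis norm_ge_zero norm_triangle_ineq power_mono)
      also have "\<dots> \<le> (1 + e) * (norm z)\<^sup>2 + (1 + 1 / e)"
        using weighted_square_add[OF e(1), of "norm z" 1] by simp
      finally have "\<kappa> * (norm (z + l *s axis i 1))\<^sup>2 \<le> \<kappa> * ((1 + e) * (norm z)\<^sup>2 + (1 + 1 / e))"
        using \<kappa>(1) by (intro mult_left_mono) auto
      also have "\<dots> = \<kappa>' * (norm z)\<^sup>2 + \<kappa> * (1 + 1 / e)"
        by (simp add: e(2)[symmetric] algebra_simps)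
      finally have "c * exp (\<kappa> * (norm (z + l *s axis i 1))\<^sup>2) \<le> c * exp (\<kappa>' * (norm z)\<^sup>2 + \<kappa> * (1 + 1 / e))"
        using c0 by (intro mult_left_mono) auto
      then show "cmod (?\<phi> l) \<le> M * exp (\<kappa>' * (norm z)\<^sup>2)"
        using c[of "z + l *s axis i 1"] by (simp add: M_def exp_add mult_ac)
    qed simp
    moreover have "deriv ?\<phi> 0 = G' z $ i"
      using DERIV_imp_deriv[OF entire_vec_line[OF G, of z "axis i 1" 0]] by (simp add: bil_axis)
    ultimately show ?thesis by simp
  qed
  then have "norm (G' z) \<le> (\<Sum>i\<in>(UNIV::'n set). M * exp (\<kappa>' * (norm z)\<^sup>2))"
    unfolding norm_vec_def by (intro order_trans[OF L2_set_le_sum] sum_mono) auto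
  then show "norm (G' z) \<le> (CARD('n) * M) * exp (\<kappa>' * (norm z)\<^sup>2)" by simp
qed

section \<open>The Bargmann transform\<close>

text \<open>Integrability against every exponential is what makes the Laplace transform converge,
  and be entire, on all of complex space.\<close>

definition exp_integrable :: "(real^'n \<Rightarrow> real) \<Rightarrow> bool" where
  "exp_integrable g \<longleftrightarrow> g \<in> borel_measurable borel \<and>
     (\<forall>R. integrable lborel (\<lambda>y. exp (R * norm y) * \<bar>g y\<bar>))"

definition laplace :: "(real^'n \<Rightarrow> real) \<Rightarrow> complex^'n \<Rightarrow> complex" where
  "laplace g w = (LBINT y. of_real (g y) * exp (bil w (creal y)))"

definition bargmann :: "(real^'n \<Rightarrow> real) \<Rightarrow> complex^'n \<Rightarrow> complex" where
  "bargmann g w = exp (- bil w w / 2) * laplace g w"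

text \<open>The product rule in closed form: differentiating the Laplace transform multiplies
  \<open>g\<close> by a coordinate, and differentiating the Gaussian prefactor produces
  \<open>- w $ i\<close>. That this is the complex gradient is
  \<open>entire_vec_bargmann\<close>.\<close>

definition bargmann_grad :: "(real^'n \<Rightarrow> real) \<Rightarrow> complex^'n \<Rightarrow> complex^'n" where
  "bargmann_grad g w = (\<chi> i. bargmann (\<lambda>y. y $ i * g y) w - w $ i * bargmann g w)"

lemma measurable_bil [measurable]:
  "(\<lambda>y. bil w (creal y)) \<in> borel_measurable borel"
  by (intro borel_measurable_continuous_onI continuous_intros bil.continuous_on)

lemma has_derivative_cexp:
  fixes f :: "'a::real_normed_vector \<Rightarrow> complex"
  assumes "(f has_derivative f') (at x within S)"
  shows "((\<lambda>x. exp (f x)) has_derivative (\<lambda>v. exp (f x) * f' v)) (at x within S)"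
  using has_derivative_compose[OF assms, of exp "(*) (exp (f x))"] DERIV_exp[of "f x"]
  by (simp add: has_field_derivative_def)

lemma norm_exp_bil_le: "norm (exp (bil w (creal y))) \<le> exp (norm w * norm y)"
  using norm_bil_le[of w "creal y"] complex_Re_le_cmod[of "bil w (creal y)"]
  by (simp add: norm_exp norm_Pair)

lemma norm_le_exp: "norm y \<le> exp (norm (y::'a::real_normed_vector))"
  using exp_ge_add_one_self[of "norm y"] by linarith

lemma exp_integrable_laplace:
  assumes "exp_integrable g"
  shows "integrable lborel (\<lambda>y. of_real (g y) * exp (bil w (creal y)) :: complex)"
proof (rule Bochner_Integration.integrable_bound)
  show "integrable lborel (\<lambda>y. exp (norm w * norm y) * \<bar>g y\<bar>)"
    using assms by (simp add: exp_integrable_def)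
  have [measurable]: "g \<in> borel_measurable borel" using assms by (simp add: exp_integrable_def)
  show "(\<lambda>y. of_real (g y) * exp (bil w (creal y)) :: complex) \<in> borel_measurable lborel"
    by measurable
  show "AE y in lborel. norm (of_real (g y) * exp (bil w (creal y)) :: complex)
      \<le> norm (exp (norm w * norm y) * \<bar>g y\<bar>)"
  proof (rule AE_I2)
    fix y
    have "norm (of_real (g y) * exp (bil w (creal y)) :: complex) = \<bar>g y\<bar> * norm (exp (bil w (creal y)))"
      by (simp only: norm_mult norm_of_real)
    also have "\<dots> \<le> \<bar>g y\<bar> * exp (norm w * norm y)"
      by (rule mult_left_mono[OF norm_exp_bil_le]) simp
    finally show "norm (of_real (g y) * exp (bil w (creal y)) :: complex) \<le> norm (exp (norm w * norm y) * \<bar>g y\<bar>)"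
      by (simp add: mult.commute)
  qed
qed

lemma exp_integrable_nth:
  assumes "exp_integrable g"
  shows "exp_integrable (\<lambda>y. y $ i * g y)"
  unfolding exp_integrable_def
proof (intro conjI allI)
  have [measurable]: "g \<in> borel_measurable borel" using assms by (simp add: exp_integrable_def)
  have [measurable]: "(\<lambda>y::real^'a. y $ i) \<in> borel_measurable borel"
    by (intro borel_measurable_continuous_onI continuous_intros)
  show "(\<lambda>y. y $ i * g y) \<in> borel_measurable borel" by measurable
  fix R
  show "integrable lborel (\<lambda>y. exp (R * norm y) * \<bar>y $ i * g y\<bar>)"
  proof (rule Bochner_Integration.integrable_bound)
    show "integrable lborel (\<lambda>y. exp ((R + 1) * norm y) * \<bar>g y\<bar>)"
      using assms by (simp add: exp_integrable_def)
    have "exp (R * norm y) * \<bar>y $ i * g y\<bar> \<le> exp ((R + 1) * norm y) * \<bar>g y\<bar>" for y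
    proof -
      have "\<bar>y $ i\<bar> \<le> exp (norm y)"
        using component_le_norm_cart[of y i] norm_le_exp[of y] by linarith
      then have "exp (R * norm y) * \<bar>y $ i\<bar> * \<bar>g y\<bar> \<le> exp (R * norm y) * exp (norm y) * \<bar>g y\<bar>"
        by (intro mult_right_mono mult_left_mono) auto
      then show ?thesis by (simp add: abs_mult distrib_right exp_add mult.assoc)
    qed
    then show "AE y in lborel. norm (exp (R * norm y) * \<bar>y $ i * g y\<bar>)
        \<le> norm (exp ((R + 1) * norm y) * \<bar>g y\<bar>)" by simp
  qed measurable
qed

lemma entire_vec_laplace:
  fixes g :: "real^'n \<Rightarrow> real"
  assumes g: "exp_integrable g"
  shows "entire_vec (laplace g) (\<lambda>w. \<chi> i. laplace (\<lambda>y. y $ i * g y) w)"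
  unfolding entire_vec_def
proof
  fix w :: "complex^'n"
  let ?f' = "\<lambda>w y v. of_real (g y) * (bil v (creal y) * exp (bil w (creal y)))"
  have "(laplace g has_derivative (\<lambda>v. LBINT y. ?f' w y v)) (at w)"
    unfolding laplace_def[abs_def]
  proof (rule has_derivative_integral(2))
    show "(1::real) > 0" by simp
    show "integrable lborel (\<lambda>y. of_real (g y) * exp (bil z (creal y)) :: complex)" for z
      by (rule exp_integrable_laplace[OF g])
    show "((\<lambda>z. of_real (g y) * exp (bil z (creal y))) has_derivative ?f' z y) (at z)" for z y
    proof -
      have "((\<lambda>z. bil z (creal y)) has_derivative (\<lambda>v. bil v (creal y))) (at z)"
        by (rule bounded_linear_imp_has_derivative[OF bil.bounded_linear_left])
      from has_derivative_mult_right[OF has_derivative_cexp[OF this], of "of_real (g y)"]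
      show ?thesis by (simp add: mult.commute)
    qed
    \<comment> \<open>Of the extra rate 2, one unit comes from the radius of the ball around
      \<open>w\<close>, the other from the factor \<open>norm y\<close> that differentiation
      produces.\<close>
    show "integrable lborel (\<lambda>y. exp ((norm w + 2) * norm y) * \<bar>g y\<bar>)"
      using g by (simp add: exp_integrable_def)
    fix z v :: "complex^'n" and y :: "real^'n"
    assume "z \<in> ball w 1"
    then have "norm z \<le> norm w + 1"
      by (metis dist_norm mem_ball norm_minus_commute norm_triangle_sub less_imp_le add_left_mono order_trans)
    then have "norm (exp (bil z (creal y))) \<le> exp ((norm w + 1) * norm y)"
      by (intro order_trans[OF norm_exp_bil_le]) (simp add: mult_right_mono)
    moreover have "norm (bil v (creal y)) \<le> norm v * exp (norm y)"
      using norm_bil_le[of v "creal y"] norm_le_exp[of y]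
      by (simp add: norm_Pair) (meson mult_left_mono norm_ge_zero order_trans)
    ultimately have "norm (bil v (creal y)) * norm (exp (bil z (creal y)))
        \<le> norm v * exp (norm y) * exp ((norm w + 1) * norm y)"
      by (intro mult_mono) auto
    also have "\<dots> = exp ((norm w + 2) * norm y) * norm v"
      by (simp add: distrib_right exp_add[symmetric] add_ac)
    finally have "\<bar>g y\<bar> * (norm (bil v (creal y)) * norm (exp (bil z (creal y))))
        \<le> \<bar>g y\<bar> * (exp ((norm w + 2) * norm y) * norm v)"
      by (rule mult_left_mono) simp
    then show "norm (?f' z y v) \<le> exp ((norm w + 2) * norm y) * \<bar>g y\<bar> * norm v"
      by (simp add: norm_mult mult_ac)
  qed
  moreover have "(LBINT y. ?f' w y v) = bil v (\<chi> i. laplace (\<lambda>y. y $ i * g y) w)" for v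
  proof -
    have e: "?f' w y v = (\<Sum>i\<in>UNIV. v $ i * (of_real (y $ i * g y) * exp (bil w (creal y))))" for y
      by (simp add: bil_def[of v] sum_distrib_left sum_distrib_right complex_of_real_def[symmetric] mult_ac)
    show ?thesis
      unfolding e
      by (subst Bochner_Integration.integral_sum)
        (auto intro!: integrable_mult_right exp_integrable_laplace[OF exp_integrable_nth[OF g]]
          simp: bil_def[of v] laplace_def simp del: of_real_mult)
  qed
  ultimately show "(laplace g has_derivative (\<lambda>v. bil v (\<chi> i. laplace (\<lambda>y. y $ i * g y) w))) (at w)"
    by simp
qed

lemma entire_vec_gaussian: "entire_vec (\<lambda>w. exp (- bil w w / 2)) (\<lambda>w. - exp (- bil w w / 2) *s w)"
  unfolding entire_vec_def
proof
  fix w :: "complex^'n"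
  have "((\<lambda>w. bil w w) has_derivative (\<lambda>v. bil w v + bil v w)) (at w)"
    by (rule bil.FDERIV) auto
  from has_derivative_cexp[OF has_derivative_mult_right[OF this, of "- 1 / 2"]]
  have "((\<lambda>w. exp (- 1 / 2 * bil w w)) has_derivative
    (\<lambda>v. exp (- 1 / 2 * bil w w) * (- 1 / 2 * (bil w v + bil v w)))) (at w)" .
  moreover have "exp (- 1 / 2 * bil w w) * (- 1 / 2 * (bil w v + bil v w)) = bil v (- exp (- bil w w / 2) *s w)" for v
    using bil_commute[of w v] by (simp add: bil_scale bil.minus_right)
  ultimately
  show "((\<lambda>w. exp (- bil w w / 2)) has_derivative (\<lambda>v. bil v (- exp (- bil w w / 2) *s w))) (at w)"
    by simp
qed

lemma entire_vec_bargmann: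
  assumes g: "exp_integrable g"
  shows "entire_vec (bargmann g) (bargmann_grad g)"
proof -
  have "bargmann_grad g = (\<lambda>w. exp (- bil w w / 2) *s (\<chi> i. laplace (\<lambda>y. y $ i * g y) w)
      + laplace g w *s (- exp (- bil w w / 2) *s w))"
    by (rule ext) (simp add: vec_eq_iff bargmann_grad_def bargmann_def)
  then show ?thesis
    using entire_vec_mult[OF entire_vec_gaussian entire_vec_laplace[OF g]]
    by (simp add: bargmann_def[abs_def])
qed

lemma entire_vec_bargmann_grad:
  assumes g: "exp_integrable g"
  obtains H where "entire_vec (\<lambda>w. bargmann_grad g w $ i) H"
  using entire_vec_diff[OF entire_vec_bargmann[OF exp_integrable_nth[OF g, of i]]
      entire_vec_mult[OF entire_vec_nth[of i] entire_vec_bargmann[OF g]]]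
  by (auto simp: bargmann_grad_def)

text \<open>A majorant in product form gives integrability on the product space and so justifies
  each exchange of integrals below.\<close>

lemma fubini_product_bound:
  fixes F :: "'a::euclidean_space \<Rightarrow> 'b::euclidean_space \<Rightarrow> 'c::{banach,second_countable_topology}"
  assumes F: "case_prod F \<in> borel_measurable (lborel \<Otimes>\<^sub>M lborel)"
    and f: "integrable lborel f" and g: "integrable lborel g"
    and bound: "\<And>x y. norm (F x y) \<le> f x * g y"
  shows "integrable (lborel \<Otimes>\<^sub>M lborel) (case_prod F)"
    and "(LBINT x. LBINT y. F x y) = (LBINT y. LBINT x. F x y)"
proof -
  have "integrable (lborel \<Otimes>\<^sub>M lborel) (\<lambda>(x, y). norm (f x) * norm (g y))"
  proof (rule lborel_pair.Fubini_integrable)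
    show "(\<lambda>(x, y). norm (f x) * norm (g y)) \<in> borel_measurable (lborel \<Otimes>\<^sub>M lborel)"
      using f g by measurable
    show "integrable lborel (\<lambda>x. LBINT y. norm (case (x, y) of (x, y) \<Rightarrow> norm (f x) * norm (g y)))"
      using f by (simp add: abs_mult)
    show "AE x in lborel. integrable lborel (\<lambda>y. case (x, y) of (x, y) \<Rightarrow> norm (f x) * norm (g y))"
      using g by simp
  qed
  then show i: "integrable (lborel \<Otimes>\<^sub>M lborel) (case_prod F)"
    by (rule Bochner_Integration.integrable_bound[OF _ F])
      (auto intro!: AE_I2 order_trans[OF bound] simp: abs_mult[symmetric])
  show "(LBINT x. LBINT y. F x y) = (LBINT y. LBINT x. F x y)"
    by (rule lborel_pair.Fubini_integral[OF i, symmetric])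
qed

lemma gaussian_fourier_scaled:
  fixes v :: "'a::euclidean_space"
  assumes "e > 0"
  shows "integrable lborel (\<lambda>x::'a. of_real (exp (- e\<^sup>2 * (norm x)\<^sup>2 / 2)) * cis (v \<bullet> x))"
    and "(LBINT x::'a. of_real (exp (- e\<^sup>2 * (norm x)\<^sup>2 / 2)) * cis (v \<bullet> x))
      = of_real ((2 * pi) powr (DIM('a) / 2) / e ^ DIM('a) * exp (- (norm v / e)\<^sup>2 / 2))"
proof -
  have e: "e \<noteq> 0" using assms by simp
  note G = gaussian_fourier[of "v /\<^sub>R e"]
  have eq: "of_real (exp (- (norm (0 + e *\<^sub>R x))\<^sup>2 / 2)) * cis ((v /\<^sub>R e) \<bullet> (0 + e *\<^sub>R x))
     = of_real (exp (- e\<^sup>2 * (norm x)\<^sup>2 / 2)) * cis (v \<bullet> x)" for x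
  proof -
    have "(v /\<^sub>R e) \<bullet> (0 + e *\<^sub>R x) = v \<bullet> x" using e by (simp add: field_simps)
    moreover have "(norm (0 + e *\<^sub>R x))\<^sup>2 = e\<^sup>2 * (norm x)\<^sup>2" by (simp add: power_mult_distrib)
    ultimately show ?thesis by (simp only: minus_mult_left)
  qed
  show "integrable lborel (\<lambda>x::'a. of_real (exp (- e\<^sup>2 * (norm x)\<^sup>2 / 2)) * cis (v \<bullet> x))"
    using integral_affine(1)[OF e G(1), of 0] unfolding eq .
  have "norm (v /\<^sub>R e) = norm v / e" using assms by (simp add: divide_inverse mult.commute)
  then show "(LBINT x::'a. of_real (exp (- e\<^sup>2 * (norm x)\<^sup>2 / 2)) * cis (v \<bullet> x))
      = of_real ((2 * pi) powr (DIM('a) / 2) / e ^ DIM('a) * exp (- (norm v / e)\<^sup>2 / 2))"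
    using integral_affine(2)[OF e G(1), of 0] assms unfolding eq G(2)
    by (simp add: field_simps scaleR_conv_of_real)
qed

section \<open>Inversion and isometry\<close>

lemma measurable_cis [measurable]: "cis \<in> borel_measurable borel"
  by (intro borel_measurable_continuous_onI continuous_intros)

lemma measurable_cnj [measurable]: "cnj \<in> borel_measurable borel"
  by (intro borel_measurable_continuous_onI continuous_intros)

text \<open>Gaussian regularisation of the Fourier side makes every exchange of integrals absolutely
  convergent; the regularisation is removed by monotone convergence.\<close>

lemma plancherel_gaussian_bounded:
  fixes \<phi> :: "'a::euclidean_space \<Rightarrow> complex"
  assumes cont: "continuous_on UNIV \<phi>" and \<delta>: "\<delta> > 0"
    and bound: "\<And>b. norm (\<phi> b) \<le> c * exp (- \<delta> * (norm b)\<^sup>2)"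
  shows "(\<integral>\<^sup>+x. ennreal ((norm (LBINT b. \<phi> b * cis (- (b \<bullet> x))))\<^sup>2) \<partial>lborel)
    = ennreal ((2 * pi) ^ DIM('a)) * (\<integral>\<^sup>+b. ennreal ((norm (\<phi> b))\<^sup>2) \<partial>lborel)"
proof -
  define \<Phi> where "\<Phi> x = (LBINT b. \<phi> b * cis (- (b \<bullet> x)))" for x :: 'a
  define p where "p = (2 * pi) powr (DIM('a) / 2)"
  have pp: "p * p = (2 * pi) ^ DIM('a)"
    by (simp add: p_def powr_add[symmetric] powr_realpow)
  have p0: "p > 0" by (simp add: p_def)
  have c0: "c \<ge> 0" using order_trans[OF norm_ge_zero bound[of 0]] by simp
  have [measurable]: "\<phi> \<in> borel_measurable borel"
    using cont by (rule borel_measurable_continuous_onI)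
  have ig: "integrable lborel (\<lambda>b::'a. c * exp (- \<delta> * (norm b)\<^sup>2))"
    using integrable_gaussian(1)[OF \<delta>, of "0::'a"] by simp
  have i\<phi>: "integrable lborel \<phi>"
    using bound by (intro Bochner_Integration.integrable_bound[OF ig])
      (auto intro!: AE_I2 order_trans[OF _ abs_ge_self])
  have bc: "norm (\<phi> b) \<le> c" for b
    using \<delta> c0 by (intro order_trans[OF bound]) (simp add: mult_left_le)
  have [measurable]: "\<Phi> \<in> borel_measurable borel"
    unfolding \<Phi>_def by measurable
  define B where "B = (LBINT b. norm (\<phi> b))"
  have \<Phi>B: "norm (\<Phi> x) \<le> B" for x
    unfolding \<Phi>_def B_def by (rule order_trans[OF integral_norm_bound]) (simp add: norm_mult)
  define e where "e n = 1 / real (Suc n)" for n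
  have e0: "e n > 0" for n by (simp add: e_def)
  have elim: "e \<longlonglongrightarrow> 0" unfolding e_def by real_asymp
  \<comment> \<open>Up to normalisation, the inverse Fourier transform of \<Phi> damped by a
    Gaussian of width \<open>1 / e n\<close>.\<close>
  define U where "U n b = (LBINT x. \<Phi> x * of_real (exp (- (e n)\<^sup>2 * (norm x)\<^sup>2 / 2)) * cis (b \<bullet> x))" for n b
  have ie: "integrable lborel (\<lambda>x::'a. exp (- (e n)\<^sup>2 * (norm x)\<^sup>2 / 2))" for n
    using integrable_gaussian(1)[of "(e n)\<^sup>2 / 2" "0::'a"] e0[of n] by simp
  have i2: "integrable lborel (\<lambda>x::'a. exp (- (norm x)\<^sup>2 / 2))"
    using integrable_gaussian(1)[of "1 / 2" "0::'a"] by simp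
  \<comment> \<open>Exchanging integrals and inserting the transform of the damping factor exhibits
    \<open>U n b\<close> as an average of \<phi> around \<open>b\<close> with Gaussian weight of
    scale \<open>e n\<close>. The powers of \<open>e n\<close> from the transform and from rescaling
    cancel.\<close>
  have U: "U n b = of_real p * (LBINT z. \<phi> (b + e n *\<^sub>R z) * of_real (exp (- (norm z)\<^sup>2 / 2)))" for n b
  proof -
    have "U n b = (LBINT x. LBINT b'. \<phi> b' * (of_real (exp (- (e n)\<^sup>2 * (norm x)\<^sup>2 / 2)) * cis ((b - b') \<bullet> x)))"
      unfolding U_def
    proof (intro Bochner_Integration.integral_cong refl)
      fix x
      have "\<Phi> x * of_real (exp (- (e n)\<^sup>2 * (norm x)\<^sup>2 / 2)) * cis (b \<bullet> x)
         = (LBINT b'. (\<phi> b' * cis (- (b' \<bullet> x))) * (of_real (exp (- (e n)\<^sup>2 * (norm x)\<^sup>2 / 2)) * cis (b \<bullet> x)))"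
        unfolding \<Phi>_def integral_mult_left_zero by (rule mult.assoc)
      also have "\<dots> = (LBINT b'. \<phi> b' * (of_real (exp (- (e n)\<^sup>2 * (norm x)\<^sup>2 / 2)) * cis ((b - b') \<bullet> x)))"
      proof (intro Bochner_Integration.integral_cong refl)
        fix b'
        have "cis ((b - b') \<bullet> x) = cis (- (b' \<bullet> x)) * cis (b \<bullet> x)"
          by (simp add: cis_mult inner_diff_left)
        then show "\<phi> b' * cis (- (b' \<bullet> x)) * (of_real (exp (- (e n)\<^sup>2 * (norm x)\<^sup>2 / 2)) * cis (b \<bullet> x))
          = \<phi> b' * (of_real (exp (- (e n)\<^sup>2 * (norm x)\<^sup>2 / 2)) * cis ((b - b') \<bullet> x))" by simp
      qed
      finally show "\<Phi> x * of_real (exp (- (e n)\<^sup>2 * (norm x)\<^sup>2 / 2)) * cis (b \<bullet> x) = \<dots>" .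
    qed
    also have "\<dots> = (LBINT b'. LBINT x. \<phi> b' * (of_real (exp (- (e n)\<^sup>2 * (norm x)\<^sup>2 / 2)) * cis ((b - b') \<bullet> x)))"
      by (rule fubini_product_bound(2)[OF _ ie[of n] integrable_norm[OF i\<phi>]]) (auto simp: norm_mult)
    also have "\<dots> = (LBINT b'. \<phi> b' * of_real (p / e n ^ DIM('a) * exp (- (norm (b - b') / e n)\<^sup>2 / 2)))"
      by (simp only: integral_mult_right_zero gaussian_fourier_scaled(2)[OF e0] p_def)
    also have "\<dots> = \<bar>e n\<bar> ^ DIM('a) *\<^sub>R (LBINT z. \<phi> (b + e n *\<^sub>R z) *
        of_real (p / e n ^ DIM('a) * exp (- (norm (b - (b + e n *\<^sub>R z)) / e n)\<^sup>2 / 2)))"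
    proof (rule integral_affine(2)[symmetric])
      show "integrable lborel (\<lambda>b'. \<phi> b' * of_real (p / e n ^ DIM('a) * exp (- (norm (b - b') / e n)\<^sup>2 / 2)))"
      proof (rule Bochner_Integration.integrable_bound[OF integrable_mult_right[OF integrable_norm[OF i\<phi>], of "p / e n ^ DIM('a)"]])
        show "AE b' in lborel. norm (\<phi> b' * of_real (p / e n ^ DIM('a) * exp (- (norm (b - b') / e n)\<^sup>2 / 2)))
          \<le> norm (p / e n ^ DIM('a) * norm (\<phi> b'))"
        proof (rule AE_I2)
          fix b'
          have k: "p / e n ^ DIM('a) \<ge> 0" using p0 e0[of n] by simp
          then have "p / e n ^ DIM('a) * exp (- (norm (b - b') / e n)\<^sup>2 / 2) \<le> p / e n ^ DIM('a)"
            by (intro mult_left_le) auto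
          from mult_left_mono[OF this, of "norm (\<phi> b')"] k
          show "norm (\<phi> b' * of_real (p / e n ^ DIM('a) * exp (- (norm (b - b') / e n)\<^sup>2 / 2)))
            \<le> norm (p / e n ^ DIM('a) * norm (\<phi> b'))"
            by (simp only: norm_mult norm_of_real abs_mult abs_of_nonneg abs_norm_cancel real_norm_def
                abs_exp_cancel mult.commute norm_ge_zero)
        qed
      qed measurable
    qed (use e0[of n] in simp)
    also have "\<dots> = of_real p * (LBINT z. \<phi> (b + e n *\<^sub>R z) * of_real (exp (- (norm z)\<^sup>2 / 2)))"
    proof -
      have "\<phi> (b + e n *\<^sub>R z) * of_real (p / e n ^ DIM('a) * exp (- (norm (b - (b + e n *\<^sub>R z)) / e n)\<^sup>2 / 2))
        = of_real (p / e n ^ DIM('a)) * (\<phi> (b + e n *\<^sub>R z) * of_real (exp (- (norm z)\<^sup>2 / 2)))" for z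
        using e0[of n] by simp
      then have "(LBINT z. \<phi> (b + e n *\<^sub>R z) *
          of_real (p / e n ^ DIM('a) * exp (- (norm (b - (b + e n *\<^sub>R z)) / e n)\<^sup>2 / 2)))
        = of_real (p / e n ^ DIM('a)) * (LBINT z. \<phi> (b + e n *\<^sub>R z) * of_real (exp (- (norm z)\<^sup>2 / 2)))"
        by (simp only: integral_mult_right_zero)
      then show ?thesis
        using e0[of n] by (simp add: scaleR_conv_of_real)
    qed
    finally show ?thesis .
  qed
  define I where "I n = (LBINT x. (norm (\<Phi> x))\<^sup>2 * exp (- (e n)\<^sup>2 * (norm x)\<^sup>2 / 2))" for n
  have iI: "integrable lborel (\<lambda>x. (norm (\<Phi> x))\<^sup>2 * exp (- (e n)\<^sup>2 * (norm x)\<^sup>2 / 2))" for n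
    using power_mono[OF \<Phi>B, of _ 2]
    by (intro Bochner_Integration.integrable_bound[OF integrable_mult_right[OF ie[of n], of "B\<^sup>2"]])
      (auto intro!: AE_I2 mult_right_mono)
  \<comment> \<open>Only the conjugate factor of the squared modulus is expanded as an integral;
    after the exchange the inner integral is \<open>U n b\<close>.\<close>
  have IU: "of_real (I n) = (LBINT b. cnj (\<phi> b) * U n b)" for n
  proof -
    have "of_real (I n) = (LBINT x. (of_real ((norm (\<Phi> x))\<^sup>2 * exp (- (e n)\<^sup>2 * (norm x)\<^sup>2 / 2)) :: complex))"
      unfolding I_def by (rule integral_complex_of_real[symmetric])
    also have "\<dots> = (LBINT x. LBINT b. cnj (\<phi> b) * (\<Phi> x * of_real (exp (- (e n)\<^sup>2 * (norm x)\<^sup>2 / 2)) * cis (b \<bullet> x)))"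
    proof (intro Bochner_Integration.integral_cong refl)
      fix x
      have "cnj (\<Phi> x) = (LBINT b. cnj (\<phi> b * cis (- (b \<bullet> x))))"
        unfolding \<Phi>_def by (rule Bochner_Integration.integral_cnj[of lborel "\<lambda>b. \<phi> b * cis (- (b \<bullet> x))", symmetric])
      then have "cnj (\<Phi> x) = (LBINT b. cnj (\<phi> b) * cis (b \<bullet> x))" by (simp add: cis_cnj)
      then have "of_real ((norm (\<Phi> x))\<^sup>2 * exp (- (e n)\<^sup>2 * (norm x)\<^sup>2 / 2))
        = (\<Phi> x * of_real (exp (- (e n)\<^sup>2 * (norm x)\<^sup>2 / 2))) * (LBINT b. cnj (\<phi> b) * cis (b \<bullet> x))"
        using complex_norm_square[of "\<Phi> x"] by (simp add: mult_ac)
      also have "\<dots> = (LBINT b. (\<Phi> x * of_real (exp (- (e n)\<^sup>2 * (norm x)\<^sup>2 / 2))) * (cnj (\<phi> b) * cis (b \<bullet> x)))"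
        by (simp only: integral_mult_right_zero)
      finally show "of_real ((norm (\<Phi> x))\<^sup>2 * exp (- (e n)\<^sup>2 * (norm x)\<^sup>2 / 2))
        = (LBINT b. cnj (\<phi> b) * (\<Phi> x * of_real (exp (- (e n)\<^sup>2 * (norm x)\<^sup>2 / 2)) * cis (b \<bullet> x)))"
        by (simp add: mult_ac)
    qed
    also have "\<dots> = (LBINT b. LBINT x. cnj (\<phi> b) * (\<Phi> x * of_real (exp (- (e n)\<^sup>2 * (norm x)\<^sup>2 / 2)) * cis (b \<bullet> x)))"
    proof (rule fubini_product_bound(2)[OF _ integrable_mult_right[OF ie[of n], of B] integrable_norm[OF i\<phi>]])
      show "norm (cnj (\<phi> b) * (\<Phi> x * of_real (exp (- (e n)\<^sup>2 * (norm x)\<^sup>2 / 2)) * cis (b \<bullet> x)))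
         \<le> B * exp (- (e n)\<^sup>2 * (norm x)\<^sup>2 / 2) * norm (\<phi> b)" for x b
        using mult_right_mono[OF \<Phi>B[of x], of "exp (- (e n)\<^sup>2 * (norm x)\<^sup>2 / 2) * norm (\<phi> b)"]
        by (simp add: norm_mult mult_ac)
    qed measurable
    finally show ?thesis by (simp only: integral_mult_right_zero U_def)
  qed
  \<comment> \<open>The averages concentrate at \<open>b\<close> by continuity. The Gaussian weight
    has total mass \<open>p\<close>, so together with the prefactor the limit carries
    \<open>p * p\<close>, the constant of Plancherel's formula.\<close>
  have Ulim: "(\<lambda>n. U n b) \<longlonglongrightarrow> of_real (p * p) * \<phi> b" for b
  proof -
    have "(\<lambda>n. LBINT z. \<phi> (b + e n *\<^sub>R z) * of_real (exp (- (norm z)\<^sup>2 / 2)))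
      \<longlonglongrightarrow> (LBINT z. \<phi> b * of_real (exp (- (norm (z::'a))\<^sup>2 / 2)))"
    proof (rule integral_dominated_convergence[where w = "\<lambda>z. c * exp (- (norm z)\<^sup>2 / 2)"])
      show "AE z in lborel. (\<lambda>n. \<phi> (b + e n *\<^sub>R z) * of_real (exp (- (norm z)\<^sup>2 / 2)))
        \<longlonglongrightarrow> \<phi> b * of_real (exp (- (norm (z::'a))\<^sup>2 / 2))"
      proof (rule AE_I2)
        fix z :: 'a
        have "(\<lambda>n. b + e n *\<^sub>R z) \<longlonglongrightarrow> b + 0 *\<^sub>R z" by (intro tendsto_intros elim)
        then have "(\<lambda>n. \<phi> (b + e n *\<^sub>R z)) \<longlonglongrightarrow> \<phi> b"
          using cont by (intro continuous_on_tendsto_compose[OF cont, of _ b]) auto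
        then show "(\<lambda>n. \<phi> (b + e n *\<^sub>R z) * of_real (exp (- (norm z)\<^sup>2 / 2)))
          \<longlonglongrightarrow> \<phi> b * of_real (exp (- (norm z)\<^sup>2 / 2))" by (intro tendsto_intros)
      qed
      show "AE z in lborel. norm (\<phi> (b + e n *\<^sub>R z) * of_real (exp (- (norm z)\<^sup>2 / 2)))
        \<le> c * exp (- (norm (z::'a))\<^sup>2 / 2)" for n
        using bc by (auto simp: norm_mult intro!: AE_I2 mult_right_mono)
    qed (use i2 in auto)
    also have "(LBINT z. \<phi> b * of_real (exp (- (norm (z::'a))\<^sup>2 / 2))) = \<phi> b * of_real p"
      using gaussian_fourier(2)[of "0::'a"] by (simp add: p_def)
    finally have "(\<lambda>n. of_real p * (LBINT z. \<phi> (b + e n *\<^sub>R z) * of_real (exp (- (norm z)\<^sup>2 / 2))))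
      \<longlonglongrightarrow> of_real p * (\<phi> b * of_real p)" by (rule tendsto_mult_left)
    then show ?thesis unfolding U by (simp add: mult_ac)
  qed
  have UB: "norm (U n b) \<le> p * (c * p)" for n b
  proof -
    have "norm (LBINT z. \<phi> (b + e n *\<^sub>R z) * of_real (exp (- (norm (z::'a))\<^sup>2 / 2)))
      \<le> (LBINT z. c * exp (- (norm (z::'a))\<^sup>2 / 2))"
      using bc c0 i2 by (intro order_trans[OF integral_norm_bound] integral_mono' integrable_mult_right)
        (auto simp: norm_mult intro!: mult_right_mono)
    also have "\<dots> = c * p"
      using integrable_gaussian(2)[of "1/2" "0::'a"] by (simp add: p_def mult.commute)
    finally show ?thesis
      unfolding U using p0 by (simp add: norm_mult)
  qed
  have [measurable]: "U n \<in> borel_measurable borel" for n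
    unfolding U_def[abs_def] by measurable
  have "(\<lambda>n. LBINT b. cnj (\<phi> b) * U n b) \<longlonglongrightarrow> (LBINT b. cnj (\<phi> b) * (of_real (p * p) * \<phi> b))"
  proof (rule integral_dominated_convergence[where w = "\<lambda>b. norm (\<phi> b) * (p * (c * p))"])
    show "AE b in lborel. (\<lambda>n. cnj (\<phi> b) * U n b) \<longlonglongrightarrow> cnj (\<phi> b) * (of_real (p * p) * \<phi> b)"
      by (intro AE_I2 tendsto_mult tendsto_const Ulim)
    show "AE b in lborel. norm (cnj (\<phi> b) * U n b) \<le> norm (\<phi> b) * (p * (c * p))" for n
      using UB by (auto simp: norm_mult intro!: AE_I2 mult_left_mono)
  qed (use i\<phi> in auto)
  also have "(LBINT b. cnj (\<phi> b) * (of_real (p * p) * \<phi> b)) = (LBINT b. of_real (p * p * (norm (\<phi> b))\<^sup>2))"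
    by (intro Bochner_Integration.integral_cong refl) (simp only: of_real_mult complex_norm_square mult_ac)
  also have "\<dots> = of_real (p * p * (LBINT b. (norm (\<phi> b))\<^sup>2))"
    by (simp only: integral_complex_of_real integral_mult_right_zero)
  finally have "(\<lambda>n. I n) \<longlonglongrightarrow> p * p * (LBINT b. (norm (\<phi> b))\<^sup>2)"
    unfolding IU[symmetric] tendsto_of_real_iff .
  then have lim1: "(\<lambda>n. ennreal (I n)) \<longlonglongrightarrow> ennreal (p * p * (LBINT b. (norm (\<phi> b))\<^sup>2))"
    by (rule tendsto_ennrealI)
  have In: "ennreal (I n) = (\<integral>\<^sup>+x. ennreal ((norm (\<Phi> x))\<^sup>2 * exp (- (e n)\<^sup>2 * (norm x)\<^sup>2 / 2)) \<partial>lborel)" for n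
    unfolding I_def by (rule nn_integral_eq_integral[OF iI, symmetric]) simp
  have "(\<lambda>n. \<integral>\<^sup>+x. ennreal ((norm (\<Phi> x))\<^sup>2 * exp (- (e n)\<^sup>2 * (norm x)\<^sup>2 / 2)) \<partial>lborel)
     \<longlonglongrightarrow> (\<integral>\<^sup>+x. ennreal ((norm (\<Phi> x))\<^sup>2) \<partial>lborel)"
  proof (rule nn_integral_LIMSEQ)
    have "e m \<le> e n" if "n \<le> m" for m n using that by (simp add: e_def frac_le)
    then have "(e m)\<^sup>2 \<le> (e n)\<^sup>2" if "n \<le> m" for m n using that e0[of m] by (intro power_mono) auto
    then show "incseq (\<lambda>n x. ennreal ((norm (\<Phi> x))\<^sup>2 * exp (- (e n)\<^sup>2 * (norm x)\<^sup>2 / 2)))"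
      by (auto simp: incseq_def le_fun_def intro!: ennreal_leI mult_left_mono mult_right_mono divide_right_mono)
    fix x
    have "(\<lambda>n. (norm (\<Phi> x))\<^sup>2 * exp (- (e n)\<^sup>2 * (norm x)\<^sup>2 / 2)) \<longlonglongrightarrow> (norm (\<Phi> x))\<^sup>2 * exp (- 0\<^sup>2 * (norm x)\<^sup>2 / 2)"
      by (intro tendsto_intros elim) simp
    then show "(\<lambda>n. ennreal ((norm (\<Phi> x))\<^sup>2 * exp (- (e n)\<^sup>2 * (norm x)\<^sup>2 / 2))) \<longlonglongrightarrow> ennreal ((norm (\<Phi> x))\<^sup>2)"
      by (intro tendsto_ennrealI) simp
  qed measurable
  from LIMSEQ_unique[OF this[folded In] lim1]
  have "(\<integral>\<^sup>+x. ennreal ((norm (\<Phi> x))\<^sup>2) \<partial>lborel) = ennreal (p * p) * ennreal (LBINT b. (norm (\<phi> b))\<^sup>2)"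
    using p0 by (simp add: ennreal_mult)
  also have "ennreal (LBINT b. (norm (\<phi> b))\<^sup>2) = (\<integral>\<^sup>+b. ennreal ((norm (\<phi> b))\<^sup>2) \<partial>lborel)"
  proof (rule nn_integral_eq_integral[symmetric])
    show "integrable lborel (\<lambda>b. (norm (\<phi> b))\<^sup>2)"
      using bc by (intro Bochner_Integration.integrable_bound[OF integrable_mult_right[OF integrable_norm[OF i\<phi>], of c]])
        (auto simp: power2_eq_square intro!: AE_I2 mult_right_mono order_trans[OF _ abs_ge_self])
  qed simp
  finally show ?thesis unfolding pp \<Phi>_def .
qed

text \<open>The squared norm of Bargmann-Fock space without its normalising constant, taken in
  [0, \<infinity>] so that it can be compared before finiteness is known.\<close>

definition fock_energy :: "(complex^'n \<Rightarrow> complex) \<Rightarrow> ennreal" where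
  "fock_energy G = (\<integral>\<^sup>+p. ennreal ((norm (G (cvec p)))\<^sup>2 * exp (- (norm p)\<^sup>2)) \<partial>lborel)"

text \<open>\<open>G\<close> is the Bargmann transform of \<open>u f\<^sub>\<infinity>\<close>, expressed by the inversion formula along every
  vertical line \<open>Re z = a\<close>; this avoids growth conditions on \<open>u\<close>.\<close>

definition inversion :: "(real^'n \<Rightarrow> real) \<Rightarrow> (complex^'n \<Rightarrow> complex) \<Rightarrow> bool" where
  "inversion u G \<longleftrightarrow> (\<forall>a x. of_real ((2 * pi) powr (CARD('n) / 2) * exp (- (norm x)\<^sup>2 / 2) * u x)
     = (LBINT b. exp (bil (cvec (a, b)) (cvec (a, b)) / 2 - bil (cvec (a, b)) (creal x)) * G (cvec (a, b))))"

lemma exp_inversion_kernel: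
  "exp (bil (cvec (a, b)) (cvec (a, b)) / 2 - bil (cvec (a, b)) (creal x))
   = of_real (exp (- (a \<bullet> x))) * (exp (bil (cvec (a, b)) (cvec (a, b)) / 2) * cis (- (b \<bullet> x)))"
proof -
  have "bil (cvec (a, b)) (creal x) = of_real (a \<bullet> x) + \<i> * of_real (b \<bullet> x)"
    by (simp add: bil_creal complex_eq_iff)
  then show ?thesis
    by (simp only: exp_diff exp_add exp_minus cis_conv_exp exp_of_real[symmetric] of_real_minus
        mult_minus_right divide_inverse inverse_mult_distrib) (simp add: mult_ac exp_of_real)
qed

lemma norm_exp_half_bil:
  "norm (exp (bil (cvec (a, b)) (cvec (a, b)) / 2)) = exp (((norm a)\<^sup>2 - (norm b)\<^sup>2) / 2)"
  by (simp add: bil_self)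

text \<open>For fixed \<open>a\<close> the inversion formula says that
  \<open>exp (a \<bullet> x - (norm x)\<^sup>2 / 2) * u x\<close> is, up to a constant, a Fourier
  transform in \<open>b\<close>. Its density decays like \<open>exp (- (norm b)\<^sup>2 / 2)\<close>
  before the growth of \<open>G\<close> is counted, hence \<kappa> < 1/2.\<close>

lemma inversion_plancherel:
  fixes u :: "real^'n \<Rightarrow> real"
  assumes inv: "inversion u G" and cont: "continuous_on UNIV G"
    and growth: "\<And>z. norm (G z) \<le> c * exp (\<kappa> * (norm z)\<^sup>2)" and \<kappa>: "\<kappa> < 1 / 2"
  shows "(\<integral>\<^sup>+x. ennreal ((u x)\<^sup>2 * exp (2 * (a \<bullet> x) - (norm x)\<^sup>2)) \<partial>lborel)
    = (\<integral>\<^sup>+b. ennreal (exp ((norm a)\<^sup>2 - (norm b)\<^sup>2) * (norm (G (cvec (a, b))))\<^sup>2) \<partial>lborel)"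
proof -
  define \<phi> where "\<phi> b = exp (bil (cvec (a, b)) (cvec (a, b)) / 2) * G (cvec (a, b))" for b
  define q where "q = (2 * pi) powr (CARD('n) / 2)"
  have q: "q > 0" "q\<^sup>2 = (2 * pi) ^ DIM(real^'n)"
    by (simp_all add: q_def power2_eq_square powr_add[symmetric] powr_realpow)
  have contG: "continuous_on S (\<lambda>b. G (cvec (a, b)))" for S
    by (rule continuous_on_compose2[OF cont]) (auto intro!: continuous_intros)
  have cont\<phi>: "continuous_on UNIV \<phi>"
    unfolding \<phi>_def by (intro continuous_intros bil.continuous_on contG) auto
  have n\<phi>: "norm (\<phi> b) = exp (((norm a)\<^sup>2 - (norm b)\<^sup>2) / 2) * norm (G (cvec (a, b)))" for b
    unfolding \<phi>_def norm_mult norm_exp_half_bil ..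
  have bound: "norm (\<phi> b) \<le> (c * exp ((1 / 2 + \<kappa>) * (norm a)\<^sup>2)) * exp (- (1 / 2 - \<kappa>) * (norm b)\<^sup>2)" for b
  proof -
    have "norm (\<phi> b) \<le> exp (((norm a)\<^sup>2 - (norm b)\<^sup>2) / 2) * (c * exp (\<kappa> * ((norm a)\<^sup>2 + (norm b)\<^sup>2)))"
      unfolding n\<phi> using growth[of "cvec (a, b)"] by (intro mult_left_mono) (auto simp: norm_Pair)
    also have "\<dots> = c * exp (((norm a)\<^sup>2 - (norm b)\<^sup>2) / 2 + \<kappa> * ((norm a)\<^sup>2 + (norm b)\<^sup>2))"
      by (simp only: exp_add mult_ac)
    also have "((norm a)\<^sup>2 - (norm b)\<^sup>2) / 2 + \<kappa> * ((norm a)\<^sup>2 + (norm b)\<^sup>2)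
       = (1 / 2 + \<kappa>) * (norm a)\<^sup>2 + - (1 / 2 - \<kappa>) * (norm b)\<^sup>2"
      by (simp add: field_simps)
    finally show ?thesis by (simp only: exp_add mult.assoc)
  qed
  have Phi: "(LBINT b. \<phi> b * cis (- (b \<bullet> x))) = of_real (q * exp (a \<bullet> x - (norm x)\<^sup>2 / 2) * u x)" for x
  proof -
    have "of_real (q * exp (- (norm x)\<^sup>2 / 2) * u x)
      = (LBINT b. of_real (exp (- (a \<bullet> x))) * (\<phi> b * cis (- (b \<bullet> x))))"
      using inv unfolding inversion_def q_def \<phi>_def exp_inversion_kernel
      by (simp only: mult_ac)
    also have "\<dots> = of_real (exp (- (a \<bullet> x))) * (LBINT b. \<phi> b * cis (- (b \<bullet> x)))"
      by (rule integral_mult_right_zero)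
    finally have "of_real (exp (a \<bullet> x)) * of_real (q * exp (- (norm x)\<^sup>2 / 2) * u x)
       = of_real (exp (a \<bullet> x)) * of_real (exp (- (a \<bullet> x))) * (LBINT b. \<phi> b * cis (- (b \<bullet> x)))"
      by (simp only: mult.assoc)
    also have "of_real (exp (a \<bullet> x)) * of_real (exp (- (a \<bullet> x))) = (1::complex)"
      by (simp flip: of_real_mult exp_add)
    finally have "(LBINT b. \<phi> b * cis (- (b \<bullet> x)))
      = of_real (exp (a \<bullet> x)) * of_real (q * exp (- (norm x)\<^sup>2 / 2) * u x)" by simp
    moreover have "exp (a \<bullet> x - (norm x)\<^sup>2 / 2) = exp (a \<bullet> x) * exp (- (norm x)\<^sup>2 / 2)"
      by (simp add: exp_add[symmetric])
    ultimately show ?thesis by (simp only: of_real_mult mult_ac)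
  qed
  have P: "(\<integral>\<^sup>+x. ennreal ((norm (LBINT b. \<phi> b * cis (- (b \<bullet> x))))\<^sup>2) \<partial>lborel)
     = ennreal (q\<^sup>2) * (\<integral>\<^sup>+b. ennreal ((norm (\<phi> b))\<^sup>2) \<partial>lborel)"
    unfolding q(2) by (rule plancherel_gaussian_bounded[OF cont\<phi> _ bound]) (use \<kappa> in simp)
  have P1: "(norm (LBINT b. \<phi> b * cis (- (b \<bullet> x))))\<^sup>2 = q\<^sup>2 * ((u x)\<^sup>2 * exp (2 * (a \<bullet> x) - (norm x)\<^sup>2))" for x
  proof -
    have "(exp (a \<bullet> x - (norm x)\<^sup>2 / 2))\<^sup>2 = exp (2 * (a \<bullet> x) - (norm x)\<^sup>2)"
      by (simp add: power2_eq_square exp_add[symmetric])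
    then show ?thesis unfolding Phi norm_of_real power2_abs by (simp add: power_mult_distrib mult_ac)
  qed
  have P2: "(norm (\<phi> b))\<^sup>2 = exp ((norm a)\<^sup>2 - (norm b)\<^sup>2) * (norm (G (cvec (a, b))))\<^sup>2" for b
  proof -
    have "(exp (((norm a)\<^sup>2 - (norm b)\<^sup>2) / 2))\<^sup>2 = exp ((norm a)\<^sup>2 - (norm b)\<^sup>2)"
      by (simp add: power2_eq_square exp_add[symmetric])
    then show ?thesis unfolding n\<phi> by (simp add: power_mult_distrib)
  qed
  have e: "(\<integral>\<^sup>+x. ennreal (q\<^sup>2) * ennreal ((u x)\<^sup>2 * exp (2 * (a \<bullet> x) - (norm x)\<^sup>2)) \<partial>lborel)
     = ennreal (q\<^sup>2) * (\<integral>\<^sup>+b. ennreal (exp ((norm a)\<^sup>2 - (norm b)\<^sup>2) * (norm (G (cvec (a, b))))\<^sup>2) \<partial>lborel)"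
    using P unfolding P1 P2 by (simp add: ennreal_mult)
  have [measurable]: "\<phi> \<in> borel_measurable borel"
    using cont\<phi> by (rule borel_measurable_continuous_onI)
  have "u x = Re (LBINT b. \<phi> b * cis (- (b \<bullet> x))) / (q * exp (a \<bullet> x - (norm x)\<^sup>2 / 2))" for x
    unfolding Phi using q by simp
  then have [measurable]: "u \<in> borel_measurable borel"
    by (subst measurable_cong[of _ _ "\<lambda>x. Re (LBINT b. \<phi> b * cis (- (b \<bullet> x))) / (q * exp (a \<bullet> x - (norm x)\<^sup>2 / 2))"]) auto
  show ?thesis
    using e q(1) by (simp add: nn_integral_cmult ennreal_mult_cancel_left)
qed

text \<open>The formula on the single line a = 0 writes \<open>u\<close> as a parameter integral
  divided by a positive continuous function.\<close>

lemma inversion_measurable: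
  fixes u :: "real^'n \<Rightarrow> real"
  assumes inv: "inversion u G" and cont: "continuous_on UNIV G"
  shows "u \<in> borel_measurable borel"
proof -
  define \<phi> where "\<phi> b = exp (bil (cvec (0, b)) (cvec (0, b)) / 2) * G (cvec (0, b))" for b
  have "continuous_on UNIV (\<lambda>b. G (cvec (0, b)))"
    by (rule continuous_on_compose2[OF cont]) (auto intro!: continuous_intros)
  then have "continuous_on UNIV \<phi>"
    unfolding \<phi>_def by (intro continuous_intros bil.continuous_on) auto
  then have [measurable]: "\<phi> \<in> borel_measurable borel"
    by (rule borel_measurable_continuous_onI)
  have R: "of_real ((2 * pi) powr (CARD('n) / 2) * exp (- (norm x)\<^sup>2 / 2) * u x) = (LBINT b. \<phi> b * cis (- (b \<bullet> x)))" for x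
    using inv[unfolded inversion_def, rule_format, of x 0] unfolding \<phi>_def exp_inversion_kernel
    by (simp add: mult_ac)
  then have "Re (LBINT b. \<phi> b * cis (- (b \<bullet> x))) = (2 * pi) powr (CARD('n) / 2) * exp (- (norm x)\<^sup>2 / 2) * u x" for x
    by (simp only: R[symmetric] Re_complex_of_real)
  then have "u x = Re (LBINT b. \<phi> b * cis (- (b \<bullet> x))) / ((2 * pi) powr (CARD('n) / 2) * exp (- (norm x)\<^sup>2 / 2))" for x
    by simp
  then show ?thesis
    by (subst measurable_cong[of _ _ "\<lambda>x. Re (LBINT b. \<phi> b * cis (- (b \<bullet> x)))
      / ((2 * pi) powr (CARD('n) / 2) * exp (- (norm x)\<^sup>2 / 2))"]) auto
qed

text \<open>Plancherel on each vertical line is integrated over \<open>a\<close> against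
  \<open>exp (- 2 * (norm a)\<^sup>2)\<close>. On the side of \<open>u\<close> the integral over
  \<open>a\<close> is a shifted Gaussian and turns the weight
  \<open>exp (- (norm x)\<^sup>2)\<close> into \<open>exp (- (norm x)\<^sup>2 / 2)\<close>; on the
  side of \<open>G\<close> the exponents combine to the Fock weight. The factor
  \<open>pi powr - CARD('n)\<close> is the quotient of the constant in \<open>f_inf\<close> by
  \<open>s\<close>.\<close>

theorem inversion_isometry:
  fixes u :: "real^'n \<Rightarrow> real"
  assumes inv: "inversion u G" and cont: "continuous_on UNIV G"
    and growth: "\<And>z. norm (G z) \<le> c * exp (\<kappa> * (norm z)\<^sup>2)" and \<kappa>: "\<kappa> < 1 / 2"
  shows "(\<integral>\<^sup>+x. ennreal ((u x)\<^sup>2 * f_inf x) \<partial>lborel) = ennreal (pi powr - CARD('n)) * fock_energy G"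
proof -
  note [measurable] = inversion_measurable[OF inv cont]
  have G[measurable]: "G \<in> borel_measurable borel"
    using cont by (rule borel_measurable_continuous_onI)
  define s where "s = (pi / 2) powr (CARD('n) / 2)"
  have s: "s > 0" by (simp add: s_def)
  have gx: "(\<integral>\<^sup>+a. ennreal (exp (2 * (a \<bullet> x) - 2 * (norm a)\<^sup>2)) \<partial>lborel) = ennreal (s * exp ((norm x)\<^sup>2 / 2))"
    for x :: "real^'n"
  proof -
    have e: "exp (2 * (a \<bullet> x) - 2 * (norm a)\<^sup>2) = exp ((norm x)\<^sup>2 / 2) * exp (- 2 * (norm (a - (1 / 2) *\<^sub>R x))\<^sup>2)" for a
      by (simp add: exp_add[symmetric] power2_norm_eq_inner inner_diff inner_commute algebra_simps)
    have "(\<integral>\<^sup>+a. ennreal (exp ((norm x)\<^sup>2 / 2) * exp (- 2 * (norm (a - (1 / 2) *\<^sub>R x))\<^sup>2)) \<partial>lborel)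
      = ennreal (LBINT a. exp ((norm x)\<^sup>2 / 2) * exp (- 2 * (norm (a - (1 / 2) *\<^sub>R x))\<^sup>2))"
      using integrable_gaussian(1)[of 2 "(1 / 2) *\<^sub>R x"] by (intro nn_integral_eq_integral) auto
    then show ?thesis
      using integrable_gaussian(2)[of 2 "(1 / 2) *\<^sub>R x"] unfolding e by (simp add: s_def mult.commute)
  qed
  have "ennreal s * (\<integral>\<^sup>+x. ennreal ((u x)\<^sup>2 * exp (- (norm x)\<^sup>2 / 2)) \<partial>lborel)
     = (\<integral>\<^sup>+x. ennreal ((u x)\<^sup>2 * exp (- (norm x)\<^sup>2)) * (\<integral>\<^sup>+a. ennreal (exp (2 * (a \<bullet> x) - 2 * (norm a)\<^sup>2)) \<partial>lborel) \<partial>lborel)"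
    unfolding gx using s
    by (subst nn_integral_cmult[symmetric], measurable)
      (auto intro!: nn_integral_cong simp: ennreal_mult[symmetric] mult_ac exp_add[symmetric])
  also have "\<dots> = (\<integral>\<^sup>+x. \<integral>\<^sup>+a. ennreal ((u x)\<^sup>2 * exp (- (norm x)\<^sup>2) * exp (2 * (a \<bullet> x) - 2 * (norm a)\<^sup>2)) \<partial>lborel \<partial>lborel)"
    by (subst nn_integral_cmult[symmetric], measurable) (auto simp: ennreal_mult[symmetric])
  also have "\<dots> = (\<integral>\<^sup>+a. \<integral>\<^sup>+x. ennreal ((u x)\<^sup>2 * exp (- (norm x)\<^sup>2) * exp (2 * (a \<bullet> x) - 2 * (norm a)\<^sup>2)) \<partial>lborel \<partial>lborel)"
    by (rule lborel_pair.Fubini') measurable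
  also have "\<dots> = (\<integral>\<^sup>+a. ennreal (exp (- 2 * (norm a)\<^sup>2)) * (\<integral>\<^sup>+x. ennreal ((u x)\<^sup>2 * exp (2 * (a \<bullet> x) - (norm x)\<^sup>2)) \<partial>lborel) \<partial>lborel)"
    by (subst nn_integral_cmult[symmetric], measurable)
      (auto intro!: nn_integral_cong arg_cong[of _ _ ennreal] simp: ennreal_mult[symmetric] mult_ac exp_add[symmetric])
  also have "\<dots> = (\<integral>\<^sup>+a. ennreal (exp (- 2 * (norm a)\<^sup>2)) *
      (\<integral>\<^sup>+b. ennreal (exp ((norm a)\<^sup>2 - (norm b)\<^sup>2) * (norm (G (cvec (a, b))))\<^sup>2) \<partial>lborel) \<partial>lborel)"
    unfolding inversion_plancherel[OF inv cont growth \<kappa>] ..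
  also have "\<dots> = (\<integral>\<^sup>+a. \<integral>\<^sup>+b. ennreal ((norm (G (cvec (a, b))))\<^sup>2 * exp (- (norm (a, b))\<^sup>2)) \<partial>lborel \<partial>lborel)"
    by (subst nn_integral_cmult[symmetric], measurable)
      (auto intro!: nn_integral_cong arg_cong[of _ _ ennreal] simp: ennreal_mult[symmetric] norm_Pair mult_ac exp_add[symmetric])
  also have "\<dots> = fock_energy G"
    unfolding fock_energy_def lborel_prod[symmetric]
  proof (rule lborel.nn_integral_fst[of "\<lambda>p. ennreal ((norm (G (cvec p)))\<^sup>2 * exp (- (norm p)\<^sup>2))"])
    have "(\<lambda>p. ennreal ((norm (G (cvec p)))\<^sup>2 * exp (- (norm p)\<^sup>2))) \<in> borel_measurable borel"
      by measurable
    then show "(\<lambda>p. ennreal ((norm (G (cvec p)))\<^sup>2 * exp (- (norm p)\<^sup>2))) \<in> borel_measurable (lborel \<Otimes>\<^sub>M lborel)"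
      by (simp add: lborel_prod)
  qed
  finally have F: "ennreal s * (\<integral>\<^sup>+x. ennreal ((u x)\<^sup>2 * exp (- (norm x)\<^sup>2 / 2)) \<partial>lborel) = fock_energy G" .
  define r where "r = (2 * pi) powr (- CARD('n) / 2)"
  have r: "r > 0" "r = pi powr (- CARD('n)) * s"
  proof -
    have "pi powr (- CARD('n)) = (pi powr (- CARD('n) / 2)) * (pi powr (- CARD('n) / 2))"
      by (simp add: powr_add[symmetric])
    then show "r = pi powr (- CARD('n)) * s"
      by (simp add: r_def s_def powr_mult powr_divide powr_minus field_simps)
  qed (simp add: r_def)
  have "(\<integral>\<^sup>+x. ennreal ((u x)\<^sup>2 * f_inf x) \<partial>lborel) = (\<integral>\<^sup>+x. ennreal r * ennreal ((u x)\<^sup>2 * exp (- (norm x)\<^sup>2 / 2)) \<partial>lborel)"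
    using r(1) by (intro nn_integral_cong) (auto simp: f_inf_def r_def ennreal_mult[symmetric] mult_ac)
  also have "\<dots> = ennreal r * (\<integral>\<^sup>+x. ennreal ((u x)\<^sup>2 * exp (- (norm x)\<^sup>2 / 2)) \<partial>lborel)"
    by (rule nn_integral_cmult) measurable
  also have "\<dots> = ennreal (pi powr - CARD('n)) * fock_energy G"
    unfolding F[symmetric] r(2) using s by (simp add: ennreal_mult mult.assoc)
  finally show ?thesis .
qed

section \<open>Contractions in Fock space\<close>

text \<open>The factor by which a linear bijection scales Lebesgue measure is found by testing a
  Gaussian: it is unchanged by isometries and its integral is positive and finite.\<close>

lemma lborel_isometry:
  fixes f :: "'a::euclidean_space \<Rightarrow> 'a"
  assumes f: "linear f" and n: "\<And>x. norm (f x) = norm x"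
  shows "distr lborel borel f = lborel"
proof -
  have "inj f" using f n by (metis linear_injective_0 norm_eq_zero)
  then have b: "bij f" using f by (simp add: bij_def linear_injective_imp_surjective)
  obtain k where k: "\<And>F. F \<in> borel_measurable borel \<Longrightarrow> (\<integral>\<^sup>+x. F (f x) \<partial>lborel) = k * (\<integral>\<^sup>+x. F x \<partial>lborel)"
    using nn_integral_linear_scale[OF f b] by blast
  let ?F = "\<lambda>x::'a. ennreal (exp (- 1 * (norm (x - 0))\<^sup>2))"
  have I: "(\<integral>\<^sup>+x. ?F x \<partial>lborel) = ennreal (pi powr (DIM('a) / 2))"
    using integrable_gaussian[of 1 "0::'a"] by (subst nn_integral_eq_integral) auto
  have "k * (\<integral>\<^sup>+x. ?F x \<partial>lborel) = 1 * (\<integral>\<^sup>+x. ?F x \<partial>lborel)"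
    using k[of ?F] by (simp add: n)
  then have "ennreal (pi powr (DIM('a) / 2)) * k = ennreal (pi powr (DIM('a) / 2)) * 1"
    unfolding I by (simp add: mult.commute)
  then have "k = 1"
    by (subst (asm) ennreal_mult_cancel_left) auto
  have [measurable]: "f \<in> borel_measurable borel"
    using f by (intro borel_measurable_continuous_onI linear_continuous_on) (simp add: linear_linear)
  show ?thesis
  proof (rule measure_eqI)
    fix X assume "X \<in> sets (distr lborel borel f)"
    then have [measurable]: "X \<in> sets borel" by simp
    have "emeasure (distr lborel borel f) X = (\<integral>\<^sup>+x. indicator X x \<partial>distr lborel borel f)" by simp
    also have "\<dots> = (\<integral>\<^sup>+x. indicator X (f x) \<partial>lborel)"
      by (rule nn_integral_distr) measurable
    also have "\<dots> = emeasure lborel X"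
      using k[of "indicator X"] by (simp add: \<open>k = 1\<close>)
    finally show "emeasure (distr lborel borel f) X = emeasure lborel X" .
  qed simp
qed

text \<open>Complex multiplication by \<open>l\<close> in real coordinates. For
  \<open>norm l = 1\<close> it preserves Lebesgue measure and the Gaussian weight.\<close>

definition rot :: "complex \<Rightarrow> (real^'n) \<times> (real^'n) \<Rightarrow> (real^'n) \<times> (real^'n)" where
  "rot l p = (Re l *\<^sub>R fst p - Im l *\<^sub>R snd p, Im l *\<^sub>R fst p + Re l *\<^sub>R snd p)"

lemma cvec_rot: "cvec (rot l p) = l *s cvec p"
  by (simp add: rot_def vec_eq_iff complex_eq_iff)

lemma norm_rot: "norm (rot l p) = norm l * norm p"
  by (metis cvec_rot norm_cvec norm_scale_vec)

lemma linear_rot: "linear (rot l)"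
  by (rule linearI) (simp_all add: rot_def prod_eq_iff algebra_simps)

lemma measurable_rot [measurable]: "rot l \<in> borel_measurable borel"
  by (intro borel_measurable_continuous_onI linear_continuous_on)
    (simp add: linear_conv_bounded_linear[symmetric] linear_rot)

lemma lborel_rot: "norm l = 1 \<Longrightarrow> distr lborel borel (rot l) = lborel"
  by (rule lborel_isometry[OF linear_rot]) (simp add: norm_rot)

lemma integral_rot:
  fixes F :: "(real^'n) \<times> (real^'n) \<Rightarrow> 'c::{banach,second_countable_topology}"
  assumes "norm l = 1" and [measurable]: "F \<in> borel_measurable borel"
  shows "(LBINT p. F (rot l p)) = (LBINT p. F p)"
  using integral_distr[of "rot l" lborel borel F] by (simp add: lborel_rot[OF assms(1)])

lemma gaussian_growth_integrable:
  fixes F :: "'a::euclidean_space \<Rightarrow> 'c::{banach,second_countable_topology}"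
  assumes "F \<in> borel_measurable borel" and "\<kappa> < 1"
    and "\<And>p. norm (F p) \<le> c * exp (\<kappa> * (norm p)\<^sup>2) * exp (- (norm p)\<^sup>2)"
  shows "integrable lborel F"
proof (rule Bochner_Integration.integrable_bound)
  show "integrable lborel (\<lambda>p. c * exp (- (1 - \<kappa>) * (norm (p - 0))\<^sup>2))"
    using assms(2) by (intro integrable_mult_right integrable_gaussian) simp
  show "AE p in lborel. norm (F p) \<le> norm (c * exp (- (1 - \<kappa>) * (norm (p - 0))\<^sup>2))"
  proof (rule AE_I2)
    fix p
    have "norm (F p) \<le> c * exp (- (1 - \<kappa>) * (norm (p - 0))\<^sup>2)"
      using assms(3)[of p] by (simp add: mult.assoc exp_add[symmetric] algebra_simps)
    then show "norm (F p) \<le> norm (c * exp (- (1 - \<kappa>) * (norm (p - 0))\<^sup>2))"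
      using abs_ge_self order_trans unfolding real_norm_def by blast
  qed
qed (use assms(1) in simp)

definition fock_real :: "(complex^'n \<Rightarrow> complex) \<Rightarrow> real" where
  "fock_real G = (LBINT p. (norm (G (cvec p)))\<^sup>2 * exp (- (norm p)\<^sup>2))"

lemma growth_nonneg:
  assumes "\<And>z. norm (G z) \<le> c * exp (\<kappa> * (norm z)\<^sup>2)"
  shows "0 \<le> c"
  using order_trans[OF norm_ge_zero assms[of 0]] by simp

text \<open>Squaring doubles the growth exponent, which must stay below the exponent 1 of the
  weight; this is the origin of the threshold 1/2.\<close>

lemma fock_real:
  assumes cont: "continuous_on UNIV G"
    and growth: "\<And>z. norm (G z) \<le> c * exp (\<kappa> * (norm z)\<^sup>2)" and \<kappa>: "\<kappa> < 1 / 2"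
  shows "integrable lborel (\<lambda>p. (norm (G (cvec p)))\<^sup>2 * exp (- (norm p)\<^sup>2))"
    and "fock_energy G = ennreal (fock_real G)" and "0 \<le> fock_real G"
proof -
  have [measurable]: "G \<in> borel_measurable borel"
    using cont by (rule borel_measurable_continuous_onI)
  show i: "integrable lborel (\<lambda>p. (norm (G (cvec p)))\<^sup>2 * exp (- (norm p)\<^sup>2))"
  proof (rule gaussian_growth_integrable[where \<kappa> = "2 * \<kappa>" and c = "c\<^sup>2"])
    fix p
    have "(norm (G (cvec p)))\<^sup>2 \<le> (c * exp (\<kappa> * (norm p)\<^sup>2))\<^sup>2"
      using growth[of "cvec p"] by (intro power_mono) auto
    also have "\<dots> = c\<^sup>2 * exp (2 * \<kappa> * (norm p)\<^sup>2)"
      by (simp add: power_mult_distrib power2_eq_square[of "exp _"] exp_add[symmetric])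
    finally show "norm ((norm (G (cvec p)))\<^sup>2 * exp (- (norm p)\<^sup>2))
        \<le> c\<^sup>2 * exp (2 * \<kappa> * (norm p)\<^sup>2) * exp (- (norm p)\<^sup>2)"
      by (simp add: mult_right_mono)
  qed (use \<kappa> in auto)
  show "fock_energy G = ennreal (fock_real G)"
    unfolding fock_energy_def fock_real_def by (rule nn_integral_eq_integral[OF i]) simp
  show "0 \<le> fock_real G"
    unfolding fock_real_def by (rule integral_nonneg_AE) simp
qed

lemma fock_real_rot:
  assumes cont: "continuous_on UNIV G" and "norm l = 1"
  shows "fock_real (\<lambda>z. G (l *s z)) = fock_real G"
proof -
  have [measurable]: "G \<in> borel_measurable borel"
    using cont by (rule borel_measurable_continuous_onI)
  show ?thesis
    unfolding fock_real_def
    using integral_rot[OF assms(2), of "\<lambda>p. (norm (G (cvec p)))\<^sup>2 * exp (- (norm p)\<^sup>2)"] assms(2)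
    by (simp add: cvec_rot norm_rot)
qed

text \<open>The pairing \<open>\<Lambda>(l) = \<langle>H(l \<cdot>), H(\<theta> \<cdot>)\<rangle>\<close> is holomorphic, vanishes at \<open>0\<close> and is bounded on the unit
  circle by rotation invariance of the Gaussian; Schwarz's lemma at \<open>l = \<theta>\<close> gives the factor \<open>\<theta>\<close>.\<close>

lemma fock_dilation:
  fixes H :: "complex^'n \<Rightarrow> complex"
  assumes H: "entire_vec H H'" and H0: "H 0 = 0"
    and growth: "\<And>z. norm (H z) \<le> c * exp (\<kappa> * (norm z)\<^sup>2)" and \<kappa>: "0 < \<kappa>" "\<kappa> < 1 / 2"
    and \<theta>: "0 < \<theta>" "\<theta> < 1"
  shows "fock_real (\<lambda>z. H (of_real \<theta> *s z)) \<le> \<theta>\<^sup>2 * fock_real H"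
proof -
  have cont: "continuous_on UNIV H" by (rule entire_vec_continuous[OF H])
  have [measurable]: "H \<in> borel_measurable borel"
    using cont by (rule borel_measurable_continuous_onI)
  have c0: "c \<ge> 0" using growth by (rule growth_nonneg)
  have sc[continuous_intros]: "continuous_on S (\<lambda>z. l *s z)" for S and l :: complex
    by (rule linear_continuous_on[OF bounded_linear_scale_vec2])
  have cont': "continuous_on UNIV (\<lambda>z. H (l *s z))" for l
    by (rule continuous_on_compose2[OF cont]) (auto intro: sc)
  have [measurable]: "(\<lambda>p. H (l *s cvec p)) \<in> borel_measurable borel" for l
    using borel_measurable_continuous_onI[OF cont'[of l]] by measurable
  \<comment> \<open>The pairing is needed on a disc strictly larger than the unit disc. At radius
    \<open>r\<close> the two factors have exponents 1/2 and
    \<open>\<kappa> * \<theta>\<^sup>2\<close>, whose sum \<kappa>' is still below 1.\<close>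
  define r where "r = sqrt (1 / (2 * \<kappa>))"
  have r: "r > 1" "\<kappa> * r\<^sup>2 = 1 / 2" using \<kappa> by (auto simp: r_def field_simps)
  have gl: "norm (H (l *s z)) \<le> c * exp (\<kappa> * R\<^sup>2 * (norm z)\<^sup>2)" if "norm l \<le> R" for l z R
  proof -
    have "(norm l)\<^sup>2 \<le> R\<^sup>2" using that by (intro power_mono) auto
    then have "\<kappa> * (norm (l *s z))\<^sup>2 \<le> \<kappa> * R\<^sup>2 * (norm z)\<^sup>2"
      using \<kappa> by (simp add: norm_scale_vec power_mult_distrib mult.assoc mult_right_mono)
    then show ?thesis
      using growth[of "l *s z"] c0 by (meson exp_le_cancel_iff mult_left_mono order_trans)
  qed
  define f where "f l p = H (l *s cvec p) * cnj (H (of_real \<theta> *s cvec p)) * of_real (exp (- (norm p)\<^sup>2))" for l p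
  define \<Lambda> where "\<Lambda> l = (LBINT p. f l p)" for l
  define \<kappa>' where "\<kappa>' = 1 / 2 + \<kappa> * \<theta>\<^sup>2"
  have \<kappa>': "\<kappa>' < 1"
  proof -
    have "\<theta>\<^sup>2 < 1" using \<theta> by (simp add: power_less_one_iff)
    then have "\<kappa> * \<theta>\<^sup>2 < \<kappa> * 1" using \<kappa> by (intro mult_strict_left_mono) auto
    then show ?thesis using \<kappa> unfolding \<kappa>'_def by linarith
  qed
  have fb: "norm (f l p) \<le> c\<^sup>2 * exp (\<kappa>' * (norm p)\<^sup>2) * exp (- (norm p)\<^sup>2)" if "norm l \<le> r" for l p
  proof -
    have "norm (H (l *s cvec p)) * norm (H (of_real \<theta> *s cvec p))
        \<le> (c * exp (\<kappa> * r\<^sup>2 * (norm p)\<^sup>2)) * (c * exp (\<kappa> * \<theta>\<^sup>2 * (norm p)\<^sup>2))"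
      using gl[OF that, of "cvec p"] gl[of "of_real \<theta>" \<theta> "cvec p"] \<theta> c0
      by (intro mult_mono) auto
    also have "\<dots> = c\<^sup>2 * exp (\<kappa>' * (norm p)\<^sup>2)"
    proof -
      have "exp (\<kappa>' * (norm p)\<^sup>2) = exp (\<kappa> * r\<^sup>2 * (norm p)\<^sup>2) * exp (\<kappa> * \<theta>\<^sup>2 * (norm p)\<^sup>2)"
        unfolding \<kappa>'_def r(2) distrib_right exp_add ..
      then show ?thesis by (simp add: power2_eq_square[of c] mult_ac)
    qed
    finally show ?thesis
      by (simp add: f_def norm_mult mult_right_mono)
  qed
  have [measurable]: "f l \<in> borel_measurable borel" for l
    unfolding f_def by measurable
  have fi: "integrable lborel (f l)" if "norm l \<le> r" for l
    by (rule gaussian_growth_integrable[OF _ \<kappa>' fb[OF that]]) measurable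
  have dom: "integrable lborel (\<lambda>p::(real^'n) \<times> (real^'n). c\<^sup>2 * exp (\<kappa>' * (norm p)\<^sup>2) * exp (- (norm p)\<^sup>2))"
    by (rule gaussian_growth_integrable[OF _ \<kappa>', of _ "c\<^sup>2"]) auto
  have hol: "\<Lambda> holomorphic_on ball 0 r"
    unfolding \<Lambda>_def
  proof (rule holomorphic_on_integral)
    show "integrable lborel (f l)" if "l \<in> ball 0 r" for l
      using that by (intro fi) auto
    show "(\<lambda>l. f l p) holomorphic_on ball 0 r" for p
      unfolding f_def using entire_vec_line_holomorphic[OF H, of 0 "cvec p"]
      by (intro holomorphic_intros) auto
    show "\<exists>r'>0. \<exists>h. integrable lborel h \<and> (\<forall>l\<in>ball l0 r' \<inter> ball 0 r. \<forall>p\<in>space lborel. norm (f l p) \<le> h p)"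
      for l0
      using dom fb by (intro exI[of _ 1] conjI exI[of _ "\<lambda>p. c\<^sup>2 * exp (\<kappa>' * (norm p)\<^sup>2) * exp (- (norm p)\<^sup>2)"]) auto
  qed simp
  define E where "E = fock_real H"
  define E\<theta> where "E\<theta> = fock_real (\<lambda>z. H (of_real \<theta> *s z))"
  have gh\<theta>: "norm (H (of_real \<theta> *s z)) \<le> c * exp (\<kappa> * 1\<^sup>2 * (norm z)\<^sup>2)" for z
    using \<theta> by (intro gl) auto
  have iE\<theta>: "integrable lborel (\<lambda>p. (norm (H (of_real \<theta> *s cvec p)))\<^sup>2 * exp (- (norm p)\<^sup>2))"
    using fock_real(1)[OF cont' gh\<theta>] \<kappa> by simp
  have \<Lambda>b: "norm (\<Lambda> l) \<le> (\<theta> * E + E\<theta> / \<theta>) / 2" if l: "norm l = 1" for l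
  proof -
    have ghl: "norm (H (l *s z)) \<le> c * exp (\<kappa> * 1\<^sup>2 * (norm z)\<^sup>2)" for z
      using l by (intro gl) auto
    have iEl: "integrable lborel (\<lambda>p. (norm (H (l *s cvec p)))\<^sup>2 * exp (- (norm p)\<^sup>2))"
      using fock_real(1)[OF cont' ghl] \<kappa> by simp
    have "norm (\<Lambda> l) \<le> (LBINT p. norm (f l p))"
      unfolding \<Lambda>_def by (rule integral_norm_bound)
    also have "\<dots> \<le> (LBINT p. \<theta> / 2 * ((norm (H (l *s cvec p)))\<^sup>2 * exp (- (norm p)\<^sup>2))
        + 1 / (2 * \<theta>) * ((norm (H (of_real \<theta> *s cvec p)))\<^sup>2 * exp (- (norm p)\<^sup>2)))"
    proof (rule integral_mono')
      show "integrable lborel (\<lambda>p. \<theta> / 2 * ((norm (H (l *s cvec p)))\<^sup>2 * exp (- (norm p)\<^sup>2))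
        + 1 / (2 * \<theta>) * ((norm (H (of_real \<theta> *s cvec p)))\<^sup>2 * exp (- (norm p)\<^sup>2)))"
        using iEl iE\<theta> by (intro Bochner_Integration.integrable_add integrable_mult_right)
      fix p :: "(real^'n) \<times> (real^'n)"
      \<comment> \<open>The weight \<theta> is chosen so that, after the factor \<theta> gained by
        Schwarz's lemma, the bound becomes
        \<open>(\<theta>\<^sup>2 * E + E\<theta>) / 2\<close>.\<close>
      have "x * y \<le> \<theta> / 2 * x\<^sup>2 + 1 / (2 * \<theta>) * y\<^sup>2" for x y :: real
      proof -
        have "0 \<le> (\<theta> * x - y)\<^sup>2" by simp
        then show ?thesis using \<theta>(1) by (simp add: power2_diff power_mult_distrib field_simps power2_eq_square)
      qed
      from mult_right_mono[OF this[of "norm (H (l *s cvec p))" "norm (H (of_real \<theta> *s cvec p))"], of "exp (- (norm p)\<^sup>2)"]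
      show "norm (f l p) \<le> \<theta> / 2 * ((norm (H (l *s cvec p)))\<^sup>2 * exp (- (norm p)\<^sup>2))
        + 1 / (2 * \<theta>) * ((norm (H (of_real \<theta> *s cvec p)))\<^sup>2 * exp (- (norm p)\<^sup>2))"
        by (simp add: f_def norm_mult distrib_right mult.assoc)
    qed (use \<theta> in auto)
    also have "\<dots> = \<theta> / 2 * fock_real (\<lambda>z. H (l *s z)) + 1 / (2 * \<theta>) * E\<theta>"
      unfolding fock_real_def E\<theta>_def
      using iEl iE\<theta> by (simp only: Bochner_Integration.integral_add integrable_mult_right integral_mult_right_zero)
    also have "\<dots> = (\<theta> * E + E\<theta> / \<theta>) / 2"
      unfolding fock_real_rot[OF cont l] E_def by (simp add: field_simps)
    finally show ?thesis .
  qed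
  have "\<Lambda> 0 = 0" by (simp add: \<Lambda>_def f_def H0)
  then obtain h where h: "h holomorphic_on ball 0 r" "\<And>l. norm l < r \<Longrightarrow> \<Lambda> l = l * h l"
    using Schwarz3[OF hol] by metis
  have "norm (h (of_real \<theta>)) \<le> (\<theta> * E + E\<theta> / \<theta>) / 2"
  proof (rule maximum_modulus_frontier[of h "ball 0 1"])
    have sub: "cball 0 1 \<subseteq> ball (0::complex) r" using r by auto
    show "h holomorphic_on interior (ball 0 1)"
      using r by (auto intro!: holomorphic_on_subset[OF h(1)])
    show "continuous_on (closure (ball 0 1)) h"
      using h(1) sub by (auto intro: holomorphic_on_imp_continuous_on holomorphic_on_subset)
    show "norm (h l) \<le> (\<theta> * E + E\<theta> / \<theta>) / 2" if "l \<in> frontier (ball 0 1)" for l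
    proof -
      have l: "norm l = 1" using that by simp
      then have "norm (h l) = norm (\<Lambda> l)" using h(2)[of l] r by (simp add: norm_mult)
      then show ?thesis using \<Lambda>b[OF l] by simp
    qed
  qed (use \<theta> in auto)
  then have "norm (\<Lambda> (of_real \<theta>)) \<le> \<theta> * ((\<theta> * E + E\<theta> / \<theta>) / 2)"
    using h(2)[of "of_real \<theta>"] \<theta> r by (simp add: norm_mult mult_left_mono)
  also have "\<dots> = (\<theta>\<^sup>2 * E + E\<theta>) / 2" using \<theta> by (simp add: field_simps power2_eq_square)
  finally have "norm (\<Lambda> (of_real \<theta>)) \<le> (\<theta>\<^sup>2 * E + E\<theta>) / 2" .
  \<comment> \<open>At l = \<theta> the pairing is the energy of the dilated function itself, so
    half of it can be absorbed on the left.\<close>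
  moreover have "\<Lambda> (of_real \<theta>) = of_real E\<theta>"
  proof -
    have "f (of_real \<theta>) p = of_real ((norm (H (of_real \<theta> *s cvec p)))\<^sup>2 * exp (- (norm p)\<^sup>2))" for p
      unfolding f_def of_real_mult complex_norm_square ..
    then have "\<Lambda> (of_real \<theta>)
        = (LBINT p. of_real ((norm (H (of_real \<theta> *s cvec p)))\<^sup>2 * exp (- (norm p)\<^sup>2)))"
      unfolding \<Lambda>_def by (intro Bochner_Integration.integral_cong refl)
    then show ?thesis unfolding E\<theta>_def fock_real_def by (simp only: integral_complex_of_real)
  qed
  moreover have "E\<theta> \<ge> 0" unfolding E\<theta>_def using fock_real(3)[OF cont' gh\<theta>] \<kappa> by simp
  ultimately show ?thesis by (simp add: E_def E\<theta>_def)
qed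

text \<open>If \<open>A A\<^sup>* + B B\<^sup>* = 1\<close> then \<open>A x + B y\<close> is a standard Gaussian for independent standard
  Gaussians \<open>x, y\<close>. After substituting \<open>w = A x + B y\<close> for \<open>y\<close>, Pythagoras splits the exponent into
  \<open>|w|\<^sup>2\<close> and a function of \<open>x - A\<^sup>* w\<close>.\<close>

lemma gaussian_pushforward:
  fixes A B :: "'a::euclidean_space \<Rightarrow> 'a" and \<Psi> :: "'a \<Rightarrow> ennreal"
  assumes A: "linear A" and B: "linear B" "bij B"
    and adj: "\<And>x w. w \<bullet> A x = A' w \<bullet> x" "\<And>y w. w \<bullet> B y = B' w \<bullet> y"
    and unit: "\<And>w. A (A' w) + B (B' w) = w"
    and [measurable]: "\<Psi> \<in> borel_measurable borel"
  shows "(\<integral>\<^sup>+x. \<integral>\<^sup>+y. \<Psi> (A x + B y) * ennreal (exp (- (norm x)\<^sup>2 - (norm y)\<^sup>2)) \<partial>lborel \<partial>lborel)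
    = ennreal (pi powr (DIM('a) / 2)) * (\<integral>\<^sup>+w. \<Psi> w * ennreal (exp (- (norm w)\<^sup>2)) \<partial>lborel)"
proof -
  define C where "C = inv B"
  have BC: "B (C w) = w" for w using B(2) by (simp add: C_def bij_is_surj surj_f_inv_f)
  have CB: "C (B w) = w" for w using B(2) by (simp add: C_def bij_is_inj)
  have C: "linear C" "bij C"
  proof -
    show "linear C"
    proof (rule linearI)
      show "C (x + y) = C x + C y" for x y
        using CB[of "C x + C y"] by (simp add: linear_add[OF B(1)] BC)
      show "C (r *\<^sub>R x) = r *\<^sub>R C x" for r x
        using CB[of "r *\<^sub>R C x"] by (simp add: linear_scale[OF B(1)] BC)
    qed
    show "bij C" using B(2) by (simp add: C_def bij_imp_bij_inv)
  qed
  have meas[measurable]: "A \<in> borel_measurable borel" "B \<in> borel_measurable borel" "C \<in> borel_measurable borel"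
    using A B(1) C(1) by (auto intro!: borel_measurable_continuous_onI linear_continuous_on
        simp: linear_conv_bounded_linear[symmetric])
  obtain k where k: "\<And>F. F \<in> borel_measurable borel \<Longrightarrow> (\<integral>\<^sup>+x. F (C x) \<partial>lborel) = k * (\<integral>\<^sup>+x. F x \<partial>lborel)"
    using nn_integral_linear_scale[OF C] by blast
  obtain k' where k': "\<And>F. F \<in> borel_measurable borel \<Longrightarrow> (\<integral>\<^sup>+x. F (B x) \<partial>lborel) = k' * (\<integral>\<^sup>+x. F x \<partial>lborel)"
    using nn_integral_linear_scale[OF B] by blast
  define Z where "Z = (\<integral>\<^sup>+x. ennreal (exp (- (norm x)\<^sup>2 - (norm (C (A x)))\<^sup>2)) \<partial>lborel)"
  have pyth: "(norm x)\<^sup>2 + (norm (C (w - A x)))\<^sup>2 = (norm w)\<^sup>2 + ((norm (x - A' w))\<^sup>2 + (norm (C (A (x - A' w))))\<^sup>2)" for x w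
  proof -
    define y where "y = C (w - A x)"
    have w: "A x + B y = w" by (simp add: y_def BC)
    have "C (A (x - A' w)) = C (A x - A (A' w))" by (simp add: linear_diff[OF A])
    also have "A x - A (A' w) = B (B' w) - B y"
      using w unit[of w] by (simp add: algebra_simps)
    also have "C \<dots> = B' w - y" by (simp add: linear_diff[OF C(1)] CB)
    finally have e: "C (A (x - A' w)) = B' w - y" .
    have "w \<bullet> w = A' w \<bullet> x + B' w \<bullet> y" using w adj[of w] by (metis inner_add_right)
    moreover have "w \<bullet> w = A' w \<bullet> A' w + B' w \<bullet> B' w" using unit[of w] adj[of w] by (metis inner_add_right)
    ultimately show ?thesis
      unfolding e y_def[symmetric] power2_norm_eq_inner
      by (simp add: inner_diff_left inner_diff_right inner_commute algebra_simps)
  qed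
  \<comment> \<open>Stated for all \<Psi> because the constant \<open>k' * Z\<close> is found
    afterwards by taking \<Psi> = 1; no determinant has to be computed.\<close>
  have gen: "(\<integral>\<^sup>+x. \<integral>\<^sup>+y. \<Psi> (A x + B y) * ennreal (exp (- (norm x)\<^sup>2 - (norm y)\<^sup>2)) \<partial>lborel \<partial>lborel)
     = k' * Z * (\<integral>\<^sup>+w. \<Psi> w * ennreal (exp (- (norm w)\<^sup>2)) \<partial>lborel)"
    if [measurable]: "\<Psi> \<in> borel_measurable borel" for \<Psi>
  proof -
    have "(\<integral>\<^sup>+y. \<Psi> (A x + B y) * ennreal (exp (- (norm x)\<^sup>2 - (norm y)\<^sup>2)) \<partial>lborel)
      = k' * (\<integral>\<^sup>+w. \<Psi> w * ennreal (exp (- (norm x)\<^sup>2 - (norm (C (w - A x)))\<^sup>2)) \<partial>lborel)" for x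
    proof -
      have "(\<integral>\<^sup>+y. \<Psi> (A x + B y) * ennreal (exp (- (norm x)\<^sup>2 - (norm y)\<^sup>2)) \<partial>lborel)
         = (\<integral>\<^sup>+y. \<Psi> (A x + B y) * ennreal (exp (- (norm x)\<^sup>2 - (norm (C (B y)))\<^sup>2)) \<partial>lborel)"
        by (simp add: CB)
      also have "\<dots> = k' * (\<integral>\<^sup>+y. \<Psi> (A x + y) * ennreal (exp (- (norm x)\<^sup>2 - (norm (C y))\<^sup>2)) \<partial>lborel)"
        by (rule k') measurable
      also have "(\<integral>\<^sup>+y. \<Psi> (A x + y) * ennreal (exp (- (norm x)\<^sup>2 - (norm (C y))\<^sup>2)) \<partial>lborel)
         = (\<integral>\<^sup>+w. \<Psi> w * ennreal (exp (- (norm x)\<^sup>2 - (norm (C (w - A x)))\<^sup>2)) \<partial>lborel)"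
        using nn_integral_lborel_translate[of "\<lambda>w. \<Psi> w * ennreal (exp (- (norm x)\<^sup>2 - (norm (C (w - A x)))\<^sup>2))" "A x"]
        by simp
      finally show ?thesis .
    qed
    then have "(\<integral>\<^sup>+x. \<integral>\<^sup>+y. \<Psi> (A x + B y) * ennreal (exp (- (norm x)\<^sup>2 - (norm y)\<^sup>2)) \<partial>lborel \<partial>lborel)
      = k' * (\<integral>\<^sup>+x. \<integral>\<^sup>+w. \<Psi> w * ennreal (exp (- (norm x)\<^sup>2 - (norm (C (w - A x)))\<^sup>2)) \<partial>lborel \<partial>lborel)"
      by (simp add: nn_integral_cmult)
    also have "(\<integral>\<^sup>+x. \<integral>\<^sup>+w. \<Psi> w * ennreal (exp (- (norm x)\<^sup>2 - (norm (C (w - A x)))\<^sup>2)) \<partial>lborel \<partial>lborel)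
      = (\<integral>\<^sup>+w. \<integral>\<^sup>+x. \<Psi> w * ennreal (exp (- (norm x)\<^sup>2 - (norm (C (w - A x)))\<^sup>2)) \<partial>lborel \<partial>lborel)"
      by (rule lborel_pair.Fubini') measurable
    also have "\<dots> = (\<integral>\<^sup>+w. \<Psi> w * ennreal (exp (- (norm w)\<^sup>2)) * Z \<partial>lborel)"
    proof (rule nn_integral_cong)
      fix w
      have "(\<integral>\<^sup>+x. \<Psi> w * ennreal (exp (- (norm x)\<^sup>2 - (norm (C (w - A x)))\<^sup>2)) \<partial>lborel)
         = (\<integral>\<^sup>+x. (\<Psi> w * ennreal (exp (- (norm w)\<^sup>2))) * ennreal (exp (- (norm (x - A' w))\<^sup>2 - (norm (C (A (x - A' w))))\<^sup>2)) \<partial>lborel)"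
      proof (rule nn_integral_cong)
        fix x
        have "- (norm x)\<^sup>2 - (norm (C (w - A x)))\<^sup>2
          = - (norm w)\<^sup>2 + (- (norm (x - A' w))\<^sup>2 - (norm (C (A (x - A' w))))\<^sup>2)"
          using pyth[of x w] by linarith
        then show "\<Psi> w * ennreal (exp (- (norm x)\<^sup>2 - (norm (C (w - A x)))\<^sup>2))
          = (\<Psi> w * ennreal (exp (- (norm w)\<^sup>2))) * ennreal (exp (- (norm (x - A' w))\<^sup>2 - (norm (C (A (x - A' w))))\<^sup>2))"
          by (simp only: exp_add ennreal_mult'[OF exp_ge_zero] mult.assoc)
      qed
      also have "\<dots> = (\<Psi> w * ennreal (exp (- (norm w)\<^sup>2))) *
          (\<integral>\<^sup>+x. ennreal (exp (- (norm (x - A' w))\<^sup>2 - (norm (C (A (x - A' w))))\<^sup>2)) \<partial>lborel)"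
        by (rule nn_integral_cmult) measurable
      also have "(\<integral>\<^sup>+x. ennreal (exp (- (norm (x - A' w))\<^sup>2 - (norm (C (A (x - A' w))))\<^sup>2)) \<partial>lborel) = Z"
        unfolding Z_def
        using nn_integral_lborel_translate[of "\<lambda>x. ennreal (exp (- (norm x)\<^sup>2 - (norm (C (A x)))\<^sup>2))" "- A' w"]
        by simp
      finally show "(\<integral>\<^sup>+x. \<Psi> w * ennreal (exp (- (norm x)\<^sup>2 - (norm (C (w - A x)))\<^sup>2)) \<partial>lborel)
         = \<Psi> w * ennreal (exp (- (norm w)\<^sup>2)) * Z" .
    qed
    also have "\<dots> = (\<integral>\<^sup>+w. \<Psi> w * ennreal (exp (- (norm w)\<^sup>2)) \<partial>lborel) * Z"
      by (rule nn_integral_multc) measurable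
    finally show ?thesis by (simp add: mult_ac)
  qed
  have g: "(\<integral>\<^sup>+x. ennreal (exp (- (norm (x::'a))\<^sup>2)) \<partial>lborel) = ennreal (pi powr (DIM('a) / 2))" (is "_ = ?g")
    using integrable_gaussian[of 1 "0::'a"] by (subst nn_integral_eq_integral) auto
  have "(\<integral>\<^sup>+x. \<integral>\<^sup>+y. 1 * ennreal (exp (- (norm (x::'a))\<^sup>2 - (norm (y::'a))\<^sup>2)) \<partial>lborel \<partial>lborel)
    = (\<integral>\<^sup>+x. \<integral>\<^sup>+y. ennreal (exp (- (norm (x::'a))\<^sup>2)) * ennreal (exp (- (norm (y::'a))\<^sup>2)) \<partial>lborel \<partial>lborel)"
    by (simp add: ennreal_mult'[symmetric] exp_add[symmetric])
  also have "\<dots> = ?g * ?g"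
    by (simp add: nn_integral_cmult nn_integral_multc g)
  finally have "k' * Z * ?g = ?g * ?g"
    using gen[of "\<lambda>_. 1"] g by simp
  then have "?g * (k' * Z) = ?g * ?g" by (simp add: mult.commute)
  then have "k' * Z = ?g"
    by (subst (asm) ennreal_mult_cancel_left) auto
  then show ?thesis using gen[of \<Psi>] by simp
qed

text \<open>Mean value property: \<open>l \<mapsto> E K(w + l B \<zeta>)\<close> is holomorphic and, by rotation invariance, constant
  on the unit circle.\<close>

lemma gaussian_mean_value:
  fixes K :: "complex^'n \<Rightarrow> complex" and B :: "real^'n^'n"
  assumes K: "entire_vec K K'"
    and growth: "\<And>z. norm (K z) \<le> c * exp (\<kappa> * (norm z)\<^sup>2)" and \<kappa>: "0 < \<kappa>" "\<kappa> < 1 / 2"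
    and B: "\<And>x. norm (B *v x) \<le> norm x"
  shows "integrable lborel (\<lambda>p. K (w + cmat B (cvec p)) * of_real (exp (- (norm p)\<^sup>2)))"
    and "(LBINT p. K (w + cmat B (cvec p)) * of_real (exp (- (norm p)\<^sup>2))) = of_real (pi ^ CARD('n)) * K w"
proof -
  have cont: "continuous_on UNIV K" by (rule entire_vec_continuous[OF K])
  have c0: "c \<ge> 0" using growth by (rule growth_nonneg)
  have cB: "norm (cmat B z) \<le> norm z" for z using norm_cmat_le[of B 1] B by simp
  define f where "f l p = K (w + l *s cmat B (cvec p)) * of_real (exp (- (norm p)\<^sup>2))" for l p
  define \<Lambda> where "\<Lambda> l = (LBINT p. f l p)" for l
  \<comment> \<open>A radius slightly above 1. With r^2 = 5/4 and weight 1/4 in the square estimate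
    the exponent grows by (5/4)^2 = 25/16, and 25/16 times 1/2 is below 1.\<close>
  define r where "r = sqrt (5 / 4 :: real)"
  have r: "r > 1" "r\<^sup>2 = 5 / 4" by (auto simp: r_def)
  define c' where "c' = c * exp (\<kappa> * 5 * (norm w)\<^sup>2)"
  define \<kappa>' where "\<kappa>' = \<kappa> * (25 / 16)"
  have \<kappa>': "\<kappa>' < 1" using \<kappa> by (simp add: \<kappa>'_def)
  have fb: "norm (f l p) \<le> c' * exp (\<kappa>' * (norm p)\<^sup>2) * exp (- (norm p)\<^sup>2)" if "norm l \<le> r" for l p
  proof -
    have "norm (w + l *s cmat B (cvec p)) \<le> r * norm p + norm w"
      using mult_mono[OF that cB[of "cvec p"]] r
      by (intro order_trans[OF norm_triangle_ineq]) (simp add: norm_scale_vec)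
    then have "(norm (w + l *s cmat B (cvec p)))\<^sup>2 \<le> (r * norm p + norm w)\<^sup>2"
      by (intro power_mono) auto
    also have "\<dots> \<le> (1 + 1 / 4) * (r * norm p)\<^sup>2 + (1 + 1 / (1 / 4)) * (norm w)\<^sup>2"
      by (rule weighted_square_add) simp
    finally have "(norm (w + l *s cmat B (cvec p)))\<^sup>2 \<le> 25 / 16 * (norm p)\<^sup>2 + 5 * (norm w)\<^sup>2"
      by (simp add: power_mult_distrib r(2))
    from mult_left_mono[OF this, of \<kappa>]
    have "\<kappa> * (norm (w + l *s cmat B (cvec p)))\<^sup>2 \<le> \<kappa>' * (norm p)\<^sup>2 + \<kappa> * 5 * (norm w)\<^sup>2"
      using \<kappa>(1) by (simp add: \<kappa>'_def distrib_left mult.assoc)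
    then have "c * exp (\<kappa> * (norm (w + l *s cmat B (cvec p)))\<^sup>2) \<le> c * exp (\<kappa>' * (norm p)\<^sup>2 + \<kappa> * 5 * (norm w)\<^sup>2)"
      using c0 by (intro mult_left_mono) auto
    then have "norm (K (w + l *s cmat B (cvec p))) \<le> c' * exp (\<kappa>' * (norm p)\<^sup>2)"
      using growth[of "w + l *s cmat B (cvec p)"] by (simp add: c'_def exp_add mult_ac)
    then show ?thesis by (simp add: f_def norm_mult mult_right_mono)
  qed
  have contf: "continuous_on UNIV (\<lambda>p. K (w + l *s cmat B (cvec p)))" for l
    by (rule continuous_on_compose2[OF cont])
      (auto intro!: continuous_intros linear_continuous_on[OF bounded_linear_scale_vec2, THEN continuous_on_compose2]
        linear_continuous_on[OF bounded_linear_cmat, THEN continuous_on_compose2])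
  have [measurable]: "f l \<in> borel_measurable borel" for l
    using borel_measurable_continuous_onI[OF contf[of l]] unfolding f_def by measurable
  have fi: "integrable lborel (f l)" if "norm l \<le> r" for l
    by (rule gaussian_growth_integrable[OF _ \<kappa>' fb[OF that]]) measurable
  have f1: "f 1 p = K (w + cmat B (cvec p)) * of_real (exp (- (norm p)\<^sup>2))" for p
    by (simp add: f_def)
  show "integrable lborel (\<lambda>p. K (w + cmat B (cvec p)) * of_real (exp (- (norm p)\<^sup>2)))"
    using fi[of 1] r unfolding f1[symmetric] by simp
  have dom: "integrable lborel (\<lambda>p::(real^'n) \<times> (real^'n). c' * exp (\<kappa>' * (norm p)\<^sup>2) * exp (- (norm p)\<^sup>2))"
    using c0 by (intro gaussian_growth_integrable[OF _ \<kappa>', of _ c']) (auto simp: c'_def)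
  have hol: "\<Lambda> holomorphic_on ball 0 r"
    unfolding \<Lambda>_def
  proof (rule holomorphic_on_integral)
    show "integrable lborel (f l)" if "l \<in> ball 0 r" for l
      using that by (intro fi) auto
    show "(\<lambda>l. f l p) holomorphic_on ball 0 r" for p
      unfolding f_def using entire_vec_line_holomorphic[OF K, of w "cmat B (cvec p)"]
      by (intro holomorphic_intros) auto
    show "\<exists>r'>0. \<exists>h. integrable lborel h \<and> (\<forall>l\<in>ball l0 r' \<inter> ball 0 r. \<forall>p\<in>space lborel. norm (f l p) \<le> h p)"
      for l0
      using dom fb by (intro exI[of _ 1] conjI exI[of _ "\<lambda>p. c' * exp (\<kappa>' * (norm p)\<^sup>2) * exp (- (norm p)\<^sup>2)"]) auto
  qed simp
  have circle: "\<Lambda> l = \<Lambda> 1" if "norm l = 1" for l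
  proof -
    have "f l = (\<lambda>p. f 1 (rot l p))"
      using that by (intro ext) (simp add: f_def cvec_rot norm_rot cmat_scale)
    then show ?thesis
      unfolding \<Lambda>_def using integral_rot[OF that, of "f 1"] by simp
  qed
  have sub: "cball 0 1 \<subseteq> ball (0::complex) r" using r by auto
  have "norm (\<Lambda> 0 - \<Lambda> 1) \<le> 0"
  proof (rule maximum_modulus_frontier[of "\<lambda>l. \<Lambda> l - \<Lambda> 1" "ball 0 1"])
    show "(\<lambda>l. \<Lambda> l - \<Lambda> 1) holomorphic_on interior (ball 0 1)"
      using r by (auto intro!: holomorphic_intros holomorphic_on_subset[OF hol])
    have "continuous_on (cball 0 1) \<Lambda>"
      by (rule holomorphic_on_imp_continuous_on[OF holomorphic_on_subset[OF hol sub]])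
    then show "continuous_on (closure (ball 0 1)) (\<lambda>l. \<Lambda> l - \<Lambda> 1)"
      by (auto intro!: continuous_intros)
    show "norm (\<Lambda> l - \<Lambda> 1) \<le> 0" if "l \<in> frontier (ball 0 1)" for l
      using that circle[of l] by simp
  qed auto
  then have "\<Lambda> 1 = \<Lambda> 0" by simp
  also have "\<Lambda> 0 = K w * of_real (LBINT p::(real^'n) \<times> (real^'n). exp (- (norm p)\<^sup>2))"
    unfolding \<Lambda>_def f_def by (simp add: integral_mult_right_zero flip: integral_complex_of_real)
  also have "(LBINT p::(real^'n) \<times> (real^'n). exp (- (norm p)\<^sup>2)) = pi ^ CARD('n)"
    using integrable_gaussian(2)[of 1 "0::(real^'n) \<times> (real^'n)"] by (simp add: powr_realpow)
  finally show "(LBINT p. K (w + cmat B (cvec p)) * of_real (exp (- (norm p)\<^sup>2))) = of_real (pi ^ CARD('n)) * K w"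
    unfolding \<Lambda>_def f1 by (simp add: mult.commute)
qed

lemma norm_transpose_le:
  fixes A :: "real^'n^'n"
  assumes "\<And>x. norm (A *v x) \<le> \<theta> * norm x"
  shows "norm (transpose A *v x) \<le> \<theta> * norm x"
proof (cases "norm (transpose A *v x) = 0")
  case True
  have "0 \<le> \<theta> * norm x" using assms[of x] order_trans norm_ge_zero by blast
  then show ?thesis using True by simp
next
  case False
  have "(norm (transpose A *v x))\<^sup>2 = x \<bullet> (A *v (transpose A *v x))"
    unfolding power2_norm_eq_inner by (simp only: inner_matrix_transpose)
  also have "\<dots> \<le> norm x * norm (A *v (transpose A *v x))" by (rule norm_cauchy_schwarz)
  also have "\<dots> \<le> norm x * (\<theta> * norm (transpose A *v x))" by (intro mult_left_mono assms) simp
  finally show ?thesis using False by (simp add: power2_eq_square mult_ac)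
qed

text \<open>This defect matrix is used twice: for the flow it is the covariance of the transition
  kernel, and in the Fock space estimate it is the covariance of the noise that completes
  \<open>A\<close> to a standard Gaussian.\<close>

lemma contraction_posdef:
  fixes A :: "real^'n^'n"
  assumes A: "\<And>x. norm (A *v x) \<le> \<theta> * norm x" and \<theta>: "\<theta> < 1"
  shows "x \<bullet> ((mat 1 - A ** transpose A) *v x) = (norm x)\<^sup>2 - (norm (transpose A *v x))\<^sup>2"
    and "positive_definite (mat 1 - A ** transpose A)"
proof -
  define M :: "real^'n^'n" where "M = mat 1 - A ** transpose A"
  have M: "x \<bullet> (M *v x) = (norm x)\<^sup>2 - (norm (transpose A *v x))\<^sup>2" for x
    by (simp add: M_def matrix_vector_mult_diff_rdistrib inner_diff_right power2_norm_eq_inner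
        inner_matrix_transpose[of x A] flip: matrix_vector_mul_assoc)
  then show "x \<bullet> ((mat 1 - A ** transpose A) *v x) = (norm x)\<^sup>2 - (norm (transpose A *v x))\<^sup>2"
    by (simp only: M_def)
  have "positive_definite M"
    unfolding positive_definite_def
  proof (intro conjI allI impI)
    show "transpose M = M"
      by (simp add: M_def transpose_def matrix_matrix_mult_def vec_eq_iff mat_def mult.commute)
    fix x :: "real^'n"
    assume "x \<noteq> 0"
    have "norm (transpose A *v x) \<le> \<theta> * norm x" using A by (rule norm_transpose_le)
    also have "\<dots> < norm x" using \<theta> \<open>x \<noteq> 0\<close> by simp
    finally show "x \<bullet> (M *v x) > 0"
      unfolding M by (simp add: power_strict_mono)
  qed
  then show "positive_definite (mat 1 - A ** transpose A)" by (simp only: M_def)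
qed

text \<open>Take B with A A^T + B B^T = 1. By the mean value property K(A w) is the Gaussian average
  over \<zeta> of K(A w + B \<zeta>), and Jensen bounds its squared modulus by the average of the
  squares. Integrating over \<open>w\<close> as well, A w + B \<zeta> is again standard Gaussian,
  which leaves the energy of \<open>K\<close>.\<close>

lemma fock_contraction:
  fixes K :: "complex^'n \<Rightarrow> complex" and A :: "real^'n^'n"
  assumes K: "entire_vec K K'"
    and growth: "\<And>z. norm (K z) \<le> c * exp (\<kappa> * (norm z)\<^sup>2)" and \<kappa>: "0 < \<kappa>" "\<kappa> < 1 / 2"
    and A: "\<And>x. norm (A *v x) \<le> \<theta> * norm x" and \<theta>: "0 < \<theta>" "\<theta> < 1"
  shows "fock_energy (\<lambda>z. K (cmat A z)) \<le> fock_energy K"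
proof -
  have cont: "continuous_on UNIV K" by (rule entire_vec_continuous[OF K])
  have [measurable]: "K \<in> borel_measurable borel"
    using cont by (rule borel_measurable_continuous_onI)
  define M :: "real^'n^'n" where "M = mat 1 - A ** transpose A"
  note M = contraction_posdef(1)[OF A \<theta>(2), folded M_def]
  have "positive_definite M" unfolding M_def by (rule contraction_posdef(2)[OF A \<theta>(2)])
  then obtain Q :: "real^'n^'n" where Q: "invertible Q" "M = transpose Q ** Q"
    by (rule posdef_factorization)
  define B where "B = transpose Q"
  have BB: "A ** transpose A + B ** transpose B = mat 1"
    using Q(2) by (simp add: M_def B_def algebra_simps)
  have tB: "norm (transpose B *v x) \<le> 1 * norm x" for x
  proof -
    have "(norm (transpose B *v x))\<^sup>2 = x \<bullet> (M *v x)"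
      by (simp only: Q(2) B_def power2_norm_eq_inner inner_matrix_transpose[of x "transpose Q"]
          matrix_vector_mul_assoc[symmetric] transpose_transpose)
    also have "\<dots> \<le> (norm x)\<^sup>2" unfolding M by simp
    finally show ?thesis by (simp add: power2_le_iff_abs_le)
  qed
  have nB: "norm (B *v x) \<le> norm x" for x
    using norm_transpose_le[of "transpose B" 1 x] tB by simp
  let ?A = "\<lambda>p. (A *v fst p, A *v snd p)" and ?B = "\<lambda>p. (B *v fst p, B *v snd p)"
  let ?A' = "\<lambda>p. (transpose A *v fst p, transpose A *v snd p)"
  let ?B' = "\<lambda>p. (transpose B *v fst p, transpose B *v snd p)"
  have iB: "invertible B" using Q(1) by (simp add: B_def invertible_det_nz)
  have linA: "linear ?A" "linear ?B"
    by (auto intro!: linearI simp: matrix_vector_right_distrib matrix_vector_mult_scaleR prod_eq_iff)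
  have bijB: "bij ?B"
    by (rule bij_betw_byWitness[of _ "\<lambda>p. (matrix_inv B *v fst p, matrix_inv B *v snd p)"])
      (auto simp: matrix_vector_mul_assoc matrix_inv_left[OF iB] matrix_inv_right[OF iB])
  define d where "d = pi ^ CARD('n)"
  have d: "d > 0" by (simp add: d_def)
  \<comment> \<open>Makes \<open>\<kappa> * (1 + e)\<close> the midpoint of \<kappa> and 1/2, so
    that the functions shifted by \<open>w\<close> in \<open>J\<close> remain below the
    threshold.\<close>
  define e where "e = (1 / (2 * \<kappa>) - 1) / 2"
  have e: "e > 0" "\<kappa> * (1 + e) < 1 / 2" using \<kappa> by (auto simp: e_def field_simps)
  have c0: "c \<ge> 0" using growth by (rule growth_nonneg)
  have cB: "norm (cmat B z) \<le> norm z" for z using norm_cmat_le[of B 1] nB by simp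
  \<comment> \<open>Jensen's inequality by hand: the mean value formula is multiplied by
    \<open>norm (K w)\<close>, and x y <= (x^2 + y^2) / 2 returns half of the left side.\<close>
  have J: "d * (norm (K w))\<^sup>2 \<le> (LBINT p. (norm (K (w + cmat B (cvec p))))\<^sup>2 * exp (- (norm p)\<^sup>2))"
    and Ji: "integrable lborel (\<lambda>p. (norm (K (w + cmat B (cvec p))))\<^sup>2 * exp (- (norm p)\<^sup>2))" for w
  proof -
    have contw: "continuous_on UNIV (\<lambda>z. K (w + cmat B z))"
      by (rule continuous_on_compose2[OF cont])
        (auto intro!: continuous_intros linear_continuous_on[OF bounded_linear_cmat])
    have gw: "norm (K (w + cmat B z)) \<le> (c * exp (\<kappa> * (1 + 1 / e) * (norm w)\<^sup>2)) * exp (\<kappa> * (1 + e) * (norm z)\<^sup>2)" for z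
    proof -
      have "norm (w + cmat B z) \<le> norm z + norm w"
        using norm_triangle_ineq[of w "cmat B z"] cB[of z] by simp
      then have "(norm (w + cmat B z))\<^sup>2 \<le> (norm z + norm w)\<^sup>2" by (intro power_mono) auto
      also have "\<dots> \<le> (1 + e) * (norm z)\<^sup>2 + (1 + 1 / e) * (norm w)\<^sup>2"
        by (rule weighted_square_add[OF e(1)])
      finally have "\<kappa> * (norm (w + cmat B z))\<^sup>2 \<le> \<kappa> * ((1 + e) * (norm z)\<^sup>2 + (1 + 1 / e) * (norm w)\<^sup>2)"
        using \<kappa>(1) by (intro mult_left_mono) auto
      then have "c * exp (\<kappa> * (norm (w + cmat B z))\<^sup>2) \<le> c * exp (\<kappa> * ((1 + e) * (norm z)\<^sup>2 + (1 + 1 / e) * (norm w)\<^sup>2))"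
        using c0 by (intro mult_left_mono) auto
      then show ?thesis
      proof -
        have "\<kappa> * ((1 + e) * (norm z)\<^sup>2 + (1 + 1 / e) * (norm w)\<^sup>2)
          = \<kappa> * (1 + 1 / e) * (norm w)\<^sup>2 + \<kappa> * (1 + e) * (norm z)\<^sup>2"
          by (simp add: algebra_simps)
        then have "c * exp (\<kappa> * ((1 + e) * (norm z)\<^sup>2 + (1 + 1 / e) * (norm w)\<^sup>2))
          = (c * exp (\<kappa> * (1 + 1 / e) * (norm w)\<^sup>2)) * exp (\<kappa> * (1 + e) * (norm z)\<^sup>2)"
          by (simp only: exp_add mult.assoc)
        then show ?thesis
          using growth[of "w + cmat B z"] \<open>c * exp _ \<le> c * exp _\<close> by linarith
      qed
    qed
    show Ji: "integrable lborel (\<lambda>p. (norm (K (w + cmat B (cvec p))))\<^sup>2 * exp (- (norm p)\<^sup>2))"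
      using fock_real(1)[OF contw gw e(2)] .
    let ?E = "LBINT p. (norm (K (w + cmat B (cvec p))))\<^sup>2 * exp (- (norm p)\<^sup>2)"
    have g: "integrable lborel (\<lambda>p::(real^'n) \<times> (real^'n). exp (- (norm p)\<^sup>2))"
      "(LBINT p::(real^'n) \<times> (real^'n). exp (- (norm p)\<^sup>2)) = d"
      using integrable_gaussian[of 1 "0::(real^'n) \<times> (real^'n)"] by (simp_all add: powr_realpow d_def)
    have "d * norm (K w) = norm (LBINT p. K (w + cmat B (cvec p)) * of_real (exp (- (norm p)\<^sup>2)))"
      unfolding gaussian_mean_value(2)[OF K growth \<kappa> nB] d_def[symmetric] norm_mult norm_of_real
      using d by simp
    also have "\<dots> \<le> (LBINT p. norm (K (w + cmat B (cvec p)) * of_real (exp (- (norm p)\<^sup>2))))"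
      by (rule integral_norm_bound)
    finally have "norm (K w) * (d * norm (K w))
      \<le> norm (K w) * (LBINT p. norm (K (w + cmat B (cvec p)) * of_real (exp (- (norm p)\<^sup>2))))"
      by (rule mult_left_mono) simp
    also have "\<dots> = (LBINT p. norm (K w) * norm (K (w + cmat B (cvec p)) * of_real (exp (- (norm p)\<^sup>2))))"
      by (rule integral_mult_right_zero[symmetric])
    also have "\<dots> \<le> (LBINT p. 1 / 2 * ((norm (K (w + cmat B (cvec p))))\<^sup>2 * exp (- (norm p)\<^sup>2))
        + (norm (K w))\<^sup>2 / 2 * exp (- (norm p)\<^sup>2))"
    proof (rule integral_mono')
      show "integrable lborel (\<lambda>p. 1 / 2 * ((norm (K (w + cmat B (cvec p))))\<^sup>2 * exp (- (norm p)\<^sup>2))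
        + (norm (K w))\<^sup>2 / 2 * exp (- (norm p)\<^sup>2))"
        using Ji g(1) by (intro Bochner_Integration.integrable_add integrable_mult_right)
      fix p :: "(real^'n) \<times> (real^'n)"
      have "x * y \<le> 1 / 2 * y\<^sup>2 + x\<^sup>2 / 2" for x y :: real
        using sum_squares_bound[of x y] by (simp add: mult_ac)
      from mult_right_mono[OF this[of "norm (K w)" "norm (K (w + cmat B (cvec p)))"], of "exp (- (norm p)\<^sup>2)"]
      show "norm (K w) * norm (K (w + cmat B (cvec p)) * of_real (exp (- (norm p)\<^sup>2)))
        \<le> 1 / 2 * ((norm (K (w + cmat B (cvec p))))\<^sup>2 * exp (- (norm p)\<^sup>2)) + (norm (K w))\<^sup>2 / 2 * exp (- (norm p)\<^sup>2)"
        by (simp add: norm_mult distrib_right mult.assoc)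
    qed simp
    also have "\<dots> = 1 / 2 * ?E + (norm (K w))\<^sup>2 / 2 * d"
      using Ji g by (simp only: Bochner_Integration.integral_add integrable_mult_right integral_mult_right_zero)
    finally show "d * (norm (K w))\<^sup>2 \<le> ?E" by (simp add: power2_eq_square algebra_simps)
  qed
  have cB': "cmat A (cvec p) + cmat B (cvec q) = cvec (?A p + ?B q)" for p q :: "(real^'n) \<times> (real^'n)"
    by (simp add: cmat_cvec flip: cvec_add)
  have "ennreal d * fock_energy (\<lambda>z. K (cmat A z))
    = (\<integral>\<^sup>+p. ennreal (d * (norm (K (cmat A (cvec p))))\<^sup>2) * ennreal (exp (- (norm p)\<^sup>2)) \<partial>lborel)"
  proof -
    have [measurable]: "(\<lambda>p. cmat A (cvec p)) \<in> borel_measurable borel"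
      by (intro borel_measurable_continuous_onI linear_continuous_on[OF bounded_linear_cmat, THEN continuous_on_compose2])
        (auto intro!: continuous_intros)
    show ?thesis
      unfolding fock_energy_def using d
      by (subst nn_integral_cmult[symmetric], measurable)
        (simp add: ennreal_mult[symmetric] mult.assoc)
  qed
  also have "\<dots> \<le> (\<integral>\<^sup>+p. (\<integral>\<^sup>+q. ennreal ((norm (K (cvec (?A p + ?B q))))\<^sup>2)
      * ennreal (exp (- (norm p)\<^sup>2 - (norm q)\<^sup>2)) \<partial>lborel) \<partial>lborel)"
  proof (rule nn_integral_mono)
    fix p :: "(real^'n) \<times> (real^'n)"
    have "ennreal (d * (norm (K (cmat A (cvec p))))\<^sup>2)
      \<le> ennreal (LBINT q. (norm (K (cmat A (cvec p) + cmat B (cvec q))))\<^sup>2 * exp (- (norm q)\<^sup>2))"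
      by (rule ennreal_leI[OF J])
    also have "\<dots> = (\<integral>\<^sup>+q. ennreal ((norm (K (cmat A (cvec p) + cmat B (cvec q))))\<^sup>2 * exp (- (norm q)\<^sup>2)) \<partial>lborel)"
      by (rule nn_integral_eq_integral[OF Ji, symmetric]) simp
    finally have "ennreal (d * (norm (K (cmat A (cvec p))))\<^sup>2) * ennreal (exp (- (norm p)\<^sup>2))
      \<le> (\<integral>\<^sup>+q. ennreal ((norm (K (cmat A (cvec p) + cmat B (cvec q))))\<^sup>2 * exp (- (norm q)\<^sup>2)) \<partial>lborel)
        * ennreal (exp (- (norm p)\<^sup>2))"
      by (rule mult_right_mono) simp
    also have "\<dots> = (\<integral>\<^sup>+q. ennreal ((norm (K (cmat A (cvec p) + cmat B (cvec q))))\<^sup>2 * exp (- (norm q)\<^sup>2))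
        * ennreal (exp (- (norm p)\<^sup>2)) \<partial>lborel)"
      using borel_measurable_integrable[OF Ji] by (intro nn_integral_multc[symmetric]) simp
    also have "\<dots> = (\<integral>\<^sup>+q. ennreal ((norm (K (cvec (?A p + ?B q))))\<^sup>2)
      * ennreal (exp (- (norm p)\<^sup>2 - (norm q)\<^sup>2)) \<partial>lborel)"
      unfolding cB'
      by (intro nn_integral_cong) (simp add: ennreal_mult[symmetric] mult.assoc exp_add[symmetric])
    finally show "ennreal (d * (norm (K (cmat A (cvec p))))\<^sup>2) * ennreal (exp (- (norm p)\<^sup>2)) \<le> \<dots>" .
  qed
  also have "\<dots> = ennreal (pi powr (DIM((real^'n) \<times> (real^'n)) / 2)) *
      (\<integral>\<^sup>+w. ennreal ((norm (K (cvec w)))\<^sup>2) * ennreal (exp (- (norm w)\<^sup>2)) \<partial>lborel)"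
  proof (rule gaussian_pushforward[where A' = ?A' and B' = ?B'])
    show "w \<bullet> ?A x = ?A' w \<bullet> x" for w x :: "(real^'n) \<times> (real^'n)"
      by (simp only: inner_prod_def inner_matrix_transpose[of _ A] fst_conv snd_conv)
    show "w \<bullet> ?B x = ?B' w \<bullet> x" for w x :: "(real^'n) \<times> (real^'n)"
      by (simp only: inner_prod_def inner_matrix_transpose[of _ B] fst_conv snd_conv)
    have "A *v (transpose A *v x) + B *v (transpose B *v x) = x" for x
      using arg_cong[OF BB, of "\<lambda>M. M *v x"]
      by (simp only: matrix_vector_mult_add_rdistrib matrix_vector_mul_assoc matrix_vector_mul_lid)
    then show "?A (?A' w) + ?B (?B' w) = w" for w :: "(real^'n) \<times> (real^'n)"
      by (simp only: prod_eq_iff fst_add snd_add fst_conv snd_conv)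
  qed (use linA bijB in \<open>simp_all\<close>)
  also have "\<dots> = ennreal d * fock_energy K"
    by (simp add: d_def powr_realpow fock_energy_def ennreal_mult)
  finally show ?thesis
    using d by (simp add: ennreal_mult_le_mult_iff)
qed

text \<open>For \<theta> < s < 1 the matrix is split as s times A / s. The scalar contributes s^2 by
  \<open>fock_dilation\<close>; A / s has norm at most \<theta> / s, strictly below 1 as
  \<open>fock_contraction\<close> demands. Letting s decrease to \<theta> gives the sharp
  factor.\<close>

theorem fock_decay:
  fixes G :: "complex^'n \<Rightarrow> complex" and A :: "real^'n^'n"
  assumes G: "entire_vec G G'" and G0: "G 0 = 0"
    and growth: "\<And>z. norm (G z) \<le> c * exp (\<kappa> * (norm z)\<^sup>2)" and \<kappa>: "0 < \<kappa>" "\<kappa> < 1 / 2"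
    and A: "\<And>x. norm (A *v x) \<le> \<theta> * norm x" and \<theta>: "0 < \<theta>" "\<theta> < 1"
  shows "fock_real (\<lambda>z. G (cmat A z)) \<le> \<theta>\<^sup>2 * fock_real G"
proof -
  have cont: "continuous_on UNIV G" by (rule entire_vec_continuous[OF G])
  have c0: "c \<ge> 0" using growth by (rule growth_nonneg)
  have nA: "norm (cmat A z) \<le> \<theta> * norm z" for z by (rule norm_cmat_le[OF A])
  have gmono: "norm (G y) \<le> c * exp (\<kappa> * (norm z)\<^sup>2)" if "norm y \<le> norm z" for y z
  proof -
    have "(norm y)\<^sup>2 \<le> (norm z)\<^sup>2" using that by (intro power_mono) auto
    then have "c * exp (\<kappa> * (norm y)\<^sup>2) \<le> c * exp (\<kappa> * (norm z)\<^sup>2)"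
      using c0 \<kappa> by (intro mult_left_mono) auto
    then show ?thesis using growth[of y] by linarith
  qed
  have bound: "fock_real (\<lambda>z. G (cmat A z)) \<le> s\<^sup>2 * fock_real G" if s: "\<theta> < s" "s < 1" for s
  proof -
    have s0: "0 < s" using s \<theta> by simp
    define K where "K z = G (of_real s *s z)" for z
    have e: "of_real s *s z = cmat (s *\<^sub>R mat 1) z" for z :: "complex^'n"
    proof -
      have "cmat (s *\<^sub>R mat 1) z = of_real s *s cmat (mat 1) z"
        by (simp add: cmat_def vec_eq_iff sum_distrib_left mult.assoc)
      then show ?thesis by simp
    qed
    have K: "entire_vec K (\<lambda>z. cmat (transpose (s *\<^sub>R mat 1)) (G' (cmat (s *\<^sub>R mat 1) z)))"
      unfolding K_def e by (rule entire_vec_cmat[OF G])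
    have gK: "norm (K z) \<le> c * exp (\<kappa> * (norm z)\<^sup>2)" for z
      unfolding K_def using s s0 by (intro gmono) (simp add: norm_scale_vec mult_left_le_one_le)
    define A1 where "A1 = (1 / s) *\<^sub>R A"
    have GA: "G (cmat A z) = K (cmat A1 z)" for z
    proof -
      have "cmat A1 z = of_real (1 / s) *s cmat A z"
        by (simp add: A1_def cmat_def vec_eq_iff sum_distrib_left mult.assoc)
      then show ?thesis using s0 by (simp add: K_def vector_smult_assoc)
    qed
    have nA1: "norm (A1 *v x) \<le> (\<theta> / s) * norm x" for x
      using A[of x] s0 by (simp add: A1_def scaleR_matrix_vector_assoc[symmetric] divide_right_mono)
    have "ennreal (fock_real (\<lambda>z. G (cmat A z))) = fock_energy (\<lambda>z. K (cmat A1 z))"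
    proof -
      have "continuous_on UNIV (\<lambda>z. G (cmat A z))"
        by (rule entire_vec_continuous[OF entire_vec_cmat[OF G]])
      moreover have "norm (G (cmat A z)) \<le> c * exp (\<kappa> * (norm z)\<^sup>2)" for z
        using nA[of z] \<theta> mult_right_mono[of \<theta> 1 "norm z"] by (intro gmono) simp
      ultimately show ?thesis
        using fock_real(2)[of "\<lambda>z. G (cmat A z)" c \<kappa>] \<kappa> by (simp add: GA)
    qed
    also have "\<dots> \<le> fock_energy K"
      by (rule fock_contraction[OF K gK \<kappa> nA1]) (use \<theta> s s0 in auto)
    also have "\<dots> = ennreal (fock_real K)"
      by (rule fock_real(2)[OF entire_vec_continuous[OF K] gK \<kappa>(2)])
    finally have "fock_real (\<lambda>z. G (cmat A z)) \<le> fock_real K"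
      using fock_real(3)[OF entire_vec_continuous[OF K] gK \<kappa>(2)] by (simp add: ennreal_le_iff)
    also have "\<dots> \<le> s\<^sup>2 * fock_real G"
      unfolding K_def by (rule fock_dilation[OF G G0 growth \<kappa> s0 s(2)])
    finally show ?thesis .
  qed
  show ?thesis
  proof (rule tendsto_lowerbound)
    show "((\<lambda>s. s\<^sup>2 * fock_real G) \<longlongrightarrow> \<theta>\<^sup>2 * fock_real G) (at_right \<theta>)"
      by (intro tendsto_intros)
    show "\<forall>\<^sub>F s in at_right \<theta>. fock_real (\<lambda>z. G (cmat A z)) \<le> s\<^sup>2 * fock_real G"
      using eventually_at_right_real[OF \<theta>(2)] by eventually_elim (use bound in auto)
  qed simp
qed

section \<open>The matrix exponential and the covariance\<close>

abbreviation matrix_pow :: "real^'n^'n \<Rightarrow> nat \<Rightarrow> real^'n^'n" where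
  "matrix_pow A k \<equiv> ((**) A ^^ k) (mat 1)"

lemma bounded_bilinear_matrix_mul: "bounded_bilinear ((**) :: real^'n^'n \<Rightarrow> real^'n^'n \<Rightarrow> real^'n^'n)"
  unfolding bilinear_conv_bounded_bilinear[symmetric] bilinear_def
  by (auto intro!: linearI simp: vec_eq_iff matrix_matrix_mult_def sum.distrib sum_distrib_left algebra_simps)

interpretation matmul: bounded_bilinear "(**) :: real^'n^'n \<Rightarrow> real^'n^'n \<Rightarrow> real^'n^'n"
  by (rule bounded_bilinear_matrix_mul)

lemma bounded_linear_transpose: "bounded_linear (transpose :: real^'n^'n \<Rightarrow> real^'n^'n)"
  unfolding linear_conv_bounded_linear[symmetric]
  by (rule linearI) (simp_all add: vec_eq_iff transpose_def)

lemma transpose_scaleR: "transpose (r *\<^sub>R (M :: real^'n^'n)) = r *\<^sub>R transpose M"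
  and transpose_minus: "transpose (- (M :: real^'n^'n)) = - transpose M"
  by (simp_all add: vec_eq_iff transpose_def)

lemma matrix_pow_scaleR: "matrix_pow (t *\<^sub>R A) k = t ^ k *\<^sub>R matrix_pow A k"
  by (induction k) (simp_all add: matmul.scaleR_left matmul.scaleR_right)

lemma matrix_pow_commute: "matrix_pow A k ** A = A ** matrix_pow A k"
  by (induction k) (simp_all add: matrix_mul_assoc[symmetric])

lemma matrix_pow_transpose: "matrix_pow (transpose A) k = transpose (matrix_pow A k)"
  by (induction k) (simp_all add: transpose_mat matrix_pow_commute[where A = A, symmetric] flip: matrix_transpose_mul)

text \<open>Comparison with the scalar exponential series of the operator norm \<open>L\<close> of
  left multiplication by \<open>A\<close>.\<close>

lemma summable_matrix_exp:
  fixes A :: "real^'n^'n"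
  shows "summable (\<lambda>k. (1 / fact k) *\<^sub>R (t ^ k *\<^sub>R matrix_pow A k))"
proof -
  define L where "L = onorm (\<lambda>M. A ** (M :: real^'n^'n))"
  have L0: "L \<ge> 0" unfolding L_def by (rule onorm_pos_le[OF matmul.bounded_linear_right])
  have b: "norm (matrix_pow A k) \<le> L ^ k * norm (mat 1 :: real^'n^'n)" for k
  proof (induction k)
    case (Suc k)
    have "norm (matrix_pow A (Suc k)) \<le> L * norm (matrix_pow A k)"
      unfolding L_def using onorm[OF matmul.bounded_linear_right, of A "matrix_pow A k"] by simp
    also have "\<dots> \<le> L * (L ^ k * norm (mat 1 :: real^'n^'n))" by (intro mult_left_mono Suc L0)
    finally show ?case by (simp add: mult.assoc)
  qed simp
  have "summable (\<lambda>k. (inverse (fact k) *\<^sub>R (\<bar>t\<bar> * L) ^ k) * norm (mat 1 :: real^'n^'n))"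
    by (intro summable_mult2 summable_exp_generic)
  then show ?thesis
  proof (rule summable_comparison_test'[where N = 0])
    fix k
    have "norm ((1 / fact k) *\<^sub>R (t ^ k *\<^sub>R matrix_pow A k)) = inverse (fact k) * (\<bar>t\<bar> ^ k * norm (matrix_pow A k))"
      by (simp add: power_abs abs_mult divide_inverse mult_ac)
    also have "\<dots> \<le> inverse (fact k) * (\<bar>t\<bar> ^ k * (L ^ k * norm (mat 1 :: real^'n^'n)))"
      using b by (intro mult_left_mono) auto
    finally show "norm ((1 / fact k) *\<^sub>R (t ^ k *\<^sub>R matrix_pow A k))
      \<le> inverse (fact k) *\<^sub>R (\<bar>t\<bar> * L) ^ k * norm (mat 1 :: real^'n^'n)"
      by (simp add: power_mult_distrib mult_ac)
  qed
qed

lemma matrix_exp_scaleR: "matrix_exp (t *\<^sub>R A) = (\<Sum>k. (1 / fact k) *\<^sub>R (t ^ k *\<^sub>R matrix_pow A k))"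
  unfolding matrix_exp_def matrix_pow_scaleR ..

lemma matrix_exp_0: "matrix_exp (0 *\<^sub>R A) = mat 1"
  unfolding matrix_exp_scaleR
  by (subst suminf_finite[of "{0}"]) (auto simp: power_0_left)

lemma matrix_exp_commute: "matrix_exp (t *\<^sub>R A) ** A = A ** matrix_exp (t *\<^sub>R A)"
  unfolding matrix_exp_scaleR
    bounded_linear.suminf[OF matmul.bounded_linear_right summable_matrix_exp]
    bounded_linear.suminf[OF matmul.bounded_linear_left summable_matrix_exp]
  by (simp only: matmul.scaleR_left matmul.scaleR_right matrix_pow_commute)

lemma matrix_exp_transpose: "matrix_exp (t *\<^sub>R transpose A) = transpose (matrix_exp (t *\<^sub>R A))"
  unfolding matrix_exp_scaleR matrix_pow_transpose
    bounded_linear.suminf[OF bounded_linear_transpose summable_matrix_exp]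
  by (simp only: transpose_scaleR)

text \<open>Each entry is a power series converging everywhere, so it may be differentiated term by
  term; the shifted coefficients are those of \<open>A ** matrix_pow A k\<close>.\<close>

lemma has_vector_derivative_matrix_exp:
  fixes A :: "real^'n^'n"
  shows "((\<lambda>t. matrix_exp (t *\<^sub>R A)) has_vector_derivative A ** matrix_exp (t *\<^sub>R A)) (at t within S)"
proof -
  have entry: "matrix_exp (t *\<^sub>R A) $ i $ j = (\<Sum>k. (matrix_pow A k $ i $ j / fact k) * t ^ k)"
    and sm: "summable (\<lambda>k. (matrix_pow A k $ i $ j / fact k) * t ^ k)" for t i j
  proof -
    have bl: "bounded_linear (\<lambda>M :: real^'n^'n. M $ i $ j)"
      by (rule bounded_linear_compose[OF bounded_linear_vec_nth bounded_linear_vec_nth])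
    show "matrix_exp (t *\<^sub>R A) $ i $ j = (\<Sum>k. (matrix_pow A k $ i $ j / fact k) * t ^ k)"
      unfolding matrix_exp_scaleR bounded_linear.suminf[OF bl summable_matrix_exp]
      by (simp add: mult.commute)
    show "summable (\<lambda>k. (matrix_pow A k $ i $ j / fact k) * t ^ k)"
      using bounded_linear.summable[OF bl summable_matrix_exp[of t A]] by (simp add: mult.commute)
  qed
  have de: "((\<lambda>t. matrix_exp (t *\<^sub>R A) $ i $ j) has_real_derivative (A ** matrix_exp (t *\<^sub>R A)) $ i $ j) (at t)" for i j
  proof -
    have "((\<lambda>t. \<Sum>k. (matrix_pow A k $ i $ j / fact k) * t ^ k) has_real_derivative
        (\<Sum>k. diffs (\<lambda>k. matrix_pow A k $ i $ j / fact k) k * t ^ k)) (at t)"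
      by (rule termdiffs_strong_converges_everywhere) (rule sm)
    moreover have "diffs (\<lambda>k. matrix_pow A k $ i $ j / fact k) k * t ^ k
        = (\<Sum>l\<in>UNIV. A $ i $ l * ((matrix_pow A k $ l $ j / fact k) * t ^ k))" for k
    proof -
      have "diffs (\<lambda>k. matrix_pow A k $ i $ j / fact k) k = (A ** matrix_pow A k) $ i $ j / fact k"
        by (simp add: diffs_def field_simps del: of_nat_Suc)
      then show ?thesis
        by (simp add: matrix_matrix_mult_def sum_distrib_left divide_inverse mult_ac)
    qed
    moreover have "(\<Sum>k. \<Sum>l\<in>UNIV. A $ i $ l * ((matrix_pow A k $ l $ j / fact k) * t ^ k))
        = (A ** matrix_exp (t *\<^sub>R A)) $ i $ j"
    proof -
      have "(\<Sum>k. \<Sum>l\<in>UNIV. A $ i $ l * ((matrix_pow A k $ l $ j / fact k) * t ^ k))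
         = (\<Sum>l\<in>UNIV. \<Sum>k. A $ i $ l * ((matrix_pow A k $ l $ j / fact k) * t ^ k))"
        by (rule suminf_sum) (rule summable_mult[OF sm])
      also have "\<dots> = (\<Sum>l\<in>UNIV. A $ i $ l * matrix_exp (t *\<^sub>R A) $ l $ j)"
        by (simp only: suminf_mult[OF sm] entry)
      finally show ?thesis by (simp add: matrix_matrix_mult_def)
    qed
    ultimately show ?thesis by (simp add: entry)
  qed
  have "((\<lambda>t. matrix_exp (t *\<^sub>R A) \<bullet> b) has_derivative (\<lambda>h. (h *\<^sub>R (A ** matrix_exp (t *\<^sub>R A))) \<bullet> b)) (at t within S)"
    if b: "b \<in> Basis" for b
  proof -
    obtain i j where "b = axis i (axis j 1)" using b by (auto simp: Basis_vec_def)
    then have e: "M \<bullet> b = M $ i $ j" for M :: "real^'n^'n" by (simp add: inner_axis)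
    show ?thesis
      unfolding e using has_derivative_at_withinI[OF de[of i j, unfolded has_field_derivative_def]]
      by (simp add: mult_commute_abs)
  qed
  then show ?thesis
    unfolding has_vector_derivative_def by (subst has_derivative_componentwise_within) blast
qed

lemma matrix_exp_neg_deriv:
  fixes C :: "real^'n^'n"
  shows "((\<lambda>t. matrix_exp ((- t) *\<^sub>R C)) has_vector_derivative - (C ** matrix_exp ((- t) *\<^sub>R C))) (at t within S)"
proof -
  have "((\<lambda>t. - t) has_vector_derivative - 1) (at t within S)" for t :: real
    by (auto intro!: derivative_eq_intros)
  from vector_diff_chain_within[OF this has_vector_derivative_matrix_exp]
  show ?thesis by (simp add: o_def)
qed

lemma has_vector_derivative_matrix_mul:
  fixes f g :: "real \<Rightarrow> real^'n^'n"
  assumes "(f has_vector_derivative f') (at t within S)" "(g has_vector_derivative g') (at t within S)"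
  shows "((\<lambda>t. f t ** g t) has_vector_derivative f t ** g' + f' ** g t) (at t within S)"
  by (rule bounded_bilinear.has_vector_derivative[OF bounded_bilinear_matrix_mul assms])

text \<open>The product of the exponentials at times u and s + t - u has zero derivative in u; its
  constant value is compared at u = 0 and u = s.\<close>

lemma matrix_exp_add:
  fixes C :: "real^'n^'n"
  shows "matrix_exp ((s + t) *\<^sub>R C) = matrix_exp (s *\<^sub>R C) ** matrix_exp (t *\<^sub>R C)"
proof -
  let ?E = "\<lambda>t. matrix_exp (t *\<^sub>R C)"
  have "((\<lambda>u. ?E u ** ?E (s + t - u)) has_vector_derivative 0) (at u within UNIV)" for u
  proof -
    have "((\<lambda>u. s + t - u) has_vector_derivative - 1) (at u within UNIV)" for u
      by (auto intro!: derivative_eq_intros)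
    from vector_diff_chain_within[OF this has_vector_derivative_matrix_exp]
    have 1: "((\<lambda>u. ?E (s + t - u)) has_vector_derivative - (C ** ?E (s + t - u))) (at u within UNIV)"
      by (simp add: o_def)
    have "?E u ** (- (C ** ?E (s + t - u))) + (C ** ?E u) ** ?E (s + t - u) = 0"
      using matrix_exp_commute[of u C]
      by (simp add: matmul.minus_right matrix_mul_assoc)
    then show ?thesis
      using has_vector_derivative_matrix_mul[OF has_vector_derivative_matrix_exp[of C u UNIV] 1] by simp
  qed
  then obtain c where c: "\<And>u. ?E u ** ?E (s + t - u) = c"
    using has_vector_derivative_zero_constant[of UNIV "\<lambda>u. ?E u ** ?E (s + t - u)"] by auto
  from c[of 0] c[of s] show ?thesis by (simp add: matrix_exp_0[simplified])
qed

text \<open>Since 2 D = C + C^T and \<open>C\<close> commutes with its exponential, the integrand is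
  the derivative of - A_t A_t^T, and the fundamental theorem of calculus gives the closed
  form.\<close>

lemma W_matrix_eq:
  fixes C D :: "real^'n^'n"
  assumes D: "D = (1 / 2) *\<^sub>R (C + transpose C)" and t: "t \<ge> 0"
  shows "W_matrix C D t = mat 1 - matrix_exp ((- t) *\<^sub>R C) ** transpose (matrix_exp ((- t) *\<^sub>R C))"
proof -
  let ?A = "\<lambda>t. matrix_exp ((- t) *\<^sub>R C)"
  have tr: "((\<lambda>t. transpose (?A t)) has_vector_derivative - (transpose (?A t) ** transpose C)) (at t within S)" for t S
    using bounded_linear.has_vector_derivative[OF bounded_linear_transpose matrix_exp_neg_deriv[of C t S]]
    by (simp add: matrix_transpose_mul transpose_minus)
  have dW: "((\<lambda>t. - (?A t ** transpose (?A t))) has_vector_derivative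
      2 *\<^sub>R (?A t ** D ** matrix_exp ((- t) *\<^sub>R transpose C))) (at t within S)" for t S
  proof -
    have CA: "C ** ?A t = ?A t ** C" using matrix_exp_commute[of "- t" C] by simp
    have "2 *\<^sub>R (?A t ** D ** transpose (?A t)) = ?A t ** (2 *\<^sub>R D) ** transpose (?A t)"
      by (simp add: matmul.scaleR_right
          matmul.scaleR_left)
    also have "2 *\<^sub>R D = C + transpose C" by (simp add: D)
    also have "?A t ** (C + transpose C) ** transpose (?A t)
       = ?A t ** (transpose C ** transpose (?A t)) + ?A t ** C ** transpose (?A t)"
      by (simp add: matmul.add_left matmul.add_right matrix_mul_assoc)
    also have "transpose C ** transpose (?A t) = transpose (?A t) ** transpose C"
      by (simp only: matrix_transpose_mul[symmetric] CA)
    finally have e: "2 *\<^sub>R (?A t ** D ** transpose (?A t))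
       = - (?A t ** (- (transpose (?A t) ** transpose C)) + (- (C ** ?A t)) ** transpose (?A t))"
      by (simp only: CA matmul.minus_right matmul.minus_left minus_add_distrib minus_minus)
    show ?thesis
      unfolding matrix_exp_transpose e
      by (intro has_vector_derivative_minus has_vector_derivative_matrix_mul tr matrix_exp_neg_deriv)
  qed
  have "((\<lambda>s. 2 *\<^sub>R (?A s ** D ** matrix_exp ((- s) *\<^sub>R transpose C))) has_integral
     - (?A t ** transpose (?A t)) - - (?A 0 ** transpose (?A 0))) {0..t}"
    by (rule fundamental_theorem_of_calculus[OF t dW])
  moreover have "- (?A t ** transpose (?A t)) - - (?A 0 ** transpose (?A 0)) = mat 1 - ?A t ** transpose (?A t)"
    using matrix_exp_0[of C] by (simp add: transpose_mat)
  ultimately have "integral {0..t} (\<lambda>s. 2 *\<^sub>R (?A s ** D ** matrix_exp ((- s) *\<^sub>R transpose C)))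
     = mat 1 - ?A t ** transpose (?A t)"
    by (simp only: integral_unique)
  then show ?thesis
    unfolding W_matrix_def integral_cmul[symmetric] .
qed

text \<open>Gronwall's argument: \<open>exp (2 * m * t)\<close> times the quadratic form along the
  flow is nonincreasing. It is applied with the identity matrix and m = d for the norm, and with the
  weight matrix of the functional and m = \<lambda> for gradients.\<close>

lemma matrix_exp_decay:
  fixes C P :: "real^'n^'n"
  assumes P: "\<And>x y. x \<bullet> (P *v y) = y \<bullet> (P *v x)"
    and C: "\<And>x. x \<bullet> (P *v (C *v x)) \<ge> m * (x \<bullet> (P *v x))" and t: "t \<ge> 0"
  shows "(matrix_exp ((- t) *\<^sub>R C) *v x) \<bullet> (P *v (matrix_exp ((- t) *\<^sub>R C) *v x))
    \<le> exp (- 2 * m * t) * (x \<bullet> (P *v x))"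
proof -
  define y where "y t = matrix_exp ((- t) *\<^sub>R C) *v x" for t
  have bl: "bounded_linear (\<lambda>M :: real^'n^'n. M *v x)"
    unfolding linear_conv_bounded_linear[symmetric]
    by (rule linearI) (simp_all add: matrix_vector_mult_add_rdistrib scaleR_matrix_vector_assoc)
  have y': "(y has_vector_derivative - (C *v y t)) (at t)" for t
    using bounded_linear.has_vector_derivative[OF bl matrix_exp_neg_deriv[of C t UNIV]]
    by (simp add: y_def[abs_def] matrix_vector_mul_assoc linear_neg[OF bounded_linear.linear[OF bl]])
  define q where "q t = y t \<bullet> (P *v y t)" for t
  have q': "(q has_real_derivative - 2 * (y t \<bullet> (P *v (C *v y t)))) (at t)" for t
  proof -
    have "((\<lambda>t. P *v y t) has_vector_derivative P *v (- (C *v y t))) (at t)"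
      by (rule bounded_linear.has_vector_derivative[OF matrix_vector_mul_bounded_linear y'])
    from bounded_bilinear.has_vector_derivative[OF bounded_bilinear_inner y' this]
    have "(q has_vector_derivative y t \<bullet> (P *v (- (C *v y t))) + (- (C *v y t)) \<bullet> (P *v y t)) (at t)"
      by (simp add: q_def[abs_def])
    moreover have "(C *v y t) \<bullet> (P *v y t) = y t \<bullet> (P *v (C *v y t))" by (rule P)
    ultimately show ?thesis
      by (simp add: has_real_derivative_iff_has_vector_derivative linear_neg[OF matrix_vector_mul_linear])
  qed
  have "exp (2 * m * t) * q t \<le> exp (2 * m * 0) * q 0"
  proof (rule DERIV_nonpos_imp_nonincreasing[OF t])
    fix s :: real
    have "((\<lambda>s. exp (2 * m * s) * q s) has_real_derivative
        exp (2 * m * s) * (2 * m) * q s + exp (2 * m * s) * (- 2 * (y s \<bullet> (P *v (C *v y s))))) (at s)"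
      by (auto intro!: derivative_eq_intros q')
    moreover have "exp (2 * m * s) * (2 * m) * q s + exp (2 * m * s) * (- 2 * (y s \<bullet> (P *v (C *v y s))))
       = 2 * exp (2 * m * s) * (m * q s - y s \<bullet> (P *v (C *v y s)))"
      by (simp add: algebra_simps)
    moreover have "\<dots> \<le> 0"
      using C[of "y s"] by (intro mult_nonneg_nonpos) (auto simp: q_def)
    ultimately show "\<exists>z. ((\<lambda>s. exp (2 * m * s) * q s) has_real_derivative z) (at s) \<and> z \<le> 0" by metis
  qed
  then have *: "exp (- 2 * m * t) * (exp (2 * m * t) * q t) \<le> exp (- 2 * m * t) * (exp (2 * m * 0) * q 0)"
    by (rule mult_left_mono) simp
  have "exp (- 2 * m * t) * exp (2 * m * t) = 1"
    by (simp add: exp_add[symmetric])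
  then have "q t = exp (- 2 * m * t) * (exp (2 * m * t) * q t)"
    by (simp only: mult.assoc[symmetric] mult_1_left)
  also note *
  finally have "q t \<le> exp (- 2 * m * t) * q 0" by simp
  moreover have "y 0 = x" using matrix_exp_0[of C] by (simp add: y_def)
  then have "q 0 = x \<bullet> (P *v x)" by (simp add: q_def)
  ultimately show ?thesis by (simp only: q_def y_def)
qed

text \<open>The eigenvalues of a diagonal matrix are its entries, so the minimum is over a finite
  nonempty set and bounds every entry from below.\<close>

lemma min_eigenvalue_diagonal:
  fixes D :: "real^'n^'n"
  assumes D: "positive_definite D" "diagonal_matrix D"
  shows "min_eigenvalue D > 0" and "x \<bullet> (D *v x) \<ge> min_eigenvalue D * (x \<bullet> x)"
proof -
  have Dx: "(D *v x) $ i = D $ i $ i * x $ i" for x i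
  proof -
    have "(D *v x) $ i = (\<Sum>j\<in>UNIV. if j = i then D $ i $ i * x $ i else 0)"
      unfolding matrix_vector_mult_def vec_lambda_beta
      using D(2) by (intro sum.cong) (auto simp: diagonal_matrix_def)
    then show ?thesis by simp
  qed
  have ev: "{\<mu>. eigenvalue D \<mu>} = range (\<lambda>i. D $ i $ i)"
  proof safe
    fix \<mu> assume "eigenvalue D \<mu>"
    then obtain v where v: "v \<noteq> 0" "D *v v = \<mu> *s v" by (auto simp: eigenvalue_def)
    then obtain i where i: "v $ i \<noteq> 0" by (auto simp: vec_eq_iff)
    have "\<mu> * v $ i = D $ i $ i * v $ i" using v(2) Dx[of v i] by simp
    then have "\<mu> = D $ i $ i" using i by (simp only: mult_cancel_right) simp
    then show "\<mu> \<in> range (\<lambda>i. D $ i $ i)" by blast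
  next
    fix i
    have "D *v axis i 1 = D $ i $ i *s axis i 1"
      unfolding vec_eq_iff Dx by (simp add: axis_def)
    then show "eigenvalue D (D $ i $ i)"
      unfolding eigenvalue_def by (intro exI[of _ "axis i 1"]) (simp add: axis_eq_0_iff)
  qed
  have m: "min_eigenvalue D = Min (range (\<lambda>i. D $ i $ i))"
    by (simp add: min_eigenvalue_def ev)
  have pos: "D $ i $ i > 0" for i
  proof -
    have "(axis i 1 :: real^'n) \<noteq> 0" by (simp add: axis_eq_0_iff)
    then have "axis i 1 \<bullet> (D *v axis i 1) > 0" using D(1) unfolding positive_definite_def by blast
    then show ?thesis by (simp add: inner_axis' Dx)
  qed
  show "min_eigenvalue D > 0" unfolding m using pos by (subst Min_gr_iff) auto
  have le: "min_eigenvalue D \<le> D $ i $ i" for i unfolding m by (rule Min_le) auto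
  show "x \<bullet> (D *v x) \<ge> min_eigenvalue D * (x \<bullet> x)"
    unfolding inner_vec_def sum_distrib_left Dx
    using le by (intro sum_mono) (simp add: mult.left_commute[of "x $ _"] mult_right_mono)
qed

section \<open>Mehler's kernel\<close>

lemma abs_mult_le_squares: "\<bar>u * v\<bar> \<le> (u\<^sup>2 + v\<^sup>2) / 2" for u v :: real
  using sum_squares_bound[of "\<bar>u\<bar>" "\<bar>v\<bar>"] by (simp add: abs_mult)

text \<open>The integrand is split into |g| exp (N^2 / 4), square integrable by assumption, and exp
  (R N - N^2 / 4), whose square is dominated by a Gaussian after completing (2 R - N / 2)^2.\<close>

lemma exp_integrable_weighted:
  fixes g :: "real^'n \<Rightarrow> real"
  assumes [measurable]: "g \<in> borel_measurable borel"
    and g: "integrable lborel (\<lambda>y. (g y)\<^sup>2 * exp ((norm y)\<^sup>2 / 2))"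
  shows "exp_integrable g"
  unfolding exp_integrable_def
proof (intro conjI allI)
  fix R :: real
  show "integrable lborel (\<lambda>y. exp (R * norm y) * \<bar>g y\<bar>)"
  proof (rule Bochner_Integration.integrable_bound)
    show "integrable lborel (\<lambda>y. (g y)\<^sup>2 * exp ((norm y)\<^sup>2 / 2) + exp (4 * R\<^sup>2) * exp (- (1 / 4) * (norm (y - 0))\<^sup>2))"
      using integrable_gaussian(1)[of "1 / 4" "0 :: real^'n"] g
      by (intro Bochner_Integration.integrable_add integrable_mult_right) auto
    have "exp (R * norm y) * \<bar>g y\<bar> \<le> (g y)\<^sup>2 * exp ((norm y)\<^sup>2 / 2) + exp (4 * R\<^sup>2) * exp (- (1 / 4) * (norm (y - 0))\<^sup>2)" for y
    proof -
      define N where "N = norm y"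
      have e: "(exp (N\<^sup>2 / 4))\<^sup>2 = exp (N\<^sup>2 / 2)" "(exp (R * N - N\<^sup>2 / 4))\<^sup>2 = exp (2 * R * N - N\<^sup>2 / 2)"
        by (simp_all add: power2_eq_square[of "exp _"] exp_add[symmetric])
      have "\<bar>(\<bar>g y\<bar> * exp (N\<^sup>2 / 4)) * exp (R * N - N\<^sup>2 / 4)\<bar>
          \<le> ((\<bar>g y\<bar> * exp (N\<^sup>2 / 4))\<^sup>2 + (exp (R * N - N\<^sup>2 / 4))\<^sup>2) / 2"
        by (rule abs_mult_le_squares)
      also have "\<dots> = ((g y)\<^sup>2 * exp (N\<^sup>2 / 2) + exp (2 * R * N - N\<^sup>2 / 2)) / 2"
        by (simp only: power_mult_distrib power2_abs e)
      also have "\<dots> \<le> (g y)\<^sup>2 * exp (N\<^sup>2 / 2) + exp (2 * R * N - N\<^sup>2 / 2)" by simp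
      also have "exp (2 * R * N - N\<^sup>2 / 2) \<le> exp (4 * R\<^sup>2 + - (1 / 4) * N\<^sup>2)"
      proof -
        have "(2 * R - N / 2)\<^sup>2 = 4 * R\<^sup>2 - 2 * R * N + N\<^sup>2 / 4"
          by (simp add: power2_diff power_mult_distrib power_divide)
        then have "0 \<le> 4 * R\<^sup>2 - 2 * R * N + N\<^sup>2 / 4" by (metis zero_le_power2)
        then show ?thesis by simp
      qed
      finally have "\<bar>(\<bar>g y\<bar> * exp (N\<^sup>2 / 4)) * exp (R * N - N\<^sup>2 / 4)\<bar>
         \<le> (g y)\<^sup>2 * exp (N\<^sup>2 / 2) + exp (4 * R\<^sup>2 + - (1 / 4) * N\<^sup>2)" by simp
      moreover have "exp (N\<^sup>2 / 4) * exp (R * N - N\<^sup>2 / 4) = exp (R * N)"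
        by (simp add: exp_add[symmetric])
      then have "(\<bar>g y\<bar> * exp (N\<^sup>2 / 4)) * exp (R * N - N\<^sup>2 / 4) = \<bar>g y\<bar> * exp (R * N)"
        by (simp only: mult.assoc)
      ultimately have "\<bar>\<bar>g y\<bar> * exp (R * N)\<bar> \<le> (g y)\<^sup>2 * exp (N\<^sup>2 / 2) + exp (4 * R\<^sup>2 + - (1 / 4) * N\<^sup>2)"
        by (simp only:)
      then show ?thesis unfolding exp_add by (simp add: N_def abs_mult mult.commute)
    qed
    then show "AE y in lborel. norm (exp (R * norm y) * \<bar>g y\<bar>)
        \<le> norm ((g y)\<^sup>2 * exp ((norm y)\<^sup>2 / 2) + exp (4 * R\<^sup>2) * exp (- (1 / 4) * (norm (y - 0))\<^sup>2))"
      by (intro AE_I2) (simp add: abs_mult)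
  qed measurable
qed simp

text \<open>Only a = Re z matters for the Laplace integral, which costs exp (|a|^2). The prefactor
  has modulus exp ((|b|^2 - |a|^2) / 2), and the product is exactly the symmetric bound exp (|z|^2 /
  2).\<close>

lemma bargmann_growth:
  fixes g :: "real^'n \<Rightarrow> real"
  assumes g1[measurable]: "g \<in> borel_measurable borel"
    and g: "integrable lborel (\<lambda>y. (g y)\<^sup>2 * exp ((norm y)\<^sup>2 / 2))"
  obtains c where "\<And>z. norm (bargmann g z) \<le> c * exp (1 / 2 * (norm z)\<^sup>2)"
proof
  fix z :: "complex^'n"
  obtain a b where z: "z = cvec (a, b)" using cvec_surj by metis
  define M where "M = (LBINT y. (g y)\<^sup>2 * exp ((norm y)\<^sup>2 / 2))"
  define q where "q = (2 * pi) powr (CARD('n) / 2)"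
  note G = integrable_gaussian[of "1 / 2" "2 *\<^sub>R a"]
  have p: "norm (of_real (g y) * exp (bil z (creal y)))
      \<le> exp ((norm a)\<^sup>2) / 2 * ((g y)\<^sup>2 * exp ((norm y)\<^sup>2 / 2) + exp (- (1 / 2) * (norm (y - 2 *\<^sub>R a))\<^sup>2))" for y
  proof -
    have e1: "(exp ((norm y)\<^sup>2 / 4))\<^sup>2 = exp ((norm y)\<^sup>2 / 2)"
      "(exp (- (1 / 4) * (norm (y - 2 *\<^sub>R a))\<^sup>2))\<^sup>2 = exp (- (1 / 2) * (norm (y - 2 *\<^sub>R a))\<^sup>2)"
      by (simp_all add: power2_eq_square[of "exp _"] exp_add[symmetric])
    \<comment> \<open>The term |y|^2 / 4 goes with \<open>g\<close> to form its weighted square, the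
      remaining Gaussian is centred at 2 a.\<close>
    have e2: "a \<bullet> y = (norm a)\<^sup>2 + ((norm y)\<^sup>2 / 4 + - (1 / 4) * (norm (y - 2 *\<^sub>R a))\<^sup>2)"
      by (simp add: power2_norm_eq_inner inner_diff inner_commute algebra_simps)
    have "norm (of_real (g y) * exp (bil z (creal y))) = \<bar>g y\<bar> * exp (a \<bullet> y)"
      by (simp add: norm_mult z bil_creal)
    also have "\<dots> = exp ((norm a)\<^sup>2) * ((\<bar>g y\<bar> * exp ((norm y)\<^sup>2 / 4)) * exp (- (1 / 4) * (norm (y - 2 *\<^sub>R a))\<^sup>2))"
      unfolding e2 exp_add by (simp only: mult_ac)
    also have "\<dots> \<le> exp ((norm a)\<^sup>2) *
       (((\<bar>g y\<bar> * exp ((norm y)\<^sup>2 / 4))\<^sup>2 + (exp (- (1 / 4) * (norm (y - 2 *\<^sub>R a))\<^sup>2))\<^sup>2) / 2)"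
      by (intro mult_left_mono order_trans[OF abs_ge_self abs_mult_le_squares]) simp
    finally show ?thesis by (simp only: power_mult_distrib power2_abs e1 times_divide_eq_left times_divide_eq_right)
  qed
  have "norm (laplace g z) \<le> (LBINT y. norm (of_real (g y) * exp (bil z (creal y))))"
    unfolding laplace_def by (rule integral_norm_bound)
  also have "\<dots> \<le> (LBINT y. exp ((norm a)\<^sup>2) / 2 * ((g y)\<^sup>2 * exp ((norm y)\<^sup>2 / 2) + exp (- (1 / 2) * (norm (y - 2 *\<^sub>R a))\<^sup>2)))"
    using p g G(1) by (intro integral_mono' integrable_mult_right Bochner_Integration.integrable_add) auto
  also have "\<dots> = exp ((norm a)\<^sup>2) / 2 * (M + q)"
    using g G by (simp add: M_def q_def mult.commute[of pi])
  finally have L: "norm (laplace g z) \<le> exp ((norm a)\<^sup>2) / 2 * (M + q)" .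
  have bz: "norm (exp (- bil z z / 2)) = exp (- ((norm a)\<^sup>2 - (norm b)\<^sup>2) / 2)"
    by (simp add: z bil_self field_simps)
  have "norm (bargmann g z) = exp (- ((norm a)\<^sup>2 - (norm b)\<^sup>2) / 2) * norm (laplace g z)"
    unfolding bargmann_def norm_mult bz ..
  also have "\<dots> \<le> exp (- ((norm a)\<^sup>2 - (norm b)\<^sup>2) / 2) * (exp ((norm a)\<^sup>2) / 2 * (M + q))"
    by (rule mult_left_mono[OF L]) simp
  also have "\<dots> = (M + q) / 2 * (exp (- ((norm a)\<^sup>2 - (norm b)\<^sup>2) / 2) * exp ((norm a)\<^sup>2))" by simp
  also have "exp (- ((norm a)\<^sup>2 - (norm b)\<^sup>2) / 2) * exp ((norm a)\<^sup>2) = exp (1 / 2 * (norm z)\<^sup>2)"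
    unfolding exp_add[symmetric] z norm_cvec norm_Pair by (simp add: field_simps)
  finally show "norm (bargmann g z) \<le> ((LBINT y. (g y)\<^sup>2 * exp ((norm y)\<^sup>2 / 2)) + (2 * pi) powr (CARD('n) / 2)) / 2
     * exp (1 / 2 * (norm z)\<^sup>2)" by (simp only: M_def q_def)
qed

lemma exp_Complex: "exp (Complex r s) = of_real (exp r) * cis s"
  by (simp add: exp_eq_polar exp_of_real)

text \<open>In \<open>b\<close> the exponent is quadratic with matrix \<open>W\<close>, with linear
  term \<i> v . b where v = W a - q and q = x - A y, so the integral is a Gaussian Fourier
  transform. Expanding the inverse form at \<open>v\<close> cancels all terms in \<open>a\<close>:
  the value is the same on every vertical line.\<close>

lemma mehler_kernel:
  fixes A :: "real^'n^'n" and a x y :: "real^'n"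
  assumes A: "\<And>x. norm (A *v x) \<le> \<theta> * norm x" and \<theta>: "\<theta> < 1"
  defines "W \<equiv> mat 1 - A ** transpose A"
  shows "(LBINT b. exp (bil (cvec (a, b)) (cvec (a, b)) / 2 - bil (cvec (a, b)) (creal x)) *
       exp (bil (cmat (transpose A) (cvec (a, b))) (creal y)
         - bil (cmat (transpose A) (cvec (a, b))) (cmat (transpose A) (cvec (a, b))) / 2))
    = of_real ((2 * pi) powr (CARD('n) / 2) / sqrt (det W) *
        exp (- (1 / 2) * ((x - A *v y) \<bullet> (matrix_inv W *v (x - A *v y)))))"
proof -
  define T where "T = transpose A"
  have W: "positive_definite W" unfolding W_def by (rule contraction_posdef(2)[OF A \<theta>])
  have Wab: "u \<bullet> (W *v w) = u \<bullet> w - (T *v u) \<bullet> (T *v w)" for u w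
    by (simp add: W_def T_def matrix_vector_mult_diff_rdistrib inner_diff_right
        inner_matrix_transpose[of u A] flip: matrix_vector_mul_assoc)
  have TA: "(T *v u) \<bullet> w = u \<bullet> (A *v w)" for u w
    by (simp only: T_def inner_matrix_transpose)
  define q where "q = x - A *v y"
  define v where "v = W *v a - q"
  have "exp (bil (cvec (a, b)) (cvec (a, b)) / 2 - bil (cvec (a, b)) (creal x)) *
       exp (bil (cmat T (cvec (a, b))) (creal y) - bil (cmat T (cvec (a, b))) (cmat T (cvec (a, b))) / 2)
     = of_real (exp (a \<bullet> (W *v a) / 2 - a \<bullet> q)) * (of_real (exp (- (b \<bullet> (W *v b)) / 2)) * cis (v \<bullet> b))" for b
  proof -
    have "bil (cvec (a, b)) (cvec (a, b)) / 2 - bil (cvec (a, b)) (creal x) +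
       (bil (cmat T (cvec (a, b))) (creal y) - bil (cmat T (cvec (a, b))) (cmat T (cvec (a, b))) / 2)
      = Complex (a \<bullet> (W *v a) / 2 - a \<bullet> q + - (b \<bullet> (W *v b)) / 2) (v \<bullet> b)"
      (is "?L = ?R")
    proof (rule complex_eqI)
      have h: "u \<bullet> (W *v u) = (norm u)\<^sup>2 - (norm (T *v u))\<^sup>2" "u \<bullet> q = u \<bullet> x - (T *v u) \<bullet> y" for u
        by (simp_all add: Wab TA q_def inner_diff_right power2_norm_eq_inner)
      show "Re ?L = Re ?R"
        by (simp add: cmat_cvec bil_self bil_creal h field_simps)
      have "v \<bullet> b = b \<bullet> a - (T *v b) \<bullet> (T *v a) - (b \<bullet> x - (T *v b) \<bullet> y)"
        unfolding v_def inner_diff_left inner_commute[of "W *v a"] inner_commute[of q] Wab h(2) ..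
      then show "Im ?L = Im ?R"
        by (simp add: cmat_cvec bil_self bil_creal inner_commute[of a b] inner_commute[of "T *v a"])
    qed
    then show ?thesis
      unfolding exp_add[symmetric] by (simp only: exp_Complex exp_add of_real_mult mult.assoc)
  qed
  note e = this[unfolded T_def]
  have "v \<bullet> (matrix_inv W *v v) = a \<bullet> (W *v a) - 2 * (a \<bullet> q) + q \<bullet> (matrix_inv W *v q)"
  proof -
    have iW: "invertible W" by (rule posdef_invertible(1)[OF W])
    have 1: "matrix_inv W *v v = a - matrix_inv W *v q"
      by (simp add: v_def matrix_vector_mult_diff_distrib matrix_vector_mul_assoc matrix_inv_left[OF iW])
    have "(W *v a) \<bullet> (matrix_inv W *v q) = a \<bullet> (W *v (matrix_inv W *v q))"
      using posdef_symmetric[OF W, of "matrix_inv W *v q" a] by (simp add: inner_commute)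
    also have "\<dots> = a \<bullet> q" by (simp add: matrix_vector_mul_assoc matrix_inv_right[OF iW])
    finally show ?thesis
      unfolding 1 by (simp add: v_def inner_diff_left inner_diff_right inner_commute)
  qed
  then have ee: "exp (a \<bullet> (W *v a) / 2 - a \<bullet> q) * exp (- (v \<bullet> (matrix_inv W *v v)) / 2)
      = exp (- (1 / 2) * (q \<bullet> (matrix_inv W *v q)))"
    by (simp add: exp_add[symmetric] field_simps)
  show ?thesis
    unfolding e integral_mult_right_zero gaussian_matrix_fourier(2)[OF W] q_def[symmetric] of_real_mult[symmetric]
    by (subst mult.left_commute) (simp only: ee)
qed

text \<open>This is the substitution rule for the flow, expressed through inversion: instead of
  transforming the solution, the transformed datum is substituted into the inversion integral, and
  exchanging the integrals over \<open>b\<close> and \<open>y\<close> leaves Mehler's kernel. The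
  exchange needs \<theta> < 1, which provides the Gaussian majorant in \<open>b\<close>.\<close>

lemma mehler_inversion:
  fixes A :: "real^'n^'n" and g :: "real^'n \<Rightarrow> real"
  assumes A: "\<And>x. norm (A *v x) \<le> \<theta> * norm x" and \<theta>: "0 \<le> \<theta>" "\<theta> < 1" and g: "exp_integrable g"
  defines "W \<equiv> mat 1 - A ** transpose A"
  shows "inversion (\<lambda>x. 1 / ((2 * pi) powr (CARD('n) / 2) * sqrt (det W)) *
      (LBINT y. exp (- (1 / 2) * ((x - A *v y) \<bullet> (matrix_inv W *v (x - A *v y)))) * g y) / f_inf x)
    (\<lambda>z. bargmann g (cmat (transpose A) z))"
  unfolding inversion_def
proof (intro allI)
  fix a x :: "real^'n"
  have [measurable]: "g \<in> borel_measurable borel" using g by (simp add: exp_integrable_def)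
  define T where "T = transpose A"
  let ?z = "\<lambda>b. cvec (a, b)"
  define K where "K b y = exp (bil (?z b) (?z b) / 2 - bil (?z b) (creal x)) *
       exp (bil (cmat T (?z b)) (creal y) - bil (cmat T (?z b)) (cmat T (?z b)) / 2)" for b y
  define q where "q = (2 * pi) powr (CARD('n) / 2)"
  have q: "q > 0" by (simp add: q_def)
  have detW: "det W > 0" unfolding W_def by (rule posdef_invertible(2)[OF contraction_posdef(2)[OF A \<theta>(2)]])
  define J where "J = (LBINT y. exp (- (1 / 2) * ((x - A *v y) \<bullet> (matrix_inv W *v (x - A *v y)))) * g y)"
  have T: "norm (T *v b) \<le> \<theta> * norm b" for b unfolding T_def by (rule norm_transpose_le[OF A])
  have "(LBINT b. exp (bil (?z b) (?z b) / 2 - bil (?z b) (creal x)) * bargmann g (cmat T (?z b)))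
    = (LBINT b. LBINT y. of_real (g y) * K b y)"
  proof (intro Bochner_Integration.integral_cong refl)
    fix b
    have "(LBINT y. of_real (g y) * K b y) = (LBINT y. (exp (bil (?z b) (?z b) / 2 - bil (?z b) (creal x)) *
        exp (- bil (cmat T (?z b)) (cmat T (?z b)) / 2)) * (of_real (g y) * exp (bil (cmat T (?z b)) (creal y))))"
    proof (intro Bochner_Integration.integral_cong refl)
      fix y
      have "exp (u - w / 2) = exp (- w / 2) * exp u" for u w :: complex
        by (simp add: exp_add[symmetric])
      then show "of_real (g y) * K b y = (exp (bil (?z b) (?z b) / 2 - bil (?z b) (creal x)) *
        exp (- bil (cmat T (?z b)) (cmat T (?z b)) / 2)) * (of_real (g y) * exp (bil (cmat T (?z b)) (creal y)))"
        by (simp only: K_def mult_ac)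
    qed
    then show "exp (bil (?z b) (?z b) / 2 - bil (?z b) (creal x)) * bargmann g (cmat T (?z b))
       = (LBINT y. of_real (g y) * K b y)"
      by (simp only: integral_mult_right_zero bargmann_def laplace_def mult.assoc)
  qed
  also have "\<dots> = (LBINT y. LBINT b. of_real (g y) * K b y)"
  proof (rule fubini_product_bound(2))
    define k where "k = exp (- (a \<bullet> x) + (norm a)\<^sup>2 / 2 - (norm (T *v a))\<^sup>2 / 2)"
    show "integrable lborel (\<lambda>b :: real^'n. exp (- ((1 - \<theta>\<^sup>2) / 2) * (norm (b - 0))\<^sup>2))"
      using \<theta> by (intro integrable_gaussian) (simp add: power_less_one_iff)
    show "integrable lborel (\<lambda>y. k * (exp (norm (T *v a) * norm y) * \<bar>g y\<bar>))"
      using g by (intro integrable_mult_right) (simp add: exp_integrable_def)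
    fix b y :: "real^'n"
    have "norm (K b y) = exp ((norm a)\<^sup>2 / 2 - (norm b)\<^sup>2 / 2 - a \<bullet> x) *
        exp ((T *v a) \<bullet> y - ((norm (T *v a))\<^sup>2 - (norm (T *v b))\<^sup>2) / 2)"
      unfolding K_def cmat_cvec bil_self bil_creal norm_mult norm_exp
      by (simp add: diff_divide_distrib)
    also have "\<dots> = k * (exp ((T *v a) \<bullet> y) * exp (((norm (T *v b))\<^sup>2 - (norm b)\<^sup>2) / 2))"
      unfolding k_def exp_add[symmetric] by (simp add: field_simps)
    also have "\<dots> \<le> k * (exp (norm (T *v a) * norm y) * exp (- ((1 - \<theta>\<^sup>2) / 2) * (norm (b - 0))\<^sup>2))"
    proof -
      have "(norm (T *v b))\<^sup>2 \<le> (\<theta> * norm b)\<^sup>2" by (intro power_mono T) simp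
      then have "((norm (T *v b))\<^sup>2 - (norm b)\<^sup>2) / 2 \<le> - ((1 - \<theta>\<^sup>2) / 2) * (norm (b - 0))\<^sup>2"
        by (simp add: power_mult_distrib field_simps)
      then show ?thesis
        using norm_cauchy_schwarz[of "T *v a" y] by (intro mult_left_mono mult_mono) (auto simp: k_def)
    qed
    finally have "\<bar>g y\<bar> * norm (K b y) \<le> \<bar>g y\<bar> * (k * (exp (norm (T *v a) * norm y) * exp (- ((1 - \<theta>\<^sup>2) / 2) * (norm (b - 0))\<^sup>2)))"
      by (rule mult_left_mono) simp
    then show "norm (of_real (g y) * K b y)
      \<le> exp (- ((1 - \<theta>\<^sup>2) / 2) * (norm (b - 0))\<^sup>2) * (k * (exp (norm (T *v a) * norm y) * \<bar>g y\<bar>))"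
      by (simp only: norm_mult norm_of_real mult_ac)
  next
    have "continuous_on UNIV (\<lambda>p. K (fst p) (snd p))"
      unfolding K_def
      by (intro continuous_intros bil.continuous_on linear_continuous_on[OF bounded_linear_cmat, THEN continuous_on_compose2]) auto
    then have "(\<lambda>p. K (fst p) (snd p)) \<in> borel_measurable borel"
      by (rule borel_measurable_continuous_onI)
    then have [measurable]: "(\<lambda>p. K (fst p) (snd p)) \<in> borel_measurable (borel \<Otimes>\<^sub>M borel)"
      by (simp add: borel_prod)
    show "(\<lambda>(b, y). of_real (g y) * K b y) \<in> borel_measurable (lborel \<Otimes>\<^sub>M lborel)"
      unfolding case_prod_beta by measurable
  qed
  also have "\<dots> = (LBINT y. of_real (q / sqrt (det W)) *
      of_real (exp (- (1 / 2) * ((x - A *v y) \<bullet> (matrix_inv W *v (x - A *v y)))) * g y))"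
  proof (intro Bochner_Integration.integral_cong refl)
    fix y
    have "(LBINT b. K b y) = of_real (q / sqrt (det W) * exp (- (1 / 2) * ((x - A *v y) \<bullet> (matrix_inv W *v (x - A *v y)))))"
      unfolding K_def T_def q_def W_def by (rule mehler_kernel[OF A \<theta>(2)])
    then show "(LBINT b. of_real (g y) * K b y) = of_real (q / sqrt (det W)) *
      of_real (exp (- (1 / 2) * ((x - A *v y) \<bullet> (matrix_inv W *v (x - A *v y)))) * g y)"
      unfolding integral_mult_right_zero by (simp only: of_real_mult mult_ac)
  qed
  also have "\<dots> = of_real (q / sqrt (det W) * J)"
    unfolding integral_mult_right_zero J_def integral_complex_of_real of_real_mult[symmetric] ..
  finally have main: "(LBINT b. exp (bil (?z b) (?z b) / 2 - bil (?z b) (creal x)) * bargmann g (cmat T (?z b)))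
    = of_real (q / sqrt (det W) * J)" .
  have "(2 * pi) powr (- real CARD('n) / 2) = 1 / q"
    by (simp only: q_def minus_divide_left[symmetric] powr_minus_divide)
  then have fx: "f_inf x = exp (- (norm x)\<^sup>2 / 2) / q"
    by (simp add: f_inf_def)
  have "q * exp (- (norm x)\<^sup>2 / 2) * (1 / (q * sqrt (det W)) * J / f_inf x) = q / sqrt (det W) * J"
    unfolding fx using q detW by (simp add: field_simps)
  then show "of_real ((2 * pi) powr (CARD('n) / 2) * exp (- (norm x)\<^sup>2 / 2) *
      (1 / ((2 * pi) powr (CARD('n) / 2) * sqrt (det W)) *
      (LBINT y. exp (- (1 / 2) * ((x - A *v y) \<bullet> (matrix_inv W *v (x - A *v y)))) * g y) / f_inf x))
     = (LBINT b. exp (bil (?z b) (?z b) / 2 - bil (?z b) (creal x)) * bargmann g (cmat (transpose A) (?z b)))"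
    unfolding main[unfolded T_def] J_def[symmetric] q_def[symmetric] by (simp only:)
qed

text \<open>Because the formula holds on every line Re z = a, x and a can be shifted by the same
  \<alpha>. The kernel then changes only by a factor that the Gaussian in front of \<open>h\<close>
  cancels, and all dependence on \<alpha> sits in the argument of \<open>F\<close>. Differentiating
  at \<alpha> = 0 therefore produces F' under an unchanged kernel.\<close>

lemma inversion_gradient:
  fixes h :: "real^'n \<Rightarrow> real"
  assumes inv: "inversion h F" and F: "entire_vec F F'"
    and growth: "\<And>z. norm (F z) \<le> c * exp (\<kappa> * (norm z)\<^sup>2)" and \<kappa>: "0 < \<kappa>" "\<kappa> < 1 / 2"
  shows "h differentiable (at x)"
    and "inversion (\<lambda>x. frechet_derivative h (at x) v) (\<lambda>z. bil (creal v) (F' z))"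
proof -
  \<comment> \<open>Together with \<kappa> and 1/2 these are equally spaced: one step is spent on
    passing from \<open>F\<close> to its gradient, the next on shifts \<alpha> in the unit ball, and
    one remains for convergence.\<close>
  define \<kappa>1 where "\<kappa>1 = (2 * \<kappa> + 1 / 2) / 3"
  define \<kappa>2 where "\<kappa>2 = (\<kappa> + 1) / 3"
  have k12: "\<kappa> < \<kappa>1" "\<kappa>1 < \<kappa>2" "\<kappa>2 < 1 / 2" "0 < \<kappa>1" using \<kappa> by (auto simp: \<kappa>1_def \<kappa>2_def)
  obtain c1 where c1: "\<And>z. norm (F' z) \<le> c1 * exp (\<kappa>1 * (norm z)\<^sup>2)"
    using entire_vec_growth_deriv[OF F growth \<kappa>(1) k12(1)] by metis
  have c10: "c1 \<ge> 0" using order_trans[OF norm_ge_zero c1[of 0]] by simp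
  define e where "e = \<kappa>2 / \<kappa>1 - 1"
  have e: "e > 0" "\<kappa>1 * (1 + e) = \<kappa>2" using k12 by (auto simp: e_def field_simps)
  have cont: "continuous_on S F" for S by (rule entire_vec_continuous[OF F])
  define N where "N x = (2 * pi) powr (CARD('n) / 2) * exp (- (norm x)\<^sup>2 / 2)" for x :: "real^'n"
  have N: "N x > 0" for x by (simp add: N_def)
  define w where "w a x b = exp (bil (cvec (a, b)) (cvec (a, b)) / 2 - bil (cvec (a, b)) (creal x))" for a x b :: "real^'n"
  have nw: "norm (w a x b) = exp ((norm a)\<^sup>2 / 2 - a \<bullet> x) * exp (- (norm b)\<^sup>2 / 2)" for a x b
    unfolding w_def bil_self bil_creal norm_exp exp_add[symmetric] by (simp add: diff_divide_distrib)
  have shift: "cvec (a, b) + creal \<alpha> = cvec (a + \<alpha>, b)" for a b \<alpha> :: "real^'n"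
    by (simp flip: cvec_add)
  have trans: "of_real (N x * h (x + \<alpha>)) = (LBINT b. w a x b * F (cvec (a, b) + creal \<alpha>))" for a x \<alpha>
  proof -
    define r where "r = exp (- (\<alpha> \<bullet> x) - (norm \<alpha>)\<^sup>2 / 2)"
    have wr: "w (a + \<alpha>) (x + \<alpha>) b = of_real r * w a x b" for b
    proof -
      have "bil (cvec (a + \<alpha>, b)) (cvec (a + \<alpha>, b)) / 2 - bil (cvec (a + \<alpha>, b)) (creal (x + \<alpha>))
        = of_real (- (\<alpha> \<bullet> x) - (norm \<alpha>)\<^sup>2 / 2) + (bil (cvec (a, b)) (cvec (a, b)) / 2 - bil (cvec (a, b)) (creal x))"
        unfolding bil_self bil_creal
        by (simp add: complex_eq_iff power2_norm_eq_inner inner_add_left inner_add_right inner_commute field_simps)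
      then show ?thesis by (simp only: w_def exp_add exp_of_real r_def)
    qed
    have Nr: "N (x + \<alpha>) = r * N x"
      unfolding N_def r_def
      by (simp add: exp_add[symmetric] power2_norm_eq_inner inner_add_left inner_add_right inner_commute field_simps)
    have "of_real (N (x + \<alpha>) * h (x + \<alpha>)) = (LBINT b. w (a + \<alpha>) (x + \<alpha>) b * F (cvec (a + \<alpha>, b)))"
      using inv[unfolded inversion_def, rule_format, of "x + \<alpha>" "a + \<alpha>"] by (simp only: N_def w_def)
    also have "\<dots> = (LBINT b. of_real r * (w a x b * F (cvec (a, b) + creal \<alpha>)))"
      unfolding wr shift by (simp only: mult.assoc)
    also have "\<dots> = of_real r * (LBINT b. w a x b * F (cvec (a, b) + creal \<alpha>))"
      by (rule integral_mult_right_zero)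
    finally have "of_real r * of_real (N x * h (x + \<alpha>)) = of_real r * (LBINT b. w a x b * F (cvec (a, b) + creal \<alpha>))"
      unfolding Nr by (simp only: of_real_mult mult.assoc)
    then show ?thesis by (simp add: r_def)
  qed
  define D where "D a x v = (LBINT b. w a x b * bil (creal v) (F' (cvec (a, b))))" for a x v
  have der: "((\<lambda>\<alpha>. of_real (N x * h (x + \<alpha>))) has_derivative D a x) (at 0)" for a x
  proof -
    let ?f' = "\<lambda>\<alpha> b v. w a x b * bil (creal v) (F' (cvec (a, b) + creal \<alpha>))"
    define k where "k = c1 * exp ((norm a)\<^sup>2 / 2 - a \<bullet> x) * exp (\<kappa>2 * (norm a)\<^sup>2 + \<kappa>1 * (1 + 1 / e))"
    have "((\<lambda>\<alpha>. LBINT b. w a x b * F (cvec (a, b) + creal \<alpha>)) has_derivative (\<lambda>v. LBINT b. ?f' 0 b v)) (at 0)"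
    proof (rule has_derivative_integral(2)[where f' = ?f'])
      show "(1::real) > 0" by simp
      show "integrable lborel (\<lambda>b. k * exp (- (1 / 2 - \<kappa>2) * (norm (b - 0))\<^sup>2))"
        using k12 by (intro integrable_mult_right integrable_gaussian) simp
      fix \<alpha> b :: "real^'n"
      have "((\<lambda>\<alpha>. cvec (a, b) + creal \<alpha>) has_derivative (\<lambda>v. creal v)) (at \<alpha>)"
      proof -
        have "bounded_linear (\<lambda>v :: real^'n. creal v)"
          by (rule bounded_linear_compose[OF bounded_linear_cvec bounded_linear_Pair]) (auto intro: bounded_linear_ident bounded_linear_zero)
        then show ?thesis by (auto intro!: derivative_eq_intros bounded_linear_imp_has_derivative)
      qed
      from entire_vec_compose[OF F this]
      show "((\<lambda>\<alpha>. w a x b * F (cvec (a, b) + creal \<alpha>)) has_derivative ?f' \<alpha> b) (at \<alpha>)"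
        by (rule has_derivative_mult_right)
    next
      fix \<alpha> :: "real^'n"
      show "integrable lborel (\<lambda>b. w a x b * F (cvec (a, b) + creal \<alpha>))"
      proof (rule gaussian_growth_integrable[where \<kappa> = "1 / 2 + \<kappa>" and c = "exp ((norm a)\<^sup>2 / 2 - a \<bullet> x) * (c * exp (\<kappa> * (norm (a + \<alpha>))\<^sup>2))"])
        have "continuous_on UNIV (\<lambda>b. w a x b * F (cvec (a, b) + creal \<alpha>))"
          unfolding w_def
          by (intro continuous_intros bil.continuous_on continuous_on_compose2[OF cont[of UNIV]]) auto
        then show "(\<lambda>b. w a x b * F (cvec (a, b) + creal \<alpha>)) \<in> borel_measurable borel"
          by (rule borel_measurable_continuous_onI)
        fix b
        have "norm (F (cvec (a + \<alpha>, b))) \<le> c * exp (\<kappa> * ((norm (a + \<alpha>))\<^sup>2 + (norm b)\<^sup>2))"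
          using growth[of "cvec (a + \<alpha>, b)"] by (simp add: norm_Pair)
        then have "norm (w a x b) * norm (F (cvec (a + \<alpha>, b)))
          \<le> (exp ((norm a)\<^sup>2 / 2 - a \<bullet> x) * exp (- (norm b)\<^sup>2 / 2)) * (c * exp (\<kappa> * ((norm (a + \<alpha>))\<^sup>2 + (norm b)\<^sup>2)))"
          unfolding nw by (rule mult_left_mono) simp
        also have "\<dots> = exp ((norm a)\<^sup>2 / 2 - a \<bullet> x) * (c * exp (\<kappa> * (norm (a + \<alpha>))\<^sup>2)) *
            (exp (- (norm b)\<^sup>2 / 2) * exp (\<kappa> * (norm b)\<^sup>2))"
          by (simp only: distrib_left exp_add mult_ac)
        also have "exp (- (norm b)\<^sup>2 / 2) * exp (\<kappa> * (norm b)\<^sup>2) = exp ((1 / 2 + \<kappa>) * (norm b)\<^sup>2) * exp (- (norm b)\<^sup>2)"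
          by (simp add: exp_add[symmetric] algebra_simps)
        finally show "norm (w a x b * F (cvec (a, b) + creal \<alpha>))
          \<le> exp ((norm a)\<^sup>2 / 2 - a \<bullet> x) * (c * exp (\<kappa> * (norm (a + \<alpha>))\<^sup>2)) * exp ((1 / 2 + \<kappa>) * (norm b)\<^sup>2) * exp (- (norm b)\<^sup>2)"
          by (simp only: shift norm_mult mult.assoc)
      qed (use \<kappa> in simp)
    next
      fix \<alpha> b v :: "real^'n"
      assume "\<alpha> \<in> ball 0 1"
      then have "norm (cvec (a, b) + creal \<alpha>) \<le> norm (cvec (a, b)) + 1"
        using norm_triangle_ineq[of "cvec (a, b)" "creal \<alpha>"] by (simp add: norm_Pair)
      then have "(norm (cvec (a, b) + creal \<alpha>))\<^sup>2 \<le> (norm (cvec (a, b)) + 1)\<^sup>2" by (intro power_mono) auto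
      also have "\<dots> \<le> (1 + e) * (norm (cvec (a, b)))\<^sup>2 + (1 + 1 / e) * 1\<^sup>2" by (rule weighted_square_add[OF e(1)])
      finally have "\<kappa>1 * (norm (cvec (a, b) + creal \<alpha>))\<^sup>2 \<le> \<kappa>1 * ((1 + e) * (norm (cvec (a, b)))\<^sup>2 + (1 + 1 / e) * 1\<^sup>2)"
        using k12 by (intro mult_left_mono) auto
      also have "\<dots> = (\<kappa>2 * (norm a)\<^sup>2 + \<kappa>1 * (1 + 1 / e)) + \<kappa>2 * (norm b)\<^sup>2"
        unfolding e(2)[symmetric] by (simp add: norm_Pair algebra_simps)
      finally have "c1 * exp (\<kappa>1 * (norm (cvec (a, b) + creal \<alpha>))\<^sup>2)
         \<le> c1 * (exp (\<kappa>2 * (norm a)\<^sup>2 + \<kappa>1 * (1 + 1 / e)) * exp (\<kappa>2 * (norm b)\<^sup>2))"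
        unfolding exp_add[symmetric] using c10 by (intro mult_left_mono) auto
      with c1[of "cvec (a, b) + creal \<alpha>"]
      have "norm (F' (cvec (a, b) + creal \<alpha>)) \<le> c1 * (exp (\<kappa>2 * (norm a)\<^sup>2 + \<kappa>1 * (1 + 1 / e)) * exp (\<kappa>2 * (norm b)\<^sup>2))"
        by (rule order_trans)
      then have "norm (creal v) * norm (F' (cvec (a, b) + creal \<alpha>))
         \<le> norm (creal v) * (c1 * (exp (\<kappa>2 * (norm a)\<^sup>2 + \<kappa>1 * (1 + 1 / e)) * exp (\<kappa>2 * (norm b)\<^sup>2)))"
        by (rule mult_left_mono) simp
      then have "norm (bil (creal v) (F' (cvec (a, b) + creal \<alpha>)))
         \<le> norm (creal v) * (c1 * (exp (\<kappa>2 * (norm a)\<^sup>2 + \<kappa>1 * (1 + 1 / e)) * exp (\<kappa>2 * (norm b)\<^sup>2)))"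
        by (rule order_trans[OF norm_bil_le])
      then have "norm (w a x b) * norm (bil (creal v) (F' (cvec (a, b) + creal \<alpha>)))
         \<le> norm (w a x b) * (norm (creal v) * (c1 * (exp (\<kappa>2 * (norm a)\<^sup>2 + \<kappa>1 * (1 + 1 / e)) * exp (\<kappa>2 * (norm b)\<^sup>2))))"
        by (rule mult_left_mono) simp
      also have "\<dots> = k * (exp (- (norm b)\<^sup>2 / 2) * exp (\<kappa>2 * (norm b)\<^sup>2)) * norm v"
        unfolding nw k_def by (simp add: norm_Pair mult_ac)
      also have "exp (- (norm b)\<^sup>2 / 2) * exp (\<kappa>2 * (norm b)\<^sup>2) = exp (- (1 / 2 - \<kappa>2) * (norm (b - 0))\<^sup>2)"
        by (simp add: exp_add[symmetric] algebra_simps)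
      finally show "norm (?f' \<alpha> b v) \<le> k * exp (- (1 / 2 - \<kappa>2) * (norm (b - 0))\<^sup>2) * norm v"
        by (simp only: norm_mult)
    qed
    then show ?thesis
      unfolding trans[of x _ a] D_def[abs_def] by (simp add: cvec_def[of "(0, 0)"] zero_vec_def[symmetric] zero_complex.ctr[symmetric])
  qed
  have diff: "(h has_derivative (\<lambda>v. Re (D 0 x v) / N x)) (at x)" for x
  proof -
    have "((\<lambda>\<alpha>. Re (of_real (N x * h (x + \<alpha>))) / N x) has_derivative (\<lambda>v. Re (D 0 x v) / N x)) (at 0)"
      by (rule bounded_linear.has_derivative[OF bounded_linear_compose[OF bounded_linear_divide bounded_linear_Re] der])
    then have "((\<lambda>\<alpha>. h (x + \<alpha>)) has_derivative (\<lambda>v. Re (D 0 x v) / N x)) (at 0)"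
      using N[of x] by simp
    then have "((\<lambda>\<alpha>. h (x + \<alpha>)) has_derivative (\<lambda>v. Re (D 0 x v) / N x)) (at (x - x))" by simp
    moreover have "((\<lambda>y. y - x) has_derivative (\<lambda>v. v)) (at x)" by (auto intro!: derivative_eq_intros)
    ultimately have "((\<lambda>y. h (x + (y - x))) has_derivative (\<lambda>v. Re (D 0 x v) / N x)) (at x)"
      by (rule has_derivative_compose[rotated])
    then show ?thesis by simp
  qed
  then show "h differentiable (at x)" by (auto simp: differentiable_def)
  \<comment> \<open>The computation with any \<open>a\<close> differentiates the same function of
    \<alpha>, so uniqueness of derivatives yields the formula on all lines at once.\<close>
  show "inversion (\<lambda>x. frechet_derivative h (at x) v) (\<lambda>z. bil (creal v) (F' z))"
    unfolding inversion_def
  proof (intro allI)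
    fix a x :: "real^'n"
    have "(h has_derivative frechet_derivative h (at x)) (at (x + 0))"
      using diff[of x] by (simp add: frechet_derivative_works[symmetric] differentiable_def) blast
    moreover have "((\<lambda>\<alpha>. x + \<alpha>) has_derivative (\<lambda>v. v)) (at 0)" by (auto intro!: derivative_eq_intros)
    ultimately have "((\<lambda>\<alpha>. h (x + \<alpha>)) has_derivative frechet_derivative h (at x)) (at 0)"
      by (rule has_derivative_compose[rotated])
    then have "((\<lambda>\<alpha>. N x * h (x + \<alpha>)) has_derivative (\<lambda>v. N x * frechet_derivative h (at x) v)) (at 0)"
      by (rule has_derivative_mult_right)
    then have "((\<lambda>\<alpha>. of_real (N x * h (x + \<alpha>)) :: complex) has_derivative (\<lambda>v. of_real (N x * frechet_derivative h (at x) v))) (at 0)"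
      by (rule bounded_linear.has_derivative[OF bounded_linear_of_real])
    from has_derivative_unique[OF this der[of x a]]
    have "of_real (N x * frechet_derivative h (at x) v) = D a x v" by metis
    then show "of_real ((2 * pi) powr (CARD('n) / 2) * exp (- (norm x)\<^sup>2 / 2) * frechet_derivative h (at x) v)
      = (LBINT b. exp (bil (cvec (a, b)) (cvec (a, b)) / 2 - bil (cvec (a, b)) (creal x)) * bil (creal v) (F' (cvec (a, b))))"
      by (simp only: N_def D_def w_def)
  qed
qed

section \<open>The Fokker-Planck flow\<close>

text \<open>Here \<open>g\<close> is a Borel representative of the initial datum; its integrability
  condition is the weighted one with the normalising constant of \<open>f_inf\<close>
  removed.\<close>

locale ou_flow =
  fixes C D :: "real^'n^'n" and g :: "real^'n \<Rightarrow> real"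
  assumes posdef: "positive_definite D" and diag: "diagonal_matrix D"
    and sym: "D = (1 / 2) *\<^sub>R (C + transpose C)"
    and meas [measurable]: "g \<in> borel_measurable borel"
    and weighted: "integrable lborel (\<lambda>y. (g y)\<^sup>2 * exp ((norm y)\<^sup>2 / 2))"
begin

definition "A t = matrix_exp ((- t) *\<^sub>R C)"
definition "T t = transpose (A t)"
definition "d = min_eigenvalue D"
text \<open>The chain rule applied to the transform of the datum composed with the transpose of
  \<open>A t\<close>, hence the complex gradient of the transform at time \<open>t\<close>.\<close>

definition "gradF t z = cmat (A t) (bargmann_grad g (cmat (T t) z))"
definition "dirF q t z = bil (creal q) (gradF t z)"

lemma d_pos: "d > 0" unfolding d_def by (rule min_eigenvalue_diagonal(1)[OF posdef diag])

text \<open>The antisymmetric part of \<open>C\<close> drops out of y . Cy, leaving y . Dy, which is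
  at least d |y|^2; then \<open>matrix_exp_decay\<close> applies with the identity matrix.\<close>

lemma norm_A: "t \<ge> 0 \<Longrightarrow> norm (A t *v x) \<le> exp (- d * t) * norm x"
proof -
  assume t: "t \<ge> 0"
  have "y \<bullet> (mat 1 *v (C *v y)) \<ge> d * (y \<bullet> (mat 1 *v y))" for y
  proof -
    have "y \<bullet> (transpose C *v y) = y \<bullet> (C *v y)"
      by (simp only: inner_matrix_transpose[of y "transpose C"] transpose_transpose inner_commute)
    then have "y \<bullet> (D *v y) = y \<bullet> (C *v y)"
      by (simp add: sym scaleR_matrix_vector_assoc[symmetric] matrix_vector_mult_add_rdistrib inner_add_right)
    then show ?thesis
      using min_eigenvalue_diagonal(2)[OF posdef diag, of y] by (simp add: d_def)
  qed
  then have "(A t *v x) \<bullet> (mat 1 *v (A t *v x)) \<le> exp (- 2 * d * t) * (x \<bullet> (mat 1 *v x))"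
    unfolding A_def using t by (intro matrix_exp_decay) (auto simp: inner_commute)
  then have "(norm (A t *v x))\<^sup>2 \<le> exp (- 2 * d * t) * (norm x)\<^sup>2"
    by (simp add: power2_norm_eq_inner)
  also have "\<dots> = (exp (- d * t) * norm x)\<^sup>2"
    by (simp add: power_mult_distrib power2_eq_square[of "exp _"] exp_add[symmetric])
  finally show ?thesis by (simp add: power2_le_iff_abs_le)
qed

lemma norm_T: "t \<ge> 0 \<Longrightarrow> norm (T t *v x) \<le> exp (- d * t) * norm x"
  unfolding T_def by (rule norm_transpose_le[OF norm_A])

lemma decay_less_1: "t > 0 \<Longrightarrow> exp (- d * t) < 1"
  using d_pos by simp

lemma exp_int: "exp_integrable g"
  by (rule exp_integrable_weighted[OF meas weighted])

lemma grad_growth: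
  assumes "\<kappa> > 1 / 2"
  obtains c where "\<And>w. norm (bargmann_grad g w) \<le> c * exp (\<kappa> * (norm w)\<^sup>2)"
proof -
  obtain c0 where "\<And>z. norm (bargmann g z) \<le> c0 * exp (1 / 2 * (norm z)\<^sup>2)"
    using bargmann_growth[OF meas weighted] by metis
  from entire_vec_growth_deriv[OF entire_vec_bargmann[OF exp_int] this _ assms] that
  show thesis by (metis half_gt_zero zero_less_one)
qed

lemma dirF_eq: "dirF q t z = (\<Sum>i\<in>UNIV. cmat (T t) (creal q) $ i * bargmann_grad g (cmat (T t) z) $ i)"
  unfolding dirF_def gradF_def bil_commute[of "creal q"] bil_cmat T_def[symmetric]
  by (simp add: bil_commute bil_def mult.commute)

lemma grad_entire: obtains H where "\<And>i. entire_vec (\<lambda>w. bargmann_grad g w $ i) (H i)"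
proof -
  have "\<exists>h. entire_vec (\<lambda>w. bargmann_grad g w $ i) h" for i
    by (rule entire_vec_bargmann_grad[OF exp_int, of i]) (rule exI)
  then have "\<exists>H. \<forall>i. entire_vec (\<lambda>w. bargmann_grad g w $ i) (H i)"
    by (intro choice) blast
  then show thesis using that by blast
qed

lemma dirF_entire: obtains H where "entire_vec (dirF q t) H"
proof -
  obtain H where H: "\<And>i. entire_vec (\<lambda>w. bargmann_grad g w $ i) (H i)"
    by (rule grad_entire) blast
  have "entire_vec (\<lambda>z. \<Sum>i\<in>UNIV. cmat (T t) (creal q) $ i * bargmann_grad g (cmat (T t) z) $ i)
    (\<lambda>z. \<Sum>i\<in>UNIV. cmat (T t) (creal q) $ i *s cmat (transpose (T t)) (H i (cmat (T t) z)))"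
    by (intro entire_vec_sum entire_vec_cmult entire_vec_cmat H)
  then show thesis using that unfolding dirF_eq[symmetric] by blast
qed

lemma dirF_continuous: "continuous_on S (dirF q t)"
  using dirF_entire[of q t] entire_vec_continuous by metis

lemma scaled_growth:
  assumes "norm (w :: complex^'n) \<le> \<theta> * norm (z :: complex^'n)" "0 \<le> \<kappa>" "0 \<le> c"
  shows "c * exp (\<kappa> * (norm w)\<^sup>2) \<le> c * exp ((\<kappa> * \<theta>\<^sup>2) * (norm z)\<^sup>2)"
proof -
  have "(norm w)\<^sup>2 \<le> (\<theta> * norm z)\<^sup>2" using assms(1) by (intro power_mono) auto
  then show ?thesis
    using assms by (intro mult_left_mono) (auto simp: power_mult_distrib mult.assoc intro!: mult_left_mono)
qed

text \<open>The gradient of the transform admits any exponent above 1/2, and composition with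
  \<open>T t\<close> multiplies it by \<theta>^2 < 1. The exponent and the constant do not depend on
  \<open>q\<close>, so one choice serves all rows of a factor \<open>Q\<close>.\<close>

lemma dirF_growth:
  assumes t: "t > 0"
  obtains c \<kappa> where "0 < \<kappa>" "\<kappa> < 1 / 2" "\<And>q z. norm (dirF q t z) \<le> norm q * c * exp (\<kappa> * (norm z)\<^sup>2)"
proof -
  define \<theta> where "\<theta> = exp (- d * t)"
  have \<theta>: "0 < \<theta>" "\<theta> < 1" using decay_less_1[OF t] by (auto simp: \<theta>_def)
  \<comment> \<open>Midpoint of 1/2 and 1/(2 \<theta>^2), the range in which both requirements
    hold.\<close>
  define \<kappa>1 where "\<kappa>1 = (1 / 2 + 1 / 2 / \<theta>\<^sup>2) / 2"
  have t2: "0 < \<theta>\<^sup>2" "\<theta>\<^sup>2 < 1" using \<theta> by (auto simp: power_less_one_iff)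
  have \<kappa>1: "\<kappa>1 > 1 / 2" "\<kappa>1 * \<theta>\<^sup>2 < 1 / 2" "0 < \<kappa>1 * \<theta>\<^sup>2"
  proof -
    define x where "x = \<theta>\<^sup>2"
    have x: "0 < x" "x < 1" using t2 by (simp_all add: x_def)
    show "\<kappa>1 > 1 / 2" "\<kappa>1 * \<theta>\<^sup>2 < 1 / 2" "0 < \<kappa>1 * \<theta>\<^sup>2"
      unfolding \<kappa>1_def x_def[symmetric] using x by (auto simp: field_simps intro!: add_pos_pos mult_pos_pos)
  qed
  obtain c where c: "\<And>w. norm (bargmann_grad g w) \<le> c * exp (\<kappa>1 * (norm w)\<^sup>2)"
    using grad_growth[OF \<kappa>1(1)] by metis
  have c0: "c \<ge> 0" using order_trans[OF norm_ge_zero c[of 0]] by simp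
  have "norm (dirF q t z) \<le> norm q * c * exp ((\<kappa>1 * \<theta>\<^sup>2) * (norm z)\<^sup>2)" for q z
  proof -
    have T: "norm (cmat (T t) u) \<le> \<theta> * norm u" for u
      unfolding \<theta>_def using t by (intro norm_cmat_le norm_T) simp
    have A: "norm (cmat (A t) u) \<le> \<theta> * norm u" for u
      unfolding \<theta>_def using t by (intro norm_cmat_le norm_A) simp
    have "norm (gradF t z) \<le> \<theta> * norm (bargmann_grad g (cmat (T t) z))"
      unfolding gradF_def by (rule A)
    also have "\<dots> \<le> 1 * norm (bargmann_grad g (cmat (T t) z))"
      using \<theta> by (intro mult_right_mono) auto
    also have "\<dots> \<le> c * exp (\<kappa>1 * (norm (cmat (T t) z))\<^sup>2)" using c by simp
    also have "\<dots> \<le> c * exp ((\<kappa>1 * \<theta>\<^sup>2) * (norm z)\<^sup>2)"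
      by (rule scaled_growth[OF T]) (use c0 \<kappa>1 in auto)
    finally have "norm q * norm (gradF t z) \<le> norm q * (c * exp ((\<kappa>1 * \<theta>\<^sup>2) * (norm z)\<^sup>2))"
      by (rule mult_left_mono) simp
    then show ?thesis
      using norm_bil_le[of "creal q" "gradF t z"] by (simp add: dirF_def norm_Pair mult.assoc)
  qed
  then show thesis using that \<kappa>1 by blast
qed

lemma dirF_fock:
  assumes t: "t > 0"
  shows "integrable lborel (\<lambda>p. (norm (dirF q t (cvec p)))\<^sup>2 * exp (- (norm p)\<^sup>2))"
    and "fock_energy (dirF q t) = ennreal (fock_real (dirF q t))" and "0 \<le> fock_real (dirF q t)"
proof -
  obtain c \<kappa> where "0 < \<kappa>" "\<kappa> < 1 / 2" and c: "\<And>q z. norm (dirF q t z) \<le> norm q * c * exp (\<kappa> * (norm z)\<^sup>2)"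
    using dirF_growth[OF t] by metis
  then show "integrable lborel (\<lambda>p. (norm (dirF q t (cvec p)))\<^sup>2 * exp (- (norm p)\<^sup>2))"
    "fock_energy (dirF q t) = ennreal (fock_real (dirF q t))" "0 \<le> fock_real (dirF q t)"
    using fock_real[OF dirF_continuous c] by auto
qed

lemma A_add: "A (s + t) = A s ** A t"
  unfolding A_def using matrix_exp_add[of "- s" "- t" C] by (simp add: algebra_simps)

text \<open>The time step acts in two places, on the value of the gradient and on its argument.
  These are the separate sources of \<lambda> and of \<open>d\<close> in the decay rate.\<close>

lemma gradF_add: "gradF (s + t) z = cmat (A s) (gradF t (cmat (T s) z))"
  by (simp add: gradF_def A_add T_def matrix_transpose_mul flip: cmat_mul)

text \<open>The Fock norm is taken with respect to the unnormalised weight \<open>exp (- |z|\<^sup>2)\<close>, of total mass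
  \<open>\<pi>\<^sup>n\<close>.\<close>

definition energy :: "real^'n^'n \<Rightarrow> real \<Rightarrow> real" where
  "energy Q t = pi powr - CARD('n) * (\<Sum>k\<in>UNIV. fock_real (dirF (row k Q) t))"

lemma energy_nonneg: "t > 0 \<Longrightarrow> energy Q t \<ge> 0"
  unfolding energy_def using dirF_fock(3) by (intro mult_nonneg_nonneg sum_nonneg) auto

text \<open>At each point z the outer \<open>A s\<close> shrinks the sum over all rows, which is the
  quadratic form of \<open>P\<close>, by \<open>exp (- 2 * m * s)\<close>; this holds for the sum
  and not row by row. The inner \<open>T s\<close> is then handled for each row by
  \<open>fock_decay\<close>, where \<open>mean\<close> supplies the zero at the origin. The case s =
  0 is separate because there \<theta> would equal 1.\<close>

lemma energy_decay:
  assumes Q: "P = transpose Q ** Q" and PC: "\<And>x. x \<bullet> (P *v (C *v x)) \<ge> m * (x \<bullet> (P *v x))"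
    and mean: "bargmann_grad g 0 = 0" and t: "t > 0" and s: "s \<ge> 0"
  shows "energy Q (t + s) \<le> exp (- 2 * (m + d) * s) * energy Q t"
proof (cases "s = 0")
  case False
  then have s: "s > 0" using s by simp
  have Pxy: "x \<bullet> (P *v y) = (Q *v x) \<bullet> (Q *v y)" for x y
    by (simp only: Q inner_matrix_transpose[of x "transpose Q"] matrix_vector_mul_assoc[symmetric] transpose_transpose)
  have rowb: "(norm (bil (creal (row k Q)) (cvec p)))\<^sup>2 = ((Q *v fst p) $ k)\<^sup>2 + ((Q *v snd p) $ k)\<^sup>2" for k p
  proof -
    have "(Q *v x) $ k = x \<bullet> row k Q" for x
      by (simp add: matrix_vector_mult_def inner_vec_def row_def mult.commute)
    then show ?thesis
      unfolding bil_commute[of "creal _"] bil_creal by (simp add: cmod_power2)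
  qed
  have rows: "(\<Sum>k\<in>UNIV. (norm (bil (creal (row k Q)) (cvec p)))\<^sup>2) = fst p \<bullet> (P *v fst p) + snd p \<bullet> (P *v snd p)" for p
    unfolding rowb Pxy by (simp add: sum.distrib inner_vec_def power2_eq_square)
  have pw: "(\<Sum>k\<in>UNIV. (norm (bil (creal (row k Q)) (cmat (A s) w)))\<^sup>2)
      \<le> exp (- 2 * m * s) * (\<Sum>k\<in>UNIV. (norm (bil (creal (row k Q)) w))\<^sup>2)" for w
  proof -
    obtain a b where w: "w = cvec (a, b)" using cvec_surj by metis
    have "(A s *v x) \<bullet> (P *v (A s *v x)) \<le> exp (- 2 * m * s) * (x \<bullet> (P *v x))" for x
      unfolding A_def by (rule matrix_exp_decay[OF _ PC]) (use s Pxy in \<open>auto simp: inner_commute\<close>)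
    from this[of a] this[of b] show ?thesis
      unfolding w cmat_cvec rows by (simp add: distrib_left)
  qed
  define \<theta> where "\<theta> = exp (- d * s)"
  have \<theta>: "0 < \<theta>" "\<theta> < 1" using decay_less_1[OF s] by (auto simp: \<theta>_def)
  obtain c \<kappa> where \<kappa>: "0 < \<kappa>" "\<kappa> < 1 / 2" and c: "\<And>q z. norm (dirF q t z) \<le> norm q * c * exp (\<kappa> * (norm z)\<^sup>2)"
    using dirF_growth[OF t] by metis
  have ccont: "continuous_on UNIV (\<lambda>z. dirF q t (cmat (T s) z))" for q
    using dirF_entire[of q t] entire_vec_cmat entire_vec_continuous by metis
  have nT: "norm (cmat (T s) z) \<le> 1 * norm z" for z
    using norm_cmat_le[OF norm_T[of s]] s \<theta> mult_right_mono[of \<theta> 1 "norm z"] by (force simp: \<theta>_def intro: order_trans)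
  have cg: "norm (dirF q t (cmat (T s) z)) \<le> norm q * c * exp (\<kappa> * 1\<^sup>2 * (norm z)\<^sup>2)" for q z
  proof -
    have "norm q * c \<ge> 0" using growth_nonneg[OF c[of q]] .
    from order_trans[OF c scaled_growth[OF nT _ this]] \<kappa> show ?thesis by simp
  qed
  have ci: "integrable lborel (\<lambda>p. (norm (dirF q t (cmat (T s) (cvec p))))\<^sup>2 * exp (- (norm p)\<^sup>2))" for q
    using fock_real(1)[OF ccont cg] \<kappa> by simp
  have ts: "t + s > 0" using t s by simp
  have "(\<Sum>k\<in>UNIV. fock_real (dirF (row k Q) (t + s)))
    = (LBINT p. \<Sum>k\<in>UNIV. (norm (dirF (row k Q) (t + s) (cvec p)))\<^sup>2 * exp (- (norm p)\<^sup>2))"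
    unfolding fock_real_def by (rule Bochner_Integration.integral_sum[symmetric]) (rule dirF_fock(1)[OF ts])
  also have "\<dots> \<le> (LBINT p. exp (- 2 * m * s) * (\<Sum>k\<in>UNIV. (norm (dirF (row k Q) t (cmat (T s) (cvec p))))\<^sup>2 * exp (- (norm p)\<^sup>2)))"
  proof (rule integral_mono)
    show "integrable lborel (\<lambda>p. \<Sum>k\<in>UNIV. (norm (dirF (row k Q) (t + s) (cvec p)))\<^sup>2 * exp (- (norm p)\<^sup>2))"
      by (intro Bochner_Integration.integrable_sum dirF_fock(1)[OF ts])
    show "integrable lborel (\<lambda>p. exp (- 2 * m * s) * (\<Sum>k\<in>UNIV. (norm (dirF (row k Q) t (cmat (T s) (cvec p))))\<^sup>2 * exp (- (norm p)\<^sup>2)))"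
      by (intro integrable_mult_right Bochner_Integration.integrable_sum ci)
    fix p
    have "dirF q (t + s) z = bil (creal q) (cmat (A s) (gradF t (cmat (T s) z)))" for q z
      using gradF_add[of s t z] by (simp add: dirF_def add.commute)
    then show "(\<Sum>k\<in>UNIV. (norm (dirF (row k Q) (t + s) (cvec p)))\<^sup>2 * exp (- (norm p)\<^sup>2))
      \<le> exp (- 2 * m * s) * (\<Sum>k\<in>UNIV. (norm (dirF (row k Q) t (cmat (T s) (cvec p))))\<^sup>2 * exp (- (norm p)\<^sup>2))"
      using mult_right_mono[OF pw[of "gradF t (cmat (T s) (cvec p))"], of "exp (- (norm p)\<^sup>2)"]
      by (simp add: dirF_def sum_distrib_right mult.assoc)
  qed
  also have "\<dots> = exp (- 2 * m * s) * (\<Sum>k\<in>UNIV. fock_real (\<lambda>z. dirF (row k Q) t (cmat (T s) z)))"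
    unfolding integral_mult_right_zero fock_real_def
    by (subst Bochner_Integration.integral_sum) (auto intro: ci)
  also have "\<dots> \<le> exp (- 2 * m * s) * (\<Sum>k\<in>UNIV. \<theta>\<^sup>2 * fock_real (dirF (row k Q) t))"
  proof (intro mult_left_mono sum_mono)
    fix k
    obtain H where "entire_vec (dirF (row k Q) t) H" using dirF_entire by metis
    moreover have "dirF (row k Q) t 0 = 0"
    proof -
      have "cmat M 0 = (0 :: complex^'n)" for M :: "real^'n^'n" by (simp add: cmat_def vec_eq_iff)
      then show ?thesis by (simp add: dirF_def gradF_def mean bil.zero_right)
    qed
    ultimately show "fock_real (\<lambda>z. dirF (row k Q) t (cmat (T s) z)) \<le> \<theta>\<^sup>2 * fock_real (dirF (row k Q) t)"
      by (rule fock_decay[OF _ _ c \<kappa> _ \<theta>]) (use norm_T[of s] s in \<open>simp add: \<theta>_def\<close>)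
  qed simp
  also have "\<dots> = exp (- 2 * (m + d) * s) * (\<Sum>k\<in>UNIV. fock_real (dirF (row k Q) t))"
  proof -
    have "exp (- 2 * m * s) * \<theta>\<^sup>2 = exp (- 2 * (m + d) * s)"
      by (simp add: \<theta>_def power2_eq_square[of "exp _"] exp_add[symmetric] algebra_simps)
    then show ?thesis by (simp only: sum_distrib_left[symmetric] mult.assoc[symmetric])
  qed
  finally have "pi powr - CARD('n) * (\<Sum>k\<in>UNIV. fock_real (dirF (row k Q) (t + s)))
     \<le> pi powr - CARD('n) * (exp (- 2 * (m + d) * s) * (\<Sum>k\<in>UNIV. fock_real (dirF (row k Q) t)))"
    by (rule mult_left_mono) simp
  then show ?thesis by (simp only: energy_def mult_ac)
qed simp

section \<open>Differentiability of the energy in time\<close>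

lemma norm_le_gaussian:
  fixes r :: real
  assumes "\<eta> > 0"
  shows "r \<le> exp (\<eta> * r\<^sup>2) / sqrt \<eta>"
proof -
  have "0 \<le> (sqrt \<eta> * r - 1)\<^sup>2" by simp
  also have "\<dots> = \<eta> * r\<^sup>2 - 2 * (sqrt \<eta> * r) + 1"
    using assms by (simp add: power2_diff power_mult_distrib)
  finally have "2 * (sqrt \<eta> * r) \<le> 1 + \<eta> * r\<^sup>2" by simp
  also have "\<dots> \<le> exp (\<eta> * r\<^sup>2)" by (rule exp_ge_add_one_self)
  finally have "sqrt \<eta> * r \<le> exp (\<eta> * r\<^sup>2)"
    using exp_gt_zero[of "\<eta> * r\<^sup>2"] by linarith
  then show ?thesis using assms by (simp add: pos_le_divide_eq mult.commute)
qed

definition "T' t = - (T t ** transpose C)"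

lemma cmat_T_deriv: "((\<lambda>t. cmat (T t) w) has_vector_derivative cmat (T' t) w) (at t)"
proof -
  have "((\<lambda>t. transpose (A t)) has_vector_derivative transpose (- (C ** A t))) (at t)"
    unfolding A_def
    by (rule bounded_linear.has_vector_derivative[OF bounded_linear_transpose matrix_exp_neg_deriv])
  then have 1: "(T has_vector_derivative T' t) (at t)"
    by (simp add: T_def[abs_def] T'_def transpose_minus matrix_transpose_mul)
  have "bounded_linear (\<lambda>M :: real^'n^'n. cmat M w)"
    unfolding linear_conv_bounded_linear[symmetric]
  proof (rule linearI)
    show "cmat (M + N) w = cmat M w + cmat N w" for M N :: "real^'n^'n"
      by (simp add: cmat_def vec_eq_iff sum.distrib algebra_simps)
    have "of_real (r * x) * z = r *\<^sub>R (of_real x * z)" for r x and z :: complex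
      by (simp add: scaleR_conv_of_real)
    then show "cmat (r *\<^sub>R M) w = r *\<^sub>R cmat M w" for r and M :: "real^'n^'n"
      by (simp only: cmat_def vec_eq_iff vector_scaleR_component vec_lambda_beta scaleR_sum_right real_scaleR_def)
        simp
  qed
  from bounded_linear.has_vector_derivative[OF this 1] show ?thesis .
qed

text \<open>Differentiation under the integral. For t within t0 / 2 of t0 the norm of
  \<open>T t\<close> is at most a fixed \<theta> < 1, so the function and its time derivative have
  Gaussian bounds with a common exponent \<sigma> < 1/2; the extra factor \<open>norm z\<close> from
  differentiating the argument is absorbed by a slight further increase.\<close>

lemma dirF_fock_differentiable:
  assumes t0: "t0 > 0"
  shows "(\<lambda>t. fock_real (dirF q t)) differentiable (at t0)"
proof -
  obtain H where H: "\<And>i. entire_vec (\<lambda>w. bargmann_grad g w $ i) (H i)"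
    by (rule grad_entire) blast
  define r where "r = t0 / 2"
  have r: "r > 0" using t0 by (simp add: r_def)
  have tr: "t \<ge> r" "t > 0" if "t \<in> ball t0 r" for t
    using that t0 unfolding r_def mem_ball dist_real_def by (auto simp: abs_if split: if_splits)
  define \<theta> where "\<theta> = exp (- d * r)"
  have \<theta>: "0 < \<theta>" "\<theta> < 1" using decay_less_1[OF r] by (auto simp: \<theta>_def)
  have t2: "0 < \<theta>\<^sup>2" "\<theta>\<^sup>2 < 1" using \<theta> by (auto simp: power_less_one_iff)
  \<comment> \<open>The two points dividing the interval from 1/2 to 1/(2 \<theta>^2) into thirds:
    \<kappa>1 bounds the gradient, \<kappa>2 its derivatives \<open>H\<close>, and
    \<open>\<kappa>2 * \<theta>\<^sup>2\<close> is still below 1/2.\<close>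
  define \<kappa>1 where "\<kappa>1 = (2 / 2 + 1 / 2 / \<theta>\<^sup>2) / 3"
  define \<kappa>2 where "\<kappa>2 = (1 / 2 + 2 / 2 / \<theta>\<^sup>2) / 3"
  have \<kappa>: "\<kappa>1 > 1 / 2" "\<kappa>1 < \<kappa>2" "\<kappa>2 * \<theta>\<^sup>2 < 1 / 2" "0 < \<kappa>1"
  proof -
    define x where "x = \<theta>\<^sup>2"
    have x: "0 < x" "x < 1" using t2 by (simp_all add: x_def)
    show "\<kappa>1 > 1 / 2" "\<kappa>1 < \<kappa>2" "\<kappa>2 * \<theta>\<^sup>2 < 1 / 2" "0 < \<kappa>1"
      unfolding \<kappa>1_def \<kappa>2_def x_def[symmetric] using x by (auto simp: field_simps add_pos_pos)
  qed
  define \<sigma> where "\<sigma> = \<kappa>2 * \<theta>\<^sup>2"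
  have \<sigma>: "0 < \<sigma>" "\<sigma> < 1 / 2" using \<kappa> t2 by (auto simp: \<sigma>_def)
  obtain c1 where c1: "\<And>w. norm (bargmann_grad g w) \<le> c1 * exp (\<kappa>1 * (norm w)\<^sup>2)"
    using grad_growth[OF \<kappa>(1)] by metis
  have c10: "c1 \<ge> 0" using order_trans[OF norm_ge_zero c1[of 0]] by simp
  have "\<exists>c. \<forall>w. norm (H i w) \<le> c * exp (\<kappa>2 * (norm w)\<^sup>2)" for i
  proof -
    have "norm (bargmann_grad g w $ i) \<le> c1 * exp (\<kappa>1 * (norm w)\<^sup>2)" for w
      using c1[of w] Finite_Cartesian_Product.norm_nth_le[of "bargmann_grad g w" i] by linarith
    then show ?thesis using entire_vec_growth_deriv[OF H _ \<kappa>(4) \<kappa>(2)] by metis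
  qed
  then obtain cH where cH: "\<And>i w. norm (H i w) \<le> cH i * exp (\<kappa>2 * (norm w)\<^sup>2)" by metis
  define c2 where "c2 = (\<Sum>i\<in>UNIV. cH i)"
  have cH0: "cH i \<ge> 0" for i using order_trans[OF norm_ge_zero cH[of i 0]] by simp
  define L where "L = onorm ((*v) (transpose C))"
  have L: "norm (transpose C *v x) \<le> L * norm x" for x
    unfolding L_def by (rule onorm[OF matrix_vector_mul_bounded_linear])
  have L0: "L \<ge> 0" unfolding L_def by (rule onorm_pos_le[OF matrix_vector_mul_bounded_linear])
  have nT: "norm (cmat (T t) u) \<le> \<theta> * norm u" if "t \<in> ball t0 r" for t u
  proof (rule norm_cmat_le)
    fix x
    have "norm (T t *v x) \<le> exp (- d * t) * norm x" using tr[OF that] by (intro norm_T) simp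
    also have "\<dots> \<le> \<theta> * norm x"
      unfolding \<theta>_def using tr[OF that] d_pos by (intro mult_right_mono) auto
    finally show "norm (T t *v x) \<le> \<theta> * norm x" .
  qed
  have nT': "norm (cmat (T' t) u) \<le> L * norm u" if "t \<in> ball t0 r" for t u
  proof -
    have "cmat (T' t) u = - cmat (T t) (cmat (transpose C) u)"
      unfolding cmat_mul T'_def by (simp add: cmat_def vec_eq_iff sum_negf)
    then have "norm (cmat (T' t) u) \<le> \<theta> * norm (cmat (transpose C) u)"
      using nT[OF that] by simp
    also have "\<dots> \<le> 1 * (L * norm u)"
      using \<theta> by (intro mult_mono norm_cmat_le L) auto
    finally show ?thesis by simp
  qed
  \<comment> \<open>The product rule: \<open>T t\<close> moves both the direction \<open>q\<close>
    and the argument \<open>z\<close>, and the second contribution brings in the derivatives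
    \<open>H i\<close>.\<close>
  define G' where "G' t z = (\<Sum>i\<in>UNIV. cmat (T' t) (creal q) $ i * bargmann_grad g (cmat (T t) z) $ i
      + cmat (T t) (creal q) $ i * bil (cmat (T' t) z) (H i (cmat (T t) z)))" for t z
  have G': "((\<lambda>t. dirF q t z) has_vector_derivative G' t z) (at t)" for t z
  proof -
    have 1: "((\<lambda>t. bargmann_grad g (cmat (T t) z) $ i) has_vector_derivative bil (cmat (T' t) z) (H i (cmat (T t) z))) (at t)" for i
    proof -
      have "((\<lambda>t. cmat (T t) z) has_derivative (\<lambda>h. h *\<^sub>R cmat (T' t) z)) (at t)"
        using cmat_T_deriv[of z t] by (simp add: has_vector_derivative_def)
      from entire_vec_compose[OF H this] show ?thesis
        by (simp add: has_vector_derivative_def bil.scaleR_left)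
    qed
    have 2: "((\<lambda>t. cmat (T t) (creal q) $ i) has_vector_derivative cmat (T' t) (creal q) $ i) (at t)" for i
      by (rule bounded_linear.has_vector_derivative[OF bounded_linear_vec_nth cmat_T_deriv])
    have "((\<lambda>t. \<Sum>i\<in>UNIV. cmat (T t) (creal q) $ i * bargmann_grad g (cmat (T t) z) $ i) has_vector_derivative
      (\<Sum>i\<in>UNIV. cmat (T t) (creal q) $ i * bil (cmat (T' t) z) (H i (cmat (T t) z))
         + cmat (T' t) (creal q) $ i * bargmann_grad g (cmat (T t) z) $ i)) (at t)"
      by (intro has_vector_derivative_sum has_vector_derivative_mult 1 2)
    then show ?thesis by (simp add: dirF_eq[symmetric] G'_def add.commute)
  qed
  have nq: "norm (creal q) = norm q" by (simp add: norm_Pair)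
  have nN: "norm (bargmann_grad g (cmat (T t) z)) \<le> c1 * exp (\<sigma> * (norm z)\<^sup>2)" if "t \<in> ball t0 r" for t z
  proof -
    have "c1 * exp (\<kappa>1 * (norm (cmat (T t) z))\<^sup>2) \<le> c1 * exp ((\<kappa>1 * \<theta>\<^sup>2) * (norm z)\<^sup>2)"
      using nT[OF that] \<kappa> c10 by (intro scaled_growth) auto
    also have "\<dots> \<le> c1 * exp (\<sigma> * (norm z)\<^sup>2)"
      using \<kappa> c10 by (intro mult_left_mono) (auto simp: \<sigma>_def intro!: mult_right_mono)
    finally show ?thesis using c1[of "cmat (T t) z"] by linarith
  qed
  have nH: "norm (H i (cmat (T t) z)) \<le> cH i * exp (\<sigma> * (norm z)\<^sup>2)" if "t \<in> ball t0 r" for t z i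
  proof -
    have "cH i * exp (\<kappa>2 * (norm (cmat (T t) z))\<^sup>2) \<le> cH i * exp (\<sigma> * (norm z)\<^sup>2)"
      unfolding \<sigma>_def using nT[OF that] \<kappa> cH0 by (intro scaled_growth) auto
    then show ?thesis using cH[of i "cmat (T t) z"] by linarith
  qed
  define n where "n = real CARD('n)"
  define B1 where "B1 = n * (norm q * c1)"
  define B2 where "B2 = n * (L * norm q * c1)"
  define B3 where "B3 = norm q * L * c2"
  have c20: "c2 \<ge> 0" unfolding c2_def by (intro sum_nonneg cH0)
  have B0: "B1 \<ge> 0" "B2 \<ge> 0" "B3 \<ge> 0" using c10 c20 L0 by (auto simp: B1_def B2_def B3_def n_def)
  have nG: "norm (dirF q t z) \<le> B1 * exp (\<sigma> * (norm z)\<^sup>2)" if t: "t \<in> ball t0 r" for t z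
  proof -
    have "norm (dirF q t z) \<le> (\<Sum>i\<in>(UNIV :: 'n set). norm q * (c1 * exp (\<sigma> * (norm z)\<^sup>2)))"
      unfolding dirF_eq
    proof (rule sum_norm_le)
      fix i
      have "norm (cmat (T t) (creal q) $ i) \<le> norm q"
        using Finite_Cartesian_Product.norm_nth_le[of "cmat (T t) (creal q)" i] nT[OF t, of "creal q"]
          mult_right_mono[of \<theta> 1 "norm q"] \<theta>
        unfolding nq by simp
      moreover have "norm (bargmann_grad g (cmat (T t) z) $ i) \<le> c1 * exp (\<sigma> * (norm z)\<^sup>2)"
        using Finite_Cartesian_Product.norm_nth_le[of "bargmann_grad g (cmat (T t) z)" i] nN[OF t, of z] by linarith
      ultimately show "norm (cmat (T t) (creal q) $ i * bargmann_grad g (cmat (T t) z) $ i) \<le> norm q * (c1 * exp (\<sigma> * (norm z)\<^sup>2))"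
        unfolding norm_mult by (intro mult_mono) auto
    qed
    then show ?thesis by (simp add: B1_def n_def mult.assoc)
  qed
  have nG': "norm (G' t z) \<le> (B2 + B3 * norm z) * exp (\<sigma> * (norm z)\<^sup>2)" if t: "t \<in> ball t0 r" for t z
  proof -
    have "norm (G' t z) \<le> (\<Sum>i\<in>(UNIV :: 'n set). L * norm q * (c1 * exp (\<sigma> * (norm z)\<^sup>2))
        + norm q * (L * norm z * (cH i * exp (\<sigma> * (norm z)\<^sup>2))))"
      unfolding G'_def
    proof (rule sum_norm_le)
      fix i
      have a: "norm (cmat (T t) (creal q) $ i) \<le> norm q"
        using Finite_Cartesian_Product.norm_nth_le[of "cmat (T t) (creal q)" i] nT[OF t, of "creal q"]
          mult_right_mono[of \<theta> 1 "norm q"] \<theta>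
        unfolding nq by simp
      have b: "norm (bargmann_grad g (cmat (T t) z) $ i) \<le> c1 * exp (\<sigma> * (norm z)\<^sup>2)"
        using Finite_Cartesian_Product.norm_nth_le[of "bargmann_grad g (cmat (T t) z)" i] nN[OF t, of z] by linarith
      have c: "norm (cmat (T' t) (creal q) $ i) \<le> L * norm q"
        using Finite_Cartesian_Product.norm_nth_le[of "cmat (T' t) (creal q)" i] nT'[OF t, of "creal q"] unfolding nq by linarith
      have e: "norm (bil (cmat (T' t) z) (H i (cmat (T t) z))) \<le> L * norm z * (cH i * exp (\<sigma> * (norm z)\<^sup>2))"
        by (rule order_trans[OF norm_bil_le], intro mult_mono nT'[OF t] nH[OF t]) (use L0 in auto)
      show "norm (cmat (T' t) (creal q) $ i * bargmann_grad g (cmat (T t) z) $ i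
        + cmat (T t) (creal q) $ i * bil (cmat (T' t) z) (H i (cmat (T t) z)))
        \<le> L * norm q * (c1 * exp (\<sigma> * (norm z)\<^sup>2)) + norm q * (L * norm z * (cH i * exp (\<sigma> * (norm z)\<^sup>2)))"
        by (rule order_trans[OF norm_triangle_ineq], unfold norm_mult, intro add_mono mult_mono a b c e) (use L0 in auto)
    qed
    also have "\<dots> = (B2 + B3 * norm z) * exp (\<sigma> * (norm z)\<^sup>2)"
      by (simp add: sum.distrib B2_def B3_def n_def c2_def sum_distrib_left sum_distrib_right algebra_simps)
    finally show ?thesis .
  qed
  \<comment> \<open>Half of the room left between 2 \<sigma> and the exponent 1 of the weight,
    reserved for the linear factor \<open>norm p\<close>.\<close>
  define \<eta> where "\<eta> = (1 - 2 * \<sigma>) / 2"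
  have \<eta>: "\<eta> > 0" "2 * \<sigma> + \<eta> < 1" using \<sigma> by (auto simp: \<eta>_def field_simps)
  define B where "B = 2 * (B1 * (B2 + B3 / sqrt \<eta>))"
  define f where "f t p = (norm (dirF q t (cvec p)))\<^sup>2 * exp (- (norm p)\<^sup>2)" for t p
  have "((\<lambda>t. LBINT p. f t p) has_derivative (\<lambda>h. LBINT p. h * (2 * (dirF q t0 (cvec p) \<bullet> G' t0 (cvec p)) * exp (- (norm p)\<^sup>2)))) (at t0)"
  proof (rule has_derivative_integral(2)[where f' = "\<lambda>t p h. h * (2 * (dirF q t (cvec p) \<bullet> G' t (cvec p)) * exp (- (norm p)\<^sup>2))"])
    show "r > 0" by fact
    show "integrable lborel (f t)" if "t \<in> ball t0 r" for t
      unfolding f_def by (rule dirF_fock(1)[OF tr(2)[OF that]])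
    show "((\<lambda>t. f t p) has_derivative (\<lambda>h. h * (2 * (dirF q t (cvec p) \<bullet> G' t (cvec p)) * exp (- (norm p)\<^sup>2)))) (at t)" for t p
    proof -
      have "((\<lambda>t. dirF q t (cvec p) \<bullet> dirF q t (cvec p)) has_vector_derivative
         dirF q t (cvec p) \<bullet> G' t (cvec p) + G' t (cvec p) \<bullet> dirF q t (cvec p)) (at t)"
        by (rule bounded_bilinear.has_vector_derivative[OF bounded_bilinear_inner G' G'])
      then have "((\<lambda>t. dirF q t (cvec p) \<bullet> dirF q t (cvec p)) has_real_derivative 2 * (dirF q t (cvec p) \<bullet> G' t (cvec p))) (at t)"
        by (simp add: has_real_derivative_iff_has_vector_derivative inner_commute)
      from DERIV_cmult_right[OF this, of "exp (- (norm p)\<^sup>2)"] show ?thesis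
        by (simp add: f_def power2_norm_eq_inner has_field_derivative_def mult_commute_abs)
    qed
    show "integrable lborel (\<lambda>p::(real^'n) \<times> (real^'n). B * exp ((2 * \<sigma> + \<eta>) * (norm p)\<^sup>2) * exp (- (norm p)\<^sup>2))"
      using B0 \<eta> by (intro gaussian_growth_integrable[OF _ \<eta>(2), of _ B]) (auto simp: B_def)
    fix t h :: real and p :: "(real^'n) \<times> (real^'n)"
    assume t: "t \<in> ball t0 r"
    have E1: "exp (\<sigma> * (norm p)\<^sup>2) * exp (\<sigma> * (norm p)\<^sup>2) * exp (\<eta> * (norm p)\<^sup>2) = exp ((2 * \<sigma> + \<eta>) * (norm p)\<^sup>2)"
      by (simp add: exp_add[symmetric] algebra_simps)
    have "\<bar>dirF q t (cvec p) \<bullet> G' t (cvec p)\<bar> \<le> norm (dirF q t (cvec p)) * norm (G' t (cvec p))"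
      by (rule Cauchy_Schwarz_ineq2)
    also have "\<dots> \<le> (B1 * exp (\<sigma> * (norm p)\<^sup>2)) * ((B2 + B3 * norm p) * exp (\<sigma> * (norm p)\<^sup>2))"
      using nG[OF t, of "cvec p"] nG'[OF t, of "cvec p"] B0 by (intro mult_mono) auto
    also have "\<dots> \<le> (B1 * exp (\<sigma> * (norm p)\<^sup>2)) * (((B2 + B3 / sqrt \<eta>) * exp (\<eta> * (norm p)\<^sup>2)) * exp (\<sigma> * (norm p)\<^sup>2))"
    proof -
      have "B2 * 1 \<le> B2 * exp (\<eta> * (norm p)\<^sup>2)" using B0 \<eta> by (intro mult_left_mono) auto
      moreover have "B3 * norm p \<le> B3 * (exp (\<eta> * (norm p)\<^sup>2) / sqrt \<eta>)"
        using B0 by (intro mult_left_mono norm_le_gaussian[OF \<eta>(1)]) auto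
      ultimately have "B2 + B3 * norm p \<le> (B2 + B3 / sqrt \<eta>) * exp (\<eta> * (norm p)\<^sup>2)"
        by (simp add: distrib_right)
      then show ?thesis using B0 by (intro mult_left_mono mult_right_mono) auto
    qed
    also have "\<dots> = B / 2 * exp ((2 * \<sigma> + \<eta>) * (norm p)\<^sup>2)"
      unfolding E1[symmetric] B_def by simp
    finally have "\<bar>h\<bar> * (2 * \<bar>dirF q t (cvec p) \<bullet> G' t (cvec p)\<bar> * exp (- (norm p)\<^sup>2))
      \<le> \<bar>h\<bar> * (2 * (B / 2 * exp ((2 * \<sigma> + \<eta>) * (norm p)\<^sup>2)) * exp (- (norm p)\<^sup>2))"
      by (intro mult_left_mono mult_right_mono) auto
    then show "norm (h * (2 * (dirF q t (cvec p) \<bullet> G' t (cvec p)) * exp (- (norm p)\<^sup>2)))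
      \<le> B * exp ((2 * \<sigma> + \<eta>) * (norm p)\<^sup>2) * exp (- (norm p)\<^sup>2) * norm h"
      by (simp add: abs_mult mult_ac)
  qed
  then show ?thesis
    by (auto simp: differentiable_def fock_real_def[abs_def] f_def)
qed

lemma energy_differentiable:
  assumes "t > 0"
  shows "energy Q differentiable (at t)"
proof -
  have "(\<lambda>t. \<Sum>k\<in>UNIV. fock_real (dirF (row k Q) t)) differentiable (at t)"
    by (rule differentiable_sum) (auto intro: dirF_fock_differentiable[OF assms])
  then show ?thesis
    unfolding energy_def[abs_def] by (rule differentiable_mult[OF differentiable_const])
qed

lemma energy_deriv_le:
  assumes Q: "P = transpose Q ** Q" and PC: "\<And>x. x \<bullet> (P *v (C *v x)) \<ge> m * (x \<bullet> (P *v x))"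
    and mean: "bargmann_grad g 0 = 0" and t: "t > 0"
  obtains I' where "(energy Q has_real_derivative I') (at t)" "I' \<le> - 2 * (m + d) * energy Q t"
proof -
  obtain I' where I': "(energy Q has_real_derivative I') (at t)"
    using energy_differentiable[OF t, of Q] real_differentiable_def by blast
  define \<mu> where "\<mu> = 2 * (m + d)"
  have K: "((\<lambda>s. exp (\<mu> * (s - t)) * energy Q s) has_real_derivative \<mu> * energy Q t + I') (at t)"
    by (auto intro!: derivative_eq_intros I')
  have "\<mu> * energy Q t + I' \<le> 0"
  proof (rule ccontr)
    assume "\<not> ?thesis"
    then obtain e where e: "e > 0" "\<And>h. 0 < h \<Longrightarrow> h < e \<Longrightarrow>
       exp (\<mu> * (t - t)) * energy Q t < exp (\<mu> * (t + h - t)) * energy Q (t + h)"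
      using DERIV_pos_inc_right[OF K] by force
    define h where "h = e / 2"
    have h: "0 < h" "h < e" using e by (auto simp: h_def)
    have "exp (\<mu> * h) * energy Q (t + h) \<le> exp (\<mu> * h) * (exp (- 2 * (m + d) * h) * energy Q t)"
      using h by (intro mult_left_mono energy_decay[OF Q PC mean t]) auto
    also have "\<dots> = exp (\<mu> * h + - 2 * (m + d) * h) * energy Q t"
      by (simp only: exp_add mult.assoc)
    also have "\<mu> * h + - 2 * (m + d) * h = 0"
      by (simp add: \<mu>_def algebra_simps)
    finally have "exp (\<mu> * h) * energy Q (t + h) \<le> energy Q t" by simp
    then have "\<not> energy Q t < exp (\<mu> * h) * energy Q (t + h)" by simp
    then show False using e(2)[OF h] by simp
  qed
  then have "I' \<le> - 2 * (m + d) * energy Q t"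
    by (simp add: \<mu>_def algebra_simps)
  then show thesis by (rule that[OF I'])
qed

text \<open>With P = Q^T Q the integrand is the sum of squares of the components of \<open>Q\<close>
  applied to the gradient of u / f_inf. Each component is a derivative along a row of
  \<open>Q\<close>, so \<open>inversion_gradient\<close> pairs it with \<open>dirF\<close>, and the
  isometry converts its Gaussian norm into a Fock norm.\<close>

lemma fisher_information_eq:
  assumes t: "t > 0" and Q: "P = transpose Q ** Q"
    and inv: "inversion (\<lambda>x. u x / f_inf x) (\<lambda>z. bargmann g (cmat (T t) z))"
  shows "fisher_information P u = ennreal (energy Q t)"
proof -
  define h where "h = (\<lambda>x. u x / f_inf x)"
  define \<theta> where "\<theta> = exp (- d * t)"
  have \<theta>: "0 < \<theta>" "\<theta> < 1" using decay_less_1[OF t] by (auto simp: \<theta>_def)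
  obtain c where c: "\<And>z. norm (bargmann g z) \<le> c * exp (1 / 2 * (norm z)\<^sup>2)"
    using bargmann_growth[OF meas weighted] by metis
  have c0: "c \<ge> 0" using c by (rule growth_nonneg)
  have E: "entire_vec (\<lambda>z. bargmann g (cmat (T t) z)) (gradF t)"
    using entire_vec_cmat[OF entire_vec_bargmann[OF exp_int], of "T t"]
    by (simp add: gradF_def[abs_def] T_def)
  have growth: "norm (bargmann g (cmat (T t) z)) \<le> c * exp ((1 / 2 * \<theta>\<^sup>2) * (norm z)\<^sup>2)" for z
  proof -
    have "norm (cmat (T t) z) \<le> \<theta> * norm z"
      unfolding \<theta>_def using t by (intro norm_cmat_le norm_T) simp
    from scaled_growth[OF this _ c0, of "1 / 2"] c[of "cmat (T t) z"] show ?thesis by linarith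
  qed
  have \<kappa>: "0 < 1 / 2 * \<theta>\<^sup>2" "1 / 2 * \<theta>\<^sup>2 < 1 / 2" using \<theta> by (auto simp: power_less_one_iff)
  note grad = inversion_gradient[OF inv[folded h_def] E growth \<kappa>]
  have fd: "(h has_derivative frechet_derivative h (at x)) (at x)" for x
    using grad(1) frechet_derivative_works by blast
  have Qk: "(Q *v gradient h x) $ k = frechet_derivative h (at x) (row k Q)" for x k
  proof -
    have lin: "linear (frechet_derivative h (at x))"
      using fd has_derivative_linear by blast
    have "row k Q = (\<Sum>i\<in>UNIV. Q $ k $ i *\<^sub>R axis i 1)"
      using basis_expansion[of "row k Q"] by (simp add: row_def scalar_mult_eq_scaleR)
    then have "frechet_derivative h (at x) (row k Q) = (\<Sum>i\<in>UNIV. Q $ k $ i * frechet_derivative h (at x) (axis i 1))"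
      by (simp add: linear_sum[OF lin] linear_scale[OF lin])
    then show ?thesis by (simp add: matrix_vector_mult_def gradient_def)
  qed
  have invk: "inversion (\<lambda>x. (Q *v gradient h x) $ k) (dirF (row k Q) t)" for k
    unfolding Qk dirF_def by (rule grad(2))
  have [measurable]: "(\<lambda>x. (Q *v gradient h x) $ k) \<in> borel_measurable borel" for k
    by (rule inversion_measurable[OF invk dirF_continuous])
  have [measurable]: "f_inf \<in> borel_measurable borel"
    unfolding f_inf_def by measurable
  have f0: "f_inf x > 0" for x :: "real^'n" by (simp add: f_inf_def)
  have iso: "(\<integral>\<^sup>+x. ennreal (((Q *v gradient h x) $ k)\<^sup>2 * f_inf x) \<partial>lborel)
      = ennreal (pi powr - CARD('n) * fock_real (dirF (row k Q) t))" for k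
  proof -
    obtain c \<kappa> where "0 < \<kappa>" "\<kappa> < 1 / 2" and c: "\<And>q z. norm (dirF q t z) \<le> norm q * c * exp (\<kappa> * (norm z)\<^sup>2)"
      using dirF_growth[OF t] by metis
    then show ?thesis
      using inversion_isometry[OF invk dirF_continuous c] dirF_fock(2,3)[OF t] by (simp add: ennreal_mult)
  qed
  have quad: "v \<bullet> (P *v v) = (\<Sum>k\<in>UNIV. ((Q *v v) $ k)\<^sup>2)" for v
  proof -
    have "v \<bullet> (P *v v) = (Q *v v) \<bullet> (Q *v v)"
      by (simp only: Q inner_matrix_transpose[of v "transpose Q"] matrix_vector_mul_assoc[symmetric] transpose_transpose)
    then show ?thesis by (simp add: inner_vec_def power2_eq_square)
  qed
  have "fisher_information P u = (\<integral>\<^sup>+x. (\<Sum>k\<in>UNIV. ennreal (((Q *v gradient h x) $ k)\<^sup>2 * f_inf x)) \<partial>lebesgue)"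
    unfolding fisher_information_def Let_def h_def[symmetric] quad
    using f0 by (intro nn_integral_cong) (simp add: sum_distrib_right less_imp_le)
  also have "\<dots> = (\<integral>\<^sup>+x. (\<Sum>k\<in>UNIV. ennreal (((Q *v gradient h x) $ k)\<^sup>2 * f_inf x)) \<partial>lborel)"
    by (rule nn_integral_completion) measurable
  also have "\<dots> = (\<Sum>k\<in>UNIV. \<integral>\<^sup>+x. ennreal (((Q *v gradient h x) $ k)\<^sup>2 * f_inf x) \<partial>lborel)"
    by (rule nn_integral_sum) measurable
  also have "\<dots> = ennreal (energy Q t)"
    unfolding iso energy_def sum_distrib_left using dirF_fock(3)[OF t] by (intro sum_ennreal) simp
  finally show ?thesis .
qed

end

section \<open>From the initial datum to the theorem\<close>

lemma gradient_f_inf: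
  fixes x :: "real^'n"
  shows "gradient f_inf x $ i = - (x $ i) * f_inf x"
proof -
  define k where "k = (2 * pi) powr (- real CARD('n) / 2)"
  have "((\<lambda>x. k * exp (- (x \<bullet> x) / 2)) has_derivative (\<lambda>v. k * (exp (- (x \<bullet> x) / 2) * (- (x \<bullet> v + v \<bullet> x) / 2)))) (at x)"
    by (auto intro!: derivative_eq_intros simp: inner_commute fun_eq_iff)
  then have "((f_inf :: real^'n \<Rightarrow> real) has_derivative (\<lambda>v. - (x \<bullet> v) * f_inf x)) (at x)"
    by (simp add: f_inf_def[abs_def] k_def power2_norm_eq_inner inner_commute mult_ac)
  from frechet_derivative_at[OF this, symmetric] show ?thesis
    by (simp add: gradient_def inner_axis)
qed

text \<open>At the origin the Gaussian factor is 1 and the term with \<open>w $ i\<close> vanishes,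
  so what remains of the gradient are the first moments of \<open>g\<close>.\<close>

lemma bargmann_grad_0:
  fixes g :: "real^'n \<Rightarrow> real"
  assumes "\<And>i. (LBINT y. y $ i * g y) = 0"
  shows "bargmann_grad g 0 = 0"
proof -
  have "laplace (\<lambda>y. y $ i * g y) 0 = 0" for i
    using assms[of i] unfolding laplace_def
    by (simp add: bil.zero_left integral_complex_of_real del: of_real_mult)
  then show ?thesis by (simp add: bargmann_grad_def bargmann_def vec_eq_iff)
qed

lemma lebesgue_integral_AE_eq:
  fixes f h :: "'a::euclidean_space \<Rightarrow> real"
  assumes h: "h \<in> borel_measurable borel" and f: "f \<in> borel_measurable lebesgue"
    and eq: "AE x in lborel. f x = h x"
  shows "(LINT x|lebesgue. f x) = (LBINT x. h x)" and "integrable lebesgue f \<longleftrightarrow> integrable lborel h"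
proof -
  have h': "h \<in> borel_measurable lborel" "h \<in> borel_measurable lebesgue"
    using h by (auto intro: measurable_completion)
  have "(LINT x|lebesgue. f x) = (LINT x|lebesgue. h x)"
    by (rule integral_cong_AE[OF f h'(2) AE_completion[OF eq]])
  then show "(LINT x|lebesgue. f x) = (LBINT x. h x)"
    by (simp add: integral_completion[OF h'(1)])
  have "integrable lebesgue f \<longleftrightarrow> integrable lebesgue h"
    by (rule integrable_cong_AE[OF f h'(2) AE_completion[OF eq]])
  then show "integrable lebesgue f \<longleftrightarrow> integrable lborel h"
    by (simp add: integrable_completion[OF h'(1)])
qed

lemma f_inf_pos: "f_inf x > 0"
  by (simp add: f_inf_def)

lemma borel_measurable_f_inf [measurable]: "f_inf \<in> borel_measurable borel"
  unfolding f_inf_def[abs_def] by measurable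

text \<open>The datum is only Lebesgue measurable, while the Fubini arguments work with Borel
  functions; altering it on a null set changes none of the integrals. Division by
  \<open>f_inf\<close> is multiplication by \<open>exp ((norm x)\<^sup>2 / 2)\<close> up to the
  constant \<open>k\<close>.\<close>

lemma weighted_L2_borel_representative:
  fixes g0 :: "real^'n \<Rightarrow> real"
  assumes "weighted_L2 g0"
  obtains h where "h \<in> borel_measurable borel" "AE x in lborel. g0 x = h x"
    "integrable lborel (\<lambda>y. (h y)\<^sup>2 * exp ((norm y)\<^sup>2 / 2))"
proof -
  have g0 [measurable]: "g0 \<in> borel_measurable lebesgue" and int: "integrable lebesgue (\<lambda>x. (g0 x)\<^sup>2 / f_inf x)"
    using assms by (auto simp: weighted_L2_def)
  obtain h where h: "h \<in> borel_measurable lborel" "AE x in lborel. g0 x = h x"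
    using completion_ex_borel_measurable_real[OF g0] by blast
  have [measurable]: "h \<in> borel_measurable borel" using h(1) by simp
  define k where "k = (2 * pi) powr (- real CARD('n) / 2)"
  have k: "k > 0" by (simp add: k_def)
  have "integrable lborel (\<lambda>x. (h x)\<^sup>2 / f_inf x)"
    using int h(2) by (subst lebesgue_integral_AE_eq(2)[symmetric, of _ "\<lambda>x. (g0 x)\<^sup>2 / f_inf x"]) (auto intro: borel_measurable_integrable)
  then have "integrable lborel (\<lambda>x. k * ((h x)\<^sup>2 / f_inf x))" by (intro integrable_mult_right)
  moreover have "k * ((h x)\<^sup>2 / f_inf x) = (h x)\<^sup>2 * exp ((norm x)\<^sup>2 / 2)" for x
  proof -
    have "f_inf x = k * exp (- ((norm x)\<^sup>2 / 2))" by (simp add: f_inf_def k_def)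
    then show ?thesis using k f_inf_pos[of x] by (auto simp: exp_minus field_simps)
  qed
  ultimately show thesis using that[of h] h(2) by simp
qed

text \<open>The closed form of the covariance identifies the transition kernel with Mehler's kernel
  for \<open>A t\<close>, so \<open>mehler_inversion\<close> applies with \<theta> = exp (- d t) <
  1.\<close>

lemma (in ou_flow) fokker_planck_fisher_information:
  assumes g0: "g0 \<in> borel_measurable lebesgue" "AE y in lborel. g0 y = g y"
    and t: "t > 0" and Q: "P = transpose Q ** Q"
  shows "fisher_information P (fokker_planck_solution C D g0 t) = ennreal (energy Q t)"
proof (rule fisher_information_eq[OF t Q])
  have W: "W_matrix C D t = mat 1 - A t ** transpose (A t)"
    unfolding A_def by (rule W_matrix_eq[OF sym less_imp_le[OF t]])
  have "fokker_planck_solution C D g0 t x = 1 / ((2 * pi) powr (CARD('n) / 2) * sqrt (det (W_matrix C D t))) *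
      (LBINT y. exp (- (1 / 2) * ((x - A t *v y) \<bullet> (matrix_inv (W_matrix C D t) *v (x - A t *v y)))) * g y)" for x
  proof -
    define k where "k = (\<lambda>y. exp (- (1 / 2) * ((x - A t *v y) \<bullet> (matrix_inv (W_matrix C D t) *v (x - A t *v y)))))"
    have "continuous_on UNIV k" unfolding k_def
      by (intro continuous_intros bounded_linear.continuous_on[OF matrix_vector_mul_bounded_linear])
    then have k [measurable]: "k \<in> borel_measurable borel" by (rule borel_measurable_continuous_onI)
    then have [measurable]: "k \<in> borel_measurable lebesgue" by (simp add: measurable_completion)
    note g0(1) [measurable]
    have "(LINT y|lebesgue. k y * g0 y) = (LBINT y. k y * g y)"
      using g0(2) by (intro lebesgue_integral_AE_eq(1)) auto
    then show ?thesis by (simp add: fokker_planck_solution_def Let_def k_def A_def)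
  qed
  then show "inversion (\<lambda>x. fokker_planck_solution C D g0 t x / f_inf x) (\<lambda>z. bargmann g (cmat (T t) z))"
    using mehler_inversion[OF norm_A[OF less_imp_le[OF t]] _ decay_less_1[OF t] exp_int]
    by (simp add: W T_def)
qed

text \<open>By symmetry of \<open>P\<close> the two summands of the Lyapunov expression have the
  same quadratic form, which removes the factor 2.\<close>

lemma loewner_le_quadratic:
  fixes C P :: "real^'n^'n"
  assumes P: "transpose P = P" and le: "loewner_le ((2 * m) *\<^sub>R P) (transpose C ** P + P ** C)"
  shows "m * (x \<bullet> (P *v x)) \<le> x \<bullet> (P *v (C *v x))"
proof -
  have "x \<bullet> ((transpose C ** P) *v x) = x \<bullet> (P *v (C *v x))"
    by (metis P inner_commute inner_matrix_transpose matrix_vector_mul_assoc transpose_transpose)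
  moreover have "0 \<le> x \<bullet> ((transpose C ** P + P ** C - (2 * m) *\<^sub>R P) *v x)"
    using le by (simp add: loewner_le_def)
  ultimately show ?thesis
    by (simp add: matrix_vector_mult_diff_rdistrib matrix_vector_mult_add_rdistrib inner_diff_right inner_add_right
        scaleR_matrix_vector_assoc[symmetric] matrix_vector_mul_assoc[symmetric])
qed

theorem theorem3p5:
  fixes C D P :: "real^'n^'n" and g0 :: "real^'n \<Rightarrow> real"
    and g :: "real \<Rightarrow> real^'n \<Rightarrow> real" and lam :: real
  assumes "positive_definite D" and "diagonal_matrix D"
    and "positive_stable C"
    and "D = (1 / 2) *\<^sub>R (C + transpose C)"
    and "weighted_L2 g0"
    and "\<And>t x. t > 0 \<Longrightarrow> g t x = fokker_planck_solution C D g0 t x"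
    and "\<And>i. (LINT x|lebesgue. g0 x * (gradient f_inf x $ i) * inverse (f_inf x)) = 0"
    and "positive_definite P"
    and "lam > 0"
    and "loewner_le ((2 * lam) *\<^sub>R P) (transpose C ** P + P ** C)"
  shows "min_eigenvalue D > 0
    \<and> (\<forall>t>0. fisher_information D (g t) < \<infinity>
         \<and> (\<exists>I'. ((\<lambda>s. enn2real (fisher_information P (g s))) has_real_derivative I') (at t)
              \<and> I' \<le> - 2 * (lam + min_eigenvalue D) * enn2real (fisher_information P (g t))))
    \<and> (\<forall>t0>0. \<forall>t\<ge>t0. fisher_information P (g t)
         \<le> fisher_information P (g t0) * ennreal (exp (- 2 * (lam + min_eigenvalue D) * (t - t0))))"
proof -
  have solution: "g t = fokker_planck_solution C D g0 t" if "t > 0" for t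
    using assms(6) that by blast
  have g0: "g0 \<in> borel_measurable lebesgue" using assms(5) by (simp add: weighted_L2_def)
  obtain h where h [measurable]: "h \<in> borel_measurable borel" and eq: "AE x in lborel. g0 x = h x"
    and wh: "integrable lborel (\<lambda>y. (h y)\<^sup>2 * exp ((norm y)\<^sup>2 / 2))"
    by (rule weighted_L2_borel_representative[OF assms(5)])
  interpret ou_flow C D h
    using assms(1,2,4) h wh by (rule ou_flow.intro)
  have "(LBINT y. y $ i * h y) = 0" for i
  proof -
    have "g0 x * (gradient f_inf x $ i) * inverse (f_inf x) = - (x $ i * g0 x)" for x
      using f_inf_pos[of x] by (simp add: gradient_f_inf)
    then have "(LINT x|lebesgue. x $ i * g0 x) = 0" using assms(7)[of i] by simp
    moreover have "(LINT x|lebesgue. x $ i * g0 x) = (LBINT y. y $ i * h y)"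
    proof (rule lebesgue_integral_AE_eq(1))
      have "(\<lambda>x. x $ i) \<in> borel_measurable (lebesgue :: (real^'n) measure)"
        by (rule measurable_completion) simp
      then show "(\<lambda>x. x $ i * g0 x) \<in> borel_measurable lebesgue"
        using g0 by (rule borel_measurable_times)
    qed (use eq in auto)
    ultimately show ?thesis by simp
  qed
  then have mean: "bargmann_grad h 0 = 0" by (rule bargmann_grad_0)
  have PC: "x \<bullet> (P *v (C *v x)) \<ge> lam * (x \<bullet> (P *v x))" for x
    using assms(8,10) by (intro loewner_le_quadratic) (auto simp: positive_definite_def)
  obtain Q :: "real^'n^'n" where Q: "P = transpose Q ** Q" using posdef_factorization[OF assms(8)] by blast
  \<comment> \<open>The energy formula holds for any factorised weight matrix; applied to
    \<open>D\<close> itself it gives the finiteness claim.\<close>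
  obtain R :: "real^'n^'n" where R: "D = transpose R ** R" using posdef_factorization[OF assms(1)] by blast
  have fisher: "fisher_information P (g s) = ennreal (energy Q s)" if "s > 0" for s
    unfolding solution[OF that] by (rule fokker_planck_fisher_information[OF g0 eq that Q])
  have finite: "fisher_information D (g s) < \<infinity>" if "s > 0" for s
    unfolding solution[OF that] fokker_planck_fisher_information[OF g0 eq that R] by simp
  have deriv: "\<exists>I'. ((\<lambda>s. enn2real (fisher_information P (g s))) has_real_derivative I') (at t)
      \<and> I' \<le> - 2 * (lam + min_eigenvalue D) * enn2real (fisher_information P (g t))" if t: "t > 0" for t
  proof -
    obtain I' where I': "(energy Q has_real_derivative I') (at t)" "I' \<le> - 2 * (lam + d) * energy Q t"
      by (rule energy_deriv_le[OF Q PC mean t])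
    have e: "enn2real (fisher_information P (g s)) = energy Q s" if "s > 0" for s
      using that energy_nonneg by (simp add: fisher)
    \<comment> \<open>The functional is identified with the energy at positive times, an open set
      containing \<open>t\<close>, and this suffices to transfer the derivative.\<close>
    have "((\<lambda>s. enn2real (fisher_information P (g s))) has_real_derivative I') (at t)"
      by (rule has_field_derivative_transform_within_open[OF I'(1), of "{0<..}"]) (use t e in auto)
    then show ?thesis using I'(2) e[OF t] d_def by auto
  qed
  have decay: "fisher_information P (g t)
      \<le> fisher_information P (g t0) * ennreal (exp (- 2 * (lam + min_eigenvalue D) * (t - t0)))"
    if t: "t0 > 0" "t \<ge> t0" for t t0
  proof -
    have "energy Q t \<le> energy Q t0 * exp (- 2 * (lam + d) * (t - t0))"
      using energy_decay[OF Q PC mean t(1), of "t - t0"] t(2) by (simp add: mult.commute)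
    then have "ennreal (energy Q t) \<le> ennreal (energy Q t0 * exp (- 2 * (lam + d) * (t - t0)))"
      by (rule ennreal_leI)
    then show ?thesis
      using t energy_nonneg[OF t(1), of Q] by (simp add: fisher ennreal_mult d_def)
  qed
  show ?thesis using d_pos finite deriv decay unfolding d_def by blast
qed

end
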